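(* The algorithm MAJORITY (described completely in the context) with very high probability uses at most $\frac{7}{6}n+o(n)$ comparisons on an input of size $n$. The expected number of comparisons it uses is also at most $\frac{7}{6}n+o(n)$.
   Context: Problem: there are $n$ balls $1,\ldots,n$, each having a color (any number of colors); the coloring is fixed in advance and unknown. The only operation on colors is a comparison $\mathsf{cmp}(x,y)$, which is true if balls $x,y$ have the same color and false otherwise. A majority color is a color of more than $\lfloor n/2\rfloor$ balls; the task is to find a ball of the majority color or to report that there is none. The number of comparisons is a random variable depending on the algorithm's random choices. "With very high probability" means with probability at least $1-\exp(-\Omega(\log^2 n))$. The algorithm is described for inputs of even size; for odd sizes it is adjusted in a straightforward manner that does not change the asymptotic cost. Below, $M$ is the list of balls given to the current call, $n=|M|$, $\alpha=\frac13$, $\varepsilon=n^{-1/10}$, $\beta=0.45$. MAJORITY($M$): If $|M|=1$, return that $M[1]$ is the majority with multiplicity 1. Otherwise take a uniformly random sample $M'\subseteq M$ (without replacement) with $|M'|=n^{\alpha}$, and by comparisons inside $M'$ (at most $O(n^{2\alpha})$ of them) find representatives $v_1,\ldots,v_k$ of the colors occurring in $M'$, where the color of $v_i$ occurs $q_i|M'|$ times in $M'$ and $q_1\ge q_2\ge\ldots\ge q_k$. If $q_1,q_2\in[\frac12-4\varepsilon,\frac12+4\varepsilon]$, return BALANCED($M$). Else, if $q_1\ge\beta$ and $q_1^2\ge q_2^2+\ldots+q_k^2+2\varepsilon$, return HEAVY($M,v_1$). Else return LIGHT($M$). BALANCED($M$): Randomly shuffle $M$; let $X,Y$ be empty lists.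 For $i=1,\ldots,|M|/2$: if $\mathsf{cmp}(M[2i-1],M[2i])$ is true, append $M[2i]$ to $X$; otherwise append $M[2i-1]$ and $M[2i]$ to $Y$. Run MAJORITY($X$). If there is no majority in $X$, return "no majority in $M$". Otherwise let the color of $v$ be the majority in $X$, with multiplicity $k$ in $X$, and set $\mathsf{cnt}=2k$. For $i=1,\ldots,|Y|/2$: if $\mathsf{cmp}(v,Y[2i-1])$ is true, increase $\mathsf{cnt}$ by 1; else, if $\mathsf{cmp}(v,Y[2i])$ is true, increase $\mathsf{cnt}$ by 1. If $\mathsf{cnt}\le|M|/2$, return "no majority in $M$"; otherwise return that the color of $v$ is the majority in $M$ with multiplicity $\mathsf{cnt}$. HEAVY($M,v$): Set $\mathsf{cnt}=0$ and let $X$ be an empty list. For $i=1,\ldots,|M|$: if $\mathsf{cmp}(v,M[i])$ is true, increase $\mathsf{cnt}$ by 1; otherwise append $M[i]$ to $X$. If $\mathsf{cnt}>|M|/2$, return that the color of $v$ is the majority in $M$ with multiplicity $\mathsf{cnt}$. Otherwise set $k=|M|/2-\mathsf{cnt}$ and randomly shuffle $X$. For $i=1,\ldots,|X|/2$: if $\mathsf{cmp}(X[2i-1],X[2i])$ is false, decrease $k$ by 1; if $k\le 0$, return "no majority in $M$". If the loop ends without returning, run the Boyer–Moore algorithm on $M$ and return its answer. (Boyer–Moore: sweep through the input maintaining a candidate and a counter, increasing the counter when the next ball has the candidate's color and decreasing it otherwise, replacing the candidate by the next ball when the counter drops to zero; then count the occurrences of the final candidate's color. It uses at most $2n$ comparisons.)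 LIGHT($M$): Form $X$ and $Y$ from a random shuffle of $M$ exactly as in BALANCED and run MAJORITY($X$). If there is no majority in $X$, return "no majority in $M$". Otherwise let the color of $v$ be the majority in $X$, with multiplicity $k$ in $X$, and set $\mathsf{cnt}=2k-|X|$. For $i=1,\ldots,|Y|/2$: if $\mathsf{cmp}(v,Y[2i-1])$ is false, then also compare $v$ with $Y[2i]$, and if $\mathsf{cmp}(v,Y[2i])$ is false as well, decrease $\mathsf{cnt}$ by 1; if $\mathsf{cnt}=0$, return "no majority in $M$". If the loop ends without returning, return that the color of $v$ is the majority in $M$ with multiplicity $|M|/2+\mathsf{cnt}$. *)

theory Defs
  imports "HOL-Probability.Probability" "HOL-Library.Landau_Symbols"
begin

section \<open>Randomized comparison programs\<close>

text \<open>
  A program is a randomized decision tree. Its only access to the (unknown) coloring is through the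
  answers to the comparisons in its \<open>Compare\<close> nodes; \<open>Random\<close> draws the program to continue with.
\<close>

type_synonym ball = nat

datatype 'r prog =
    Return 'r
  | Compare ball ball "bool \<Rightarrow> 'r prog"
  | Random "'r prog pmf"

primrec bind_prog :: "'a prog \<Rightarrow> ('a \<Rightarrow> 'b prog) \<Rightarrow> 'b prog" where
  "bind_prog (Return x) f = f x"
| "bind_prog (Compare x y g) f = Compare x y (\<lambda>b. bind_prog (g b) f)"
| "bind_prog (Random p) f = Random (map_pmf (\<lambda>m. bind_prog m f) p)"

adhoc_overloading Monad_Syntax.bind \<rightleftharpoons> bind_prog

lemma bind_prog_cong [fundef_cong]:
  assumes "m = n" and "\<And>x. x \<in> set_prog n \<Longrightarrow> f x = g x"
  shows "bind_prog m f = bind_prog n g"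
proof -
  have "bind_prog n f = bind_prog n g"
    using assms(2) by (induction n) (auto intro!: pmf.map_cong)
  with assms(1) show ?thesis by simp
qed

lemma set_bind_prog: "set_prog (bind_prog m f) = (\<Union>x\<in>set_prog m. set_prog (f x))"
  by (induction m) auto

text \<open>The joint distribution of the result and the number of comparisons for a given coloring:\<close>

primrec run :: "(ball \<Rightarrow> 'c) \<Rightarrow> 'r prog \<Rightarrow> ('r \<times> nat) pmf" where
  "run col (Return r) = return_pmf (r, 0)"
| "run col (Compare x y g) = map_pmf (\<lambda>(r, c). (r, Suc c)) (run col (g (col x = col y)))"
| "run col (Random p) = join_pmf (map_pmf (run col) p)"

lemma run_Random: "run col (Random p) = bind_pmf p (run col)"
  by (simp add: bind_map_pmf join_eq_bind_pmf)

definition cmp :: "ball \<Rightarrow> ball \<Rightarrow> bool prog" where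
  "cmp x y = Compare x y Return"

text \<open>
  Only lists of pairwise distinct balls are ever shuffled, so that the uniform distribution on the
  arrangements of a list is that of a uniformly random permutation of it.
\<close>

definition shuffle :: "ball list \<Rightarrow> ball list prog" where
  "shuffle xs = Random (map_pmf Return (pmf_of_set (permutations_of_multiset (mset xs))))"

text \<open>A uniformly random sample of size \<open>s\<close> without replacement (in random order):\<close>

definition sample :: "nat \<Rightarrow> ball list \<Rightarrow> ball list prog" where
  "sample s xs = do { ys \<leftarrow> shuffle xs; Return (take s ys) }"

section \<open>The algorithm\<close>

text \<open>
  The answer \<open>Some (v, k)\<close> means that the color of \<open>v\<close> is the majority, with multiplicity \<open>k\<close>; the
  answer \<open>None\<close> means that there is no majority.
\<close>

type_synonym answer = "(ball \<times> nat) option"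

subsection \<open>Colors of the sample\<close>

text \<open>
  A color class is given by a representative and the number of balls seen so far. A new ball is
  compared with the known representatives, one after the other, until its color is found.
\<close>

fun add_ball :: "ball \<Rightarrow> (ball \<times> nat) list \<Rightarrow> (ball \<times> nat) list prog" where
  "add_ball x [] = Return [(x, 1)]"
| "add_ball x ((v, c) # cs) = do {
     same \<leftarrow> cmp v x;
     if same then Return ((v, c + 1) # cs)
     else do { cs' \<leftarrow> add_ball x cs; Return ((v, c) # cs') }
   }"

fun color_classes :: "ball list \<Rightarrow> (ball \<times> nat) list \<Rightarrow> (ball \<times> nat) list prog" where
  "color_classes [] cs = Return cs"
| "color_classes (x # xs) cs = do { cs' \<leftarrow> add_ball x cs; color_classes xs cs' }"

definition sorted_classes :: "ball list \<Rightarrow> (ball \<times> nat) list prog" where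
  "sorted_classes xs = do { cs \<leftarrow> color_classes xs []; Return (rev (sort_key snd cs)) }"

text \<open>
  In the following two conditions, \<open>n\<close> is the size of the current input and \<open>qs\<close> is the nonempty
  list of the frequencies \<open>q\<^sub>1 \<ge> \<dots> \<ge> q\<^sub>k\<close> in the sample; if \<open>k = 1\<close>, then \<open>q\<^sub>2\<close> is read as \<open>0\<close>.
\<close>

definition eps :: "nat \<Rightarrow> real" where
  "eps n = real n powr (- 1 / 10)"

definition balanced_case :: "nat \<Rightarrow> real list \<Rightarrow> bool" where
  "balanced_case n qs \<longleftrightarrow>
     (let q1 = hd qs; q2 = (if length qs \<ge> 2 then qs ! 1 else 0); I = {1/2 - 4 * eps n..1/2 + 4 * eps n}
      in q1 \<in> I \<and> q2 \<in> I)"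

definition heavy_case :: "nat \<Rightarrow> real list \<Rightarrow> bool" where
  "heavy_case n qs \<longleftrightarrow>
     hd qs \<ge> 0.45 \<and> (hd qs)\<^sup>2 \<ge> (\<Sum>q\<leftarrow>tl qs. q\<^sup>2) + 2 * eps n"

subsection \<open>Boyer--Moore\<close>

text \<open>\<open>count_color v M\<close> yields the number of balls of the color of \<open>v\<close> and the list of the others.\<close>

fun count_color :: "ball \<Rightarrow> ball list \<Rightarrow> (nat \<times> ball list) prog" where
  "count_color v [] = Return (0, [])"
| "count_color v (x # xs) = do {
     same \<leftarrow> cmp v x;
     (cnt, X) \<leftarrow> count_color v xs;
     Return (if same then (cnt + 1, X) else (cnt, x # X))
   }"

fun sweep :: "ball \<Rightarrow> nat \<Rightarrow> ball list \<Rightarrow> ball prog" where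
  "sweep v k [] = Return v"
| "sweep v k (x # xs) =
     (if k = 0 then sweep x 1 xs
      else do { same \<leftarrow> cmp v x; sweep v (if same then k + 1 else k - 1) xs })"

fun boyer_moore :: "ball list \<Rightarrow> answer prog" where
  "boyer_moore [] = Return None"
| "boyer_moore (x # xs) = do {
     v \<leftarrow> sweep x 1 xs;
     (cnt, _) \<leftarrow> count_color v (x # xs);
     Return (if 2 * cnt > length (x # xs) then Some (v, cnt) else None)
   }"

subsection \<open>The heavy case\<close>

text \<open>
  The counter is real, since \<open>|M|/2\<close> is a half-integer for odd \<open>|M|\<close>. The result says whether the
  loop has found out that there is no majority.
\<close>

fun heavy_loop :: "ball list \<Rightarrow> real \<Rightarrow> bool prog" where
  "heavy_loop (a # b # X) k = do {
     same \<leftarrow> cmp a b;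
     let k' = (if same then k else k - 1);
     if k' \<le> 0 then Return True else heavy_loop X k'
   }"
| "heavy_loop _ k = Return False"

definition heavy :: "ball list \<Rightarrow> ball \<Rightarrow> answer prog" where
  "heavy M v = do {
     (cnt, X) \<leftarrow> count_color v M;
     if 2 * cnt > length M then Return (Some (v, cnt))
     else do {
       X' \<leftarrow> shuffle X;
       stop \<leftarrow> heavy_loop X' (real (length M) / 2 - real cnt);
       if stop then Return None else boyer_moore M
     }
   }"

subsection \<open>The balanced and the light case\<close>

fun pair_up :: "ball list \<Rightarrow> (ball list \<times> ball list) prog" where
  "pair_up (a # b # M) = do {
     same \<leftarrow> cmp a b;
     (X, Y) \<leftarrow> pair_up M;
     Return (if same then (b # X, Y) else (X, a # b # Y))
   }"
| "pair_up _ = Return ([], [])"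

text \<open>
  Inputs of odd size: the last ball \<open>z\<close> of the shuffled list remains unpaired. The recursive call is
  made on the list \<open>X\<close> from the pairs if \<open>|X|\<close> is odd and on \<open>X\<close> together with \<open>z\<close> if \<open>|X|\<close> is even; in
  both cases a majority color of \<open>M\<close> is also a majority color of the list for the recursive call.
  For inputs of even size the recursive call is made on \<open>X\<close>.
\<close>

definition unpaired :: "ball list \<Rightarrow> ball list" where
  "unpaired M = (if odd (length M) then [last M] else [])"

definition rec_input :: "ball list \<Rightarrow> ball list \<Rightarrow> ball list" where
  "rec_input M X = (if even (length X) then X @ unpaired M else X)"

text \<open>
  From the multiplicity \<open>k\<close> of the color of \<open>v\<close> in \<open>rec_input M X\<close>, find its multiplicity in \<open>X\<close> and
  its multiplicity (\<open>0\<close> or \<open>1\<close>) in \<open>unpaired M\<close>, by at most one comparison and by none if \<open>|M|\<close> is even.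
\<close>

definition split_count :: "ball list \<Rightarrow> ball list \<Rightarrow> ball \<Rightarrow> nat \<Rightarrow> (nat \<times> nat) prog" where
  "split_count M X v k =
     (case unpaired M of
        [] \<Rightarrow> Return (k, 0)
      | z # _ \<Rightarrow> do {
          same \<leftarrow> cmp v z;
          Return (if \<not> same then (k, 0) else if even (length X) then (k - 1, 1) else (k, 1))
        })"

fun balanced_loop :: "ball \<Rightarrow> ball list \<Rightarrow> nat \<Rightarrow> nat prog" where
  "balanced_loop v (a # b # Y) cnt = do {
     same1 \<leftarrow> cmp v a;
     if same1 then balanced_loop v Y (cnt + 1)
     else do {
       same2 \<leftarrow> cmp v b;
       balanced_loop v Y (if same2 then cnt + 1 else cnt)
     }
   }"
| "balanced_loop v _ cnt = Return cnt"

text \<open>\<open>None\<close> means that the counter has dropped to \<open>0\<close>.\<close>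

fun light_loop :: "ball \<Rightarrow> ball list \<Rightarrow> int \<Rightarrow> int option prog" where
  "light_loop v (a # b # Y) cnt = do {
     same1 \<leftarrow> cmp v a;
     cnt' \<leftarrow> (if same1 then Return cnt
             else do { same2 \<leftarrow> cmp v b; Return (if same2 then cnt else cnt - 1) });
     if cnt' = 0 then Return None else light_loop v Y cnt'
   }"
| "light_loop v _ cnt = Return (Some cnt)"

subsection \<open>The recursive procedures\<close>

text \<open>
  An empty list, which may occur as the argument of a recursive call, has no majority. For odd \<open>|M|\<close>
  the color of \<open>v\<close> is the majority in \<open>M\<close> iff the final counter in \<open>light\<close> is positive, and its
  multiplicity then exceeds \<open>\<lfloor>|M|/2\<rfloor>\<close> by this counter.
\<close>

function majority :: "ball list \<Rightarrow> answer prog"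
  and balanced :: "ball list \<Rightarrow> answer prog"
  and light :: "ball list \<Rightarrow> answer prog"
where
  "majority M =
     (if M = [] then Return None
      else if length M = 1 then Return (Some (hd M, 1))
      else do {
        let s = nat \<lfloor>real (length M) powr (1 / 3)\<rfloor>;
        M' \<leftarrow> sample s M;
        cs \<leftarrow> sorted_classes M';
        let qs = map (\<lambda>(v, c). real c / real s) cs;
        if balanced_case (length M) qs then balanced M
        else if heavy_case (length M) qs then heavy M (fst (hd cs))
        else light M
      })"
| "balanced M = do {
     M' \<leftarrow> shuffle M;
     (X, Y) \<leftarrow> pair_up M';
     ans \<leftarrow> majority (rec_input M' X);
     case ans of
       None \<Rightarrow> Return None
     | Some (v, k) \<Rightarrow> do {
         (kX, kz) \<leftarrow> split_count M' X v k;
         cnt \<leftarrow> balanced_loop v Y (2 * kX + kz);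
         Return (if 2 * cnt \<le> length M then None else Some (v, cnt))
       }
   }"
| "light M = do {
     M' \<leftarrow> shuffle M;
     (X, Y) \<leftarrow> pair_up M';
     ans \<leftarrow> majority (rec_input M' X);
     case ans of
       None \<Rightarrow> Return None
     | Some (v, k) \<Rightarrow> do {
         (kX, kz) \<leftarrow> split_count M' X v k;
         r \<leftarrow> light_loop v Y (2 * int kX - int (length X) + int kz);
         case r of
           None \<Rightarrow> Return None
         | Some cnt \<Rightarrow> Return (Some (v, nat (int (length M div 2) + cnt)))
       }
   }"
  by pat_completeness auto

lemma length_shuffle: "M' \<in> set_prog (shuffle M) \<Longrightarrow> length M' = length M"
  by (auto simp: shuffle_def dest!: permutations_of_multisetD mset_eq_length)

lemma length_pair_up: "(X, Y) \<in> set_prog (pair_up M) \<Longrightarrow> length X \<le> length M div 2"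
proof (induction M arbitrary: X Y rule: pair_up.induct)
  case (1 a b M)
  then show ?case
    by (fastforce simp: set_bind_prog cmp_def split: if_splits)
qed auto

lemma length_rec_input:
  assumes "M' \<in> set_prog (shuffle M)" "(X, Y) \<in> set_prog (pair_up M')"
  shows "length (rec_input M' X) \<le> (length M + 1) div 2"
  using length_shuffle[OF assms(1)] length_pair_up[OF assms(2)]
  by (auto simp: rec_input_def unpaired_def elim!: oddE)

termination
proof (relation "inv_image less_than (\<lambda>x. case x of
    Inl M \<Rightarrow> if length M \<le> 1 then 0 else 2 * length M + 1
  | Inr (Inl M) \<Rightarrow> if length M \<le> 1 then 1 else 2 * length M
  | Inr (Inr M) \<Rightarrow> if length M \<le> 1 then 1 else 2 * length M)", goal_cases)
  case (4 M M' p X Y)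
  then show ?case
    using length_rec_input[of M' M X Y] by auto
next
  case (5 M M' p X Y)
  then show ?case
    using length_rec_input[of M' M X Y] by auto
qed (auto simp: neq_Nil_conv)

declare majority.simps [simp del] balanced.simps [simp del] light.simps [simp del]

section \<open>The number of comparisons\<close>

text \<open>The distribution of the number of comparisons on the balls \<open>1, \<dots>, n\<close> with the given coloring:\<close>

definition comparisons :: "(ball \<Rightarrow> nat) \<Rightarrow> nat \<Rightarrow> nat pmf" where
  "comparisons col n = map_pmf snd (run col (majority [1..<n + 1]))"

lemma run_bind:
  "run col (bind_prog m f) =
     bind_pmf (run col m) (\<lambda>(x, c). map_pmf (\<lambda>(r, d). (r, c + d)) (run col (f x)))"
proof (induction m)
  case (Return x)
  then show ?case by (simp add: bind_return_pmf)
next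
  case (Compare x y g)
  then show ?case
    by (simp add: map_bind_pmf bind_map_pmf pmf.map_comp case_prod_beta comp_def)
next
  case (Random p)
  then show ?case
    by (simp add: run_Random bind_map_pmf bind_assoc_pmf del: run.simps cong: bind_pmf_cong_simp)
qed

text \<open>Only finitely many runs are possible, so that the expected number of comparisons exists.\<close>

lemma run_results: "(x, c) \<in> set_pmf (run col m) \<Longrightarrow> x \<in> set_prog m"
  by (induction m arbitrary: x c) (force simp: run_Random simp del: run.simps(3))+

lemma finite_run_bind:
  assumes "finite (set_pmf (run col m))"
    and "\<And>x. x \<in> set_prog m \<Longrightarrow> finite (set_pmf (run col (f x)))"
  shows "finite (set_pmf (run col (bind_prog m f)))"
  using assms by (auto simp: run_bind dest: run_results)

lemma finite_run_shuffle: "finite (set_pmf (run col (shuffle xs)))"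
  by (simp add: shuffle_def run_Random bind_map_pmf del: run.simps(3))

lemma finite_run_cmp: "finite (set_pmf (run col (cmp x y)))"
  by (simp add: cmp_def)

lemma finite_run_If:
  "(b \<Longrightarrow> finite (set_pmf (run col m))) \<Longrightarrow> (\<not> b \<Longrightarrow> finite (set_pmf (run col m'))) \<Longrightarrow>
     finite (set_pmf (run col (if b then m else m')))"
  by simp

lemma finite_run_Return: "finite (set_pmf (run col (Return x)))"
  by simp

lemmas finite_run = finite_run_Return finite_run_cmp finite_run_shuffle finite_run_If finite_run_bind

lemma finite_run_add_ball: "finite (set_pmf (run col (add_ball x cs)))"
  by (induction x cs rule: add_ball.induct) (auto intro!: finite_run simp del: run.simps)

lemma finite_run_color_classes: "finite (set_pmf (run col (color_classes xs cs)))"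
  by (induction xs cs rule: color_classes.induct)
     (auto intro!: finite_run finite_run_add_ball simp del: run.simps)

lemma finite_run_count_color: "finite (set_pmf (run col (count_color v xs)))"
  by (induction v xs rule: count_color.induct) (auto intro!: finite_run simp del: run.simps)

lemma finite_run_sweep: "finite (set_pmf (run col (sweep v k xs)))"
  by (induction v k xs rule: sweep.induct) (auto intro!: finite_run simp del: run.simps)

lemma finite_run_boyer_moore: "finite (set_pmf (run col (boyer_moore xs)))"
  by (cases xs) (auto intro!: finite_run finite_run_sweep finite_run_count_color
                      simp del: run.simps count_color.simps)

lemma finite_run_heavy_loop: "finite (set_pmf (run col (heavy_loop X k)))"
  by (induction X k rule: heavy_loop.induct)
     (auto intro!: finite_run simp: Let_def simp del: run.simps)

lemma finite_run_heavy: "finite (set_pmf (run col (heavy M v)))"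
  by (auto simp: heavy_def simp del: run.simps
           intro!: finite_run finite_run_count_color finite_run_heavy_loop finite_run_boyer_moore)

lemma finite_run_pair_up: "finite (set_pmf (run col (pair_up M)))"
  by (induction M rule: pair_up.induct) (auto intro!: finite_run simp del: run.simps)

lemma finite_run_split_count: "finite (set_pmf (run col (split_count M X v k)))"
  by (auto simp: split_count_def simp del: run.simps intro!: finite_run split: list.split)

lemma finite_run_balanced_loop: "finite (set_pmf (run col (balanced_loop v Y cnt)))"
  by (induction v Y cnt rule: balanced_loop.induct)
     (auto intro!: finite_run simp del: run.simps)

lemma finite_run_light_loop: "finite (set_pmf (run col (light_loop v Y cnt)))"
  by (induction v Y cnt rule: light_loop.induct)
     (auto intro!: finite_run simp del: run.simps)

lemma finite_run_majority:
  "finite (set_pmf (run col (majority M)))"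
  "finite (set_pmf (run col (balanced M)))"
  "finite (set_pmf (run col (light M)))"
proof (induction M and M and M rule: majority_balanced_light.induct)
  case (1 M)
  then show ?case
    by (subst majority.simps, unfold Let_def sample_def sorted_classes_def)
       (intro finite_run finite_run_color_classes finite_run_heavy; blast)
next
  case (2 M)
  show ?case
    by (subst balanced.simps)
       (auto simp del: run.simps split: option.split
             intro!: finite_run finite_run_pair_up finite_run_split_count finite_run_balanced_loop 2)
next
  case (3 M)
  show ?case
    by (subst light.simps)
       (auto simp del: run.simps split: option.split
             intro!: finite_run finite_run_pair_up finite_run_split_count finite_run_light_loop 3)
qed

lemma finite_comparisons: "finite (set_pmf (comparisons col n))"
  by (simp add: comparisons_def finite_run_majority)

end

(*
  Every random choice is a uniformly random permutation, and all quantities of interest are Lipschitz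
  under transpositions, so by a martingale argument they are within n^(-1/10) or better of their means
  except with probability exp(-n^c). For color frequencies p_i and S = sum p_i^2, the pairing costs
  n/2 comparisons and leaves a list of about S n/2 balls for the recursive call. A candidate color of
  frequency p that is the majority there satisfies 2 p^2 >= S up to errors. This and the outcome of
  the sampling bound the cost of the final loop such that the total for a fixed coloring is at most
  7/6 n, given that the recursive call costs at most 7/6 of its input size; the extreme case is that of
  two colors of frequency 1/2, where 7/6 n = n/2 + 7/6 n/4 + 3/8 n. For each kappa > 0 the errors on
  inputs of more than sqrt n balls sum up to at most kappa n for large n, and calls on fewer balls
  contribute O(sqrt n) since the worst case is linear.
*)
theory Submission
  imports Defs "HOL-Real_Asymp.Real_Asymp"
begin

section \<open>Concentration for uniformly random permutations\<close>

text \<open>The obstacle is that the candidate of a pairing round is known only after the recursive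
  call, which itself depends on the shuffle. The concentration event therefore covers all colors of
  the list at once, with a stopping time fixed in advance for each of them, and the recursive bound
  is proved for every list of distinct balls. Any sound answer of the recursive call can then be
  handled deterministically. Answers are tracked only one-sidedly: \<open>None\<close> ends a call
  without a final loop, so it suffices that \<open>Some\<close> is always right. The tolerance
  \<open>\<delta>\<close> is a constant and not a vanishing function, which keeps the inequalities
  free of asymptotics. The claim for m balls is (7/6 + 4000 * \<delta>) * m + D. The recursive call
  gets at most about half of the balls, so its share of the \<delta>-term is about 2000 * \<delta> *
  m, and the rest pays for the errors of the current level; \<open>D\<close> passes unchanged
  through the only recursive call of a level.\<close>

definition uperm :: "'a set \<Rightarrow> 'a list pmf" where
  "uperm A = pmf_of_set (permutations_of_set A)"

abbreviation expct :: "'a pmf \<Rightarrow> ('a \<Rightarrow> real) \<Rightarrow> real" where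
  "expct \<equiv> measure_pmf.expectation"

lemma set_uperm: "finite A \<Longrightarrow> set_pmf (uperm A) = permutations_of_set A"
  by (simp add: uperm_def)

lemma uperm_Cons:
  assumes "finite A" "A \<noteq> {}"
  shows "uperm A = bind_pmf (pmf_of_set A) (\<lambda>x. map_pmf ((#) x) (uperm (A - {x})))"
  unfolding uperm_def by (subst random_permutation_of_set[OF assms]) (simp add: map_pmf_def)

lemma expct_uperm_Cons:
  fixes F :: "'a list \<Rightarrow> real"
  assumes "finite A" "A \<noteq> {}"
  shows "expct (uperm A) F = expct (pmf_of_set A) (\<lambda>x. expct (uperm (A - {x})) (\<lambda>ys. F (x # ys)))"
  unfolding uperm_Cons[OF assms]
  by (subst pmf_expectation_bind[where A = A])
     (use assms in \<open>auto simp: set_uperm integral_pmf_of_set sum_divide_distrib\<close>)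

text \<open>The coupling behind the martingale differences: exchanging the names \<open>x\<close>
  and \<open>y\<close> turns the arrangements of what is left after drawing \<open>x\<close> into
  those of what is left after drawing \<open>y\<close>.\<close>

lemma map_transpose_uperm:
  assumes "finite A" "x \<in> A" "y \<in> A"
  shows "map_pmf (map (Transposition.transpose x y)) (uperm (A - {x})) = uperm (A - {y})"
proof -
  have im: "Transposition.transpose x y ` (A - {x}) = A - {y}"
    using assms by (auto simp: Transposition.transpose_def image_iff split: if_splits)
  have "permutations_of_set (A - {y}) = map (Transposition.transpose x y) ` permutations_of_set (A - {x})"
    unfolding im[symmetric] by (rule permutations_of_set_image_inj) (auto intro: inj_on_subset)
  moreover have "inj_on (map (Transposition.transpose x y)) (permutations_of_set (A - {x}))"
    by (rule inj_on_subset[OF _ subset_UNIV]) simp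
  ultimately show ?thesis
    unfolding uperm_def using assms(1) by (subst map_pmf_of_set_inj) auto
qed

text \<open>Hoeffding's lemma in oscillation form. The coupling bounds differences of conditional
  means but names no interval; the extreme values on the finite support span one of length at most
  \<open>c\<close>.\<close>

lemma Hoeffding_pmf:
  fixes g :: "'a \<Rightarrow> real"
  assumes fin: "finite (set_pmf p)" and "\<And>x y. x \<in> set_pmf p \<Longrightarrow> y \<in> set_pmf p \<Longrightarrow> \<bar>g x - g y\<bar> \<le> c"
    and l: "l > 0"
  shows "expct p (\<lambda>x. exp (l * (g x - expct p g))) \<le> exp (l\<^sup>2 * c\<^sup>2 / 8)"
proof -
  define a where "a = Min (g ` set_pmf p)"
  define b where "b = Max (g ` set_pmf p)"
  have ne: "set_pmf p \<noteq> {}" by (rule set_pmf_not_empty)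
  have ab: "b - a \<le> c" "a \<le> b"
  proof -
    have "a \<in> g ` set_pmf p" "b \<in> g ` set_pmf p"
      unfolding a_def b_def using fin ne by auto
    then obtain x y where xy: "x \<in> set_pmf p" "y \<in> set_pmf p" "a = g x" "b = g y" by auto
    with assms(2)[of y x] show "b - a \<le> c" by auto
    show "a \<le> b" unfolding a_def using xy fin by (intro Min_le) auto
  qed
  interpret interval_bounded_random_variable "measure_pmf p" g a b
    by unfold_locales (auto simp: AE_measure_pmf_iff a_def b_def fin)
  have "ennreal (expct p (\<lambda>x. exp (l * (g x - expct p g)))) = nn_integral p (\<lambda>x. exp (l * (g x - expct p g)))"
    by (rule nn_integral_eq_integral[symmetric]) (auto intro: integrable_measure_pmf_finite fin)
  also have "\<dots> \<le> ennreal (exp (l\<^sup>2 * (b - a)\<^sup>2 / 8))"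
    using Hoeffdings_lemma_nn_integral[OF l] by simp
  finally have "expct p (\<lambda>x. exp (l * (g x - expct p g))) \<le> exp (l\<^sup>2 * (b - a)\<^sup>2 / 8)"
    by (subst (asm) ennreal_le_iff) auto
  also have "\<dots> \<le> exp (l\<^sup>2 * c\<^sup>2 / 8)"
    using ab by (auto intro!: divide_right_mono mult_left_mono power_mono)
  finally show ?thesis .
qed

lemma expct_mono: "finite (set_pmf p) \<Longrightarrow> (\<And>x. x \<in> set_pmf p \<Longrightarrow> f x \<le> g x) \<Longrightarrow> expct p f \<le> expct p g"
  by (rule integral_mono_AE) (auto intro: integrable_measure_pmf_finite simp: AE_measure_pmf_iff)

lemma expct_cong: "(\<And>x. x \<in> set_pmf p \<Longrightarrow> f x = g x) \<Longrightarrow> expct p f = expct p g"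
  by (rule integral_cong_AE) (auto simp: AE_measure_pmf_iff)

text \<open>
  Azuma's argument: reveal the permutation one entry at a time and apply Hoeffding's lemma to the
  conditional expectation given the first entry. Transposing \<open>x\<close> and \<open>y\<close> couples the permutations
  that start with \<open>x\<close> with those that start with \<open>y\<close>. Only the first \<open>k\<close> entries contribute.
\<close>

lemma uperm_mgf:
  fixes F :: "'a list \<Rightarrow> real"
  assumes "finite A" and "l > 0"
    and "\<And>us x y. us \<in> permutations_of_set A \<Longrightarrow> x \<in> A \<Longrightarrow> y \<in> A \<Longrightarrow> \<bar>F us - F (map (Transposition.transpose x y) us)\<bar> \<le> c"
    and "\<And>us vs. us \<in> permutations_of_set A \<Longrightarrow> vs \<in> permutations_of_set A \<Longrightarrow> take k us = take k vs \<Longrightarrow> F us = F vs"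
  shows "expct (uperm A) (\<lambda>us. exp (l * (F us - expct (uperm A) F))) \<le> exp (l\<^sup>2 * c\<^sup>2 / 8 * real k)"
  using assms(1,3,4)
proof (induction k arbitrary: A F)
  case 0
  obtain v where v: "v \<in> permutations_of_set A"
    using 0(1) by (metis all_not_in_conv permutations_of_set_empty_iff)
  have "F us = F v" if "us \<in> permutations_of_set A" for us
    using 0(3)[OF that v] by simp
  note const = this
  have "expct (uperm A) F = expct (uperm A) (\<lambda>_. F v)"
    by (intro expct_cong const) (simp add: set_uperm 0(1))
  hence "expct (uperm A) F = F v" by simp
  hence "expct (uperm A) (\<lambda>us. exp (l * (F us - expct (uperm A) F))) = expct (uperm A) (\<lambda>us. 1)"
  proof (intro expct_cong)
    fix us assume "us \<in> set_pmf (uperm A)"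
    hence "F us = F v" by (intro const) (simp add: set_uperm 0(1))
    thus "exp (l * (F us - expct (uperm A) F)) = 1"
      unfolding \<open>expct (uperm A) F = F v\<close> by simp
  qed
  then show ?case by simp
next
  case (Suc k)
  show ?case
  proof (cases "A = {}")
    case True
    then show ?thesis by (simp add: uperm_def pmf_of_set_singleton)
  next
    case False
    let ?g = "\<lambda>x. expct (uperm (A - {x})) (\<lambda>ys. F (x # ys))"
    let ?E = "expct (uperm A) F"
    have perm: "x # us \<in> permutations_of_set A" if "x \<in> A" "us \<in> permutations_of_set (A - {x})" for x us
      using that by (auto simp: permutations_of_set_def)
    have inner: "expct (uperm (A - {x})) (\<lambda>us. exp (l * (F (x # us) - ?g x))) \<le> exp (l\<^sup>2 * c\<^sup>2 / 8 * real k)"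
      if x: "x \<in> A" for x
    proof (rule Suc.IH)
      show "finite (A - {x})" using Suc.prems(1) by simp
    next
      fix us y z
      assume us: "us \<in> permutations_of_set (A - {x})" and yz: "y \<in> A - {x}" "z \<in> A - {x}"
      hence "map (Transposition.transpose y z) (x # us) = x # map (Transposition.transpose y z) us"
        by (auto simp: Transposition.transpose_def)
      thus "\<bar>F (x # us) - F (x # map (Transposition.transpose y z) us)\<bar> \<le> c"
        using Suc.prems(2)[OF perm[OF x us], of y z] yz by simp
    next
      fix us vs
      assume "us \<in> permutations_of_set (A - {x})" "vs \<in> permutations_of_set (A - {x})" "take k us = take k vs"
      thus "F (x # us) = F (x # vs)"
        by (intro Suc.prems(3) perm x) auto
    qed
    have E: "?E = expct (pmf_of_set A) ?g"
      by (rule expct_uperm_Cons[OF Suc.prems(1) False])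
    have lip: "\<bar>?g x - ?g y\<bar> \<le> c" if "x \<in> A" "y \<in> A" for x y
    proof -
      have fs: "finite (set_pmf (uperm (A - {x})))" using Suc.prems(1) by (simp add: set_uperm)
      have "?g y = expct (uperm (A - {x})) (\<lambda>ys. F (map (Transposition.transpose x y) (x # ys)))"
        by (subst map_transpose_uperm[OF Suc.prems(1) that, symmetric]) simp
      hence "?g x - ?g y = expct (uperm (A - {x})) (\<lambda>ys. F (x # ys) - F (map (Transposition.transpose x y) (x # ys)))"
        by (simp add: Bochner_Integration.integral_diff integrable_measure_pmf_finite fs)
      also have "\<bar>\<dots>\<bar> \<le> expct (uperm (A - {x})) (\<lambda>ys. \<bar>F (x # ys) - F (map (Transposition.transpose x y) (x # ys))\<bar>)"
        by (rule integral_abs_bound)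
      also have "\<dots> \<le> expct (uperm (A - {x})) (\<lambda>ys. c)"
        using Suc.prems(1) that by (intro expct_mono fs Suc.prems(2) perm) (auto simp: set_uperm)
      finally show ?thesis by simp
    qed
    have "expct (uperm A) (\<lambda>us. exp (l * (F us - ?E))) =
       expct (pmf_of_set A) (\<lambda>x. expct (uperm (A - {x})) (\<lambda>us. exp (l * (F (x # us) - ?E))))"
      by (rule expct_uperm_Cons[OF Suc.prems(1) False])
    also have "\<dots> = expct (pmf_of_set A) (\<lambda>x. exp (l * (?g x - ?E)) * expct (uperm (A - {x})) (\<lambda>us. exp (l * (F (x # us) - ?g x))))"
    proof (intro expct_cong)
      fix x
      have "exp (l * (F (x # us) - ?E)) = exp (l * (?g x - ?E)) * exp (l * (F (x # us) - ?g x))" for us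
        unfolding exp_add[symmetric] by (simp add: algebra_simps)
      thus "expct (uperm (A - {x})) (\<lambda>us. exp (l * (F (x # us) - ?E))) =
        exp (l * (?g x - ?E)) * expct (uperm (A - {x})) (\<lambda>us. exp (l * (F (x # us) - ?g x)))"
        by simp
    qed
    also have "\<dots> \<le> expct (pmf_of_set A) (\<lambda>x. exp (l * (?g x - ?E)) * exp (l\<^sup>2 * c\<^sup>2 / 8 * real k))"
      using False Suc.prems(1) by (intro expct_mono mult_left_mono inner) auto
    also have "\<dots> = expct (pmf_of_set A) (\<lambda>x. exp (l * (?g x - ?E))) * exp (l\<^sup>2 * c\<^sup>2 / 8 * real k)"
      by simp
    also have "\<dots> \<le> exp (l\<^sup>2 * c\<^sup>2 / 8) * exp (l\<^sup>2 * c\<^sup>2 / 8 * real k)"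
      unfolding E using False Suc.prems(1)
      by (intro mult_right_mono Hoeffding_pmf lip assms(2)) auto
    also have "\<dots> = exp (l\<^sup>2 * c\<^sup>2 / 8 * real (Suc k))"
      unfolding exp_add[symmetric] by (simp add: algebra_simps)
    finally show ?thesis .
  qed
qed

lemma uperm_tail:
  fixes F :: "'a list \<Rightarrow> real"
  assumes "finite A" and "r > 0" "k > 0" "c > 0"
    and "\<And>us x y. us \<in> permutations_of_set A \<Longrightarrow> x \<in> A \<Longrightarrow> y \<in> A \<Longrightarrow> \<bar>F us - F (map (Transposition.transpose x y) us)\<bar> \<le> c"
    and "\<And>us vs. us \<in> permutations_of_set A \<Longrightarrow> vs \<in> permutations_of_set A \<Longrightarrow> take k us = take k vs \<Longrightarrow> F us = F vs"
  shows "measure_pmf.prob (uperm A) {us. F us \<ge> expct (uperm A) F + r} \<le> exp (- (2 * r\<^sup>2 / (c\<^sup>2 * real k)))"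
proof -
  \<comment> \<open>The minimizer of \<open>- l * r + l\<^sup>2 * c\<^sup>2 / 8 * real k\<close>,
    the exponent that the exponential Markov inequality yields.\<close>
  define l where "l = 4 * r / (c\<^sup>2 * real k)"
  have l: "l > 0" using assms(1-4) by (simp add: l_def)
  let ?E = "expct (uperm A) F"
  have fs: "finite (set_pmf (uperm A))" using assms(1-4) by (simp add: set_uperm)
  have "measure_pmf.prob (uperm A) {us. F us \<ge> ?E + r} = expct (uperm A) (indicator {us. F us \<ge> ?E + r})"
    by simp
  also have "\<dots> \<le> expct (uperm A) (\<lambda>us. exp (- l * r) * exp (l * (F us - ?E)))"
  proof (intro expct_mono fs)
    fix us
    have "0 \<le> l * (F us - ?E - r)" if "F us \<ge> ?E + r"
      using l that by (intro mult_nonneg_nonneg) auto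
    thus "indicator {us. F us \<ge> ?E + r} us \<le> exp (- l * r) * exp (l * (F us - ?E))"
      unfolding exp_add[symmetric] by (cases "F us \<ge> ?E + r") (simp_all add: right_diff_distrib)
  qed
  also have "\<dots> = exp (- l * r) * expct (uperm A) (\<lambda>us. exp (l * (F us - ?E)))"
    by simp
  also have "\<dots> \<le> exp (- l * r) * exp (l\<^sup>2 * c\<^sup>2 / 8 * real k)"
    by (intro mult_left_mono uperm_mgf[OF assms(1) l assms(5,6)]) auto
  also have "\<dots> = exp (- (2 * r\<^sup>2 / (c\<^sup>2 * real k)))"
  proof -
    have "- l * r + l\<^sup>2 * c\<^sup>2 / 8 * real k = - (2 * r\<^sup>2 / (c\<^sup>2 * real k))"
      using assms(2-4) by (simp add: l_def power2_eq_square divide_simps) 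
    thus ?thesis unfolding exp_add[symmetric] by (rule arg_cong)
  qed
  finally show ?thesis .
qed

section \<open>Sums over consecutive pairs\<close>

fun pairs :: "'a list \<Rightarrow> ('a \<times> 'a) list" where
  "pairs (a # b # xs) = (a, b) # pairs xs"
| "pairs _ = []"

lemma length_pairs [simp]: "length (pairs xs) = length xs div 2"
  by (induction xs rule: pairs.induct) auto

lemma nth_pairs: "i < length xs div 2 \<Longrightarrow> pairs xs ! i = (xs ! (2 * i), xs ! (2 * i + 1))"
proof (induction xs arbitrary: i rule: pairs.induct)
  case (1 a b xs)
  then show ?case by (cases i) auto
qed auto

definition psum :: "('a \<Rightarrow> 'a \<Rightarrow> real) \<Rightarrow> nat \<Rightarrow> 'a list \<Rightarrow> real" where
  "psum h t xs = (\<Sum>(x, y)\<leftarrow>take t (pairs xs). h x y)"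

text \<open>
  The average over pairs drawn with replacement. It differs by at most \<open>1 / (n - 1)\<close> from the mean
  over two entries of a random permutation, which explains the summand \<open>1\<close> in the tail bounds below.
\<close>

definition pair_avg :: "'a set \<Rightarrow> ('a \<Rightarrow> 'a \<Rightarrow> real) \<Rightarrow> real" where
  "pair_avg A h = (\<Sum>x\<in>A. \<Sum>y\<in>A. h x y) / (real (card A))\<^sup>2"

lemma psum_nth:
  assumes "2 * t \<le> length xs"
  shows "psum h t xs = (\<Sum>i<t. h (xs ! (2 * i)) (xs ! (2 * i + 1)))"
proof -
  have "psum h t xs = (\<Sum>i<t. case pairs xs ! i of (x, y) \<Rightarrow> h x y)"
  proof -
    have "length (take t (pairs xs)) = t" using assms by simp
    thus ?thesis
      unfolding psum_def sum_list_sum_nth length_map atLeast0LessThan by (auto intro!: sum.cong)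
  qed
  also have "\<dots> = (\<Sum>i<t. h (xs ! (2 * i)) (xs ! (2 * i + 1)))"
  proof (intro sum.cong refl)
    fix i assume "i \<in> {..<t}"
    hence "i < length xs div 2" using assms by auto
    thus "(case pairs xs ! i of (x, y) \<Rightarrow> h x y) = h (xs ! (2 * i)) (xs ! (2 * i + 1))"
      by (simp add: nth_pairs)
  qed
  finally show ?thesis .
qed

text \<open>Rotation brings any position to the front, so means over one entry or over two
  neighbouring entries reduce to the first draws.\<close>

lemma rotate_uperm:
  assumes "finite A"
  shows "map_pmf (rotate k) (uperm A) = uperm A"
proof -
  have inj: "inj_on (rotate k) (permutations_of_set A)"
  proof (rule inj_onI)
    fix us vs assume *: "us \<in> permutations_of_set A" "vs \<in> permutations_of_set A" "rotate k us = rotate k vs"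
    have rot1: "rotate1 xs = rotate1 ys \<Longrightarrow> xs = ys" for xs ys :: "'a list"
      by (cases xs; cases ys) auto
    from *(3) show "us = vs"
      by (induction k) (auto dest: rot1)
  qed
  have "rotate k ` permutations_of_set A = permutations_of_set A"
  proof (rule endo_inj_surj[OF _ _ inj])
    show "rotate k ` permutations_of_set A \<subseteq> permutations_of_set A"
      by (auto simp: permutations_of_set_def)
  qed simp
  thus ?thesis
    unfolding uperm_def using assms inj by (subst map_pmf_of_set_inj) auto
qed

lemma expct_nth:
  fixes \<phi> :: "'a \<Rightarrow> real"
  assumes "finite A" "i < card A"
  shows "expct (uperm A) (\<lambda>us. \<phi> (us ! i)) = (\<Sum>x\<in>A. \<phi> x) / card A"
proof -
  have ne: "A \<noteq> {}" using assms by auto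
  have "expct (uperm A) (\<lambda>us. \<phi> (us ! i)) = expct (uperm A) (\<lambda>us. \<phi> (rotate i us ! 0))"
    using assms by (intro expct_cong) (auto simp: set_uperm nth_rotate length_finite_permutations_of_set
        dest: length_finite_permutations_of_set)
  also have "\<dots> = expct (map_pmf (rotate i) (uperm A)) (\<lambda>us. \<phi> (us ! 0))" by simp
  also have "\<dots> = expct (uperm A) (\<lambda>us. \<phi> (us ! 0))" by (simp add: rotate_uperm assms)
  also have "\<dots> = (\<Sum>x\<in>A. \<phi> x) / card A"
    using assms ne by (subst expct_uperm_Cons) (auto simp: integral_pmf_of_set)
  finally show ?thesis .
qed

lemma expct_nth_pair:
  fixes h :: "'a \<Rightarrow> 'a \<Rightarrow> real"
  assumes "finite A" "Suc i < card A"
  shows "expct (uperm A) (\<lambda>us. h (us ! i) (us ! Suc i)) =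
    (\<Sum>x\<in>A. \<Sum>y\<in>A - {x}. h x y) / (real (card A) * real (card A - 1))"
proof -
  have ne: "A \<noteq> {}" using assms by auto
  have ne': "A - {x} \<noteq> {}" if "x \<in> A" for x
  proof
    assume "A - {x} = {}"
    hence "card A \<le> card {x}" by (intro card_mono) auto
    thus False using assms by simp
  qed
  have "expct (uperm A) (\<lambda>us. h (us ! i) (us ! Suc i)) = expct (uperm A) (\<lambda>us. h (rotate i us ! 0) (rotate i us ! 1))"
    using assms by (intro expct_cong) (auto simp: set_uperm nth_rotate 
        dest!: length_finite_permutations_of_set)
  also have "\<dots> = expct (map_pmf (rotate i) (uperm A)) (\<lambda>us. h (us ! 0) (us ! 1))" by simp
  also have "\<dots> = expct (uperm A) (\<lambda>us. h (us ! 0) (us ! 1))" by (simp add: rotate_uperm assms)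
  also have "\<dots> = expct (pmf_of_set A) (\<lambda>x. expct (uperm (A - {x})) (\<lambda>ys. h x (ys ! 0)))"
    using assms ne by (subst expct_uperm_Cons) auto
  also have "\<dots> = expct (pmf_of_set A) (\<lambda>x. expct (pmf_of_set (A - {x})) (h x))"
    using assms ne ne' by (intro expct_cong, subst expct_uperm_Cons) auto
  also have "\<dots> = expct (pmf_of_set A) (\<lambda>x. (\<Sum>y\<in>A - {x}. h x y) / real (card A - 1))"
    using assms ne ne' by (intro expct_cong) (simp add: integral_pmf_of_set)
  also have "\<dots> = (\<Sum>x\<in>A. \<Sum>y\<in>A - {x}. h x y) / (real (card A) * real (card A - 1))"
    using assms ne by (simp add: integral_pmf_of_set flip: sum_divide_distrib)
  finally show ?thesis .
qed

lemma pair_avg_nonneg: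
  assumes "\<And>x y. x \<in> A \<Longrightarrow> y \<in> A \<Longrightarrow> 0 \<le> h x y"
  shows "0 \<le> pair_avg A h"
  unfolding pair_avg_def using assms by (intro divide_nonneg_nonneg sum_nonneg) auto

lemma expct_nth_pair_le:
  fixes h :: "'a \<Rightarrow> 'a \<Rightarrow> real"
  assumes "finite A" "Suc i < card A" and h: "\<And>x y. x \<in> A \<Longrightarrow> y \<in> A \<Longrightarrow> 0 \<le> h x y \<and> h x y \<le> 1"
  shows "expct (uperm A) (\<lambda>us. h (us ! i) (us ! Suc i)) \<le> pair_avg A h + 1 / real (card A - 1)"
proof -
  define n where "n = real (card A)"
  have n: "n > 1" "real (card A - 1) = n - 1" using assms by (auto simp: n_def)
  define H where "H = (\<Sum>x\<in>A. \<Sum>y\<in>A. h x y)"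
  have "H \<le> (\<Sum>x\<in>A. \<Sum>y\<in>A. 1)" unfolding H_def using h by (intro sum_mono) auto
  hence H: "H \<le> n\<^sup>2" by (simp add: n_def power2_eq_square)
  have "(\<Sum>x\<in>A. \<Sum>y\<in>A - {x}. h x y) \<le> H"
    unfolding H_def using assms h by (intro sum_mono sum_mono2) auto
  hence "expct (uperm A) (\<lambda>us. h (us ! i) (us ! Suc i)) \<le> H / (n * (n - 1))"
    unfolding expct_nth_pair[OF assms(1,2)] n n_def[symmetric] using n by (intro divide_right_mono) auto
  \<comment> \<open>Omitting the diagonal only lowered the sum, as \<open>h\<close> is nonnegative.
    The price is the smaller denominator \<open>n * (n - 1)\<close>, which adds at most
    \<open>1 / (n - 1)\<close> because \<open>H \<le> n\<^sup>2\<close>.\<close>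
  also have "H / (n * (n - 1)) = H / n\<^sup>2 + H / n\<^sup>2 / (n - 1)"
    using n by (simp add: field_simps power2_eq_square)
  also have "\<dots> \<le> H / n\<^sup>2 + 1 / (n - 1)"
    using H n by (intro add_left_mono divide_right_mono) (auto simp: field_simps)
  finally show ?thesis unfolding pair_avg_def H_def n_def[symmetric] n .
qed

lemma abs_sum_two_le:
  fixes d :: "nat \<Rightarrow> real"
  assumes "\<And>i. i < t \<Longrightarrow> \<bar>d i\<bar> \<le> 1" "\<And>i. i < t \<Longrightarrow> d i \<noteq> 0 \<Longrightarrow> i = a \<or> i = b"
  shows "\<bar>\<Sum>i<t. d i\<bar> \<le> 2"
proof -
  have "(\<Sum>i<t. d i) = (\<Sum>i\<in>{..<t} \<inter> {a, b}. d i)"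
    using assms(2) by (intro sum.mono_neutral_right) auto
  also have "\<bar>\<dots>\<bar> \<le> (\<Sum>i\<in>{..<t} \<inter> {a, b}. 1)"
    using assms(1) by (intro order.trans[OF sum_abs] sum_mono) auto
  also have "\<dots> = real (card ({..<t} \<inter> {a, b}))" by simp
  also have "card ({..<t} \<inter> {a, b}) \<le> card {a, b}" by (intro card_mono) auto
  also have "\<dots> \<le> 2" by (simp add: card_insert_if)
  finally show ?thesis by simp
qed

text \<open>The entries \<open>x\<close> and \<open>y\<close> lie in at most two pairs, found by
  halving their positions. All other summands stay the same, and each of these two moves by at most
  1.\<close>

lemma psum_lipschitz:
  assumes "us \<in> permutations_of_set A" "x \<in> A" "y \<in> A" "2 * t \<le> card A"
    and h: "\<And>x y. x \<in> A \<Longrightarrow> y \<in> A \<Longrightarrow> 0 \<le> h x y \<and> h x y \<le> 1"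
  shows "\<bar>psum h t us - psum h t (map (Transposition.transpose x y) us)\<bar> \<le> 2"
proof -
  have us: "set us = A" "distinct us" "length us = card A"
    using assms(1) by (auto simp: permutations_of_set_def distinct_card)
  obtain px py where p: "px < length us" "us ! px = x" "py < length us" "us ! py = y"
    using assms(2,3) us by (metis in_set_conv_nth)
  let ?f = "Transposition.transpose x y"
  let ?d = "\<lambda>i. h (us ! (2 * i)) (us ! (2 * i + 1)) - h (?f (us ! (2 * i))) (?f (us ! (2 * i + 1)))"
  have "psum h t us - psum h t (map ?f us) = (\<Sum>i<t. ?d i)"
    using us assms(4) by (simp add: psum_nth sum_subtractf)
  also have "\<bar>\<dots>\<bar> \<le> 2"
  proof (rule abs_sum_two_le[where a = "px div 2" and b = "py div 2"])
    fix i assume i: "i < t"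
    have mem: "us ! (2 * i) \<in> A" "us ! (2 * i + 1) \<in> A"
      using i us assms(4) by (auto intro!: nth_mem simp flip: us(1))
    hence "?f (us ! (2 * i)) \<in> A" "?f (us ! (2 * i + 1)) \<in> A"
      using assms(2,3) by (auto simp: Transposition.transpose_def)
    thus "\<bar>?d i\<bar> \<le> 1" using h mem by (smt (verit))
    assume "?d i \<noteq> 0"
    hence "?f (us ! (2 * i)) \<noteq> us ! (2 * i) \<or> ?f (us ! (2 * i + 1)) \<noteq> us ! (2 * i + 1)" by auto
    hence "us ! (2 * i) = us ! px \<or> us ! (2 * i) = us ! py \<or> us ! (2 * i + 1) = us ! px \<or> us ! (2 * i + 1) = us ! py"
      using p by (auto simp: Transposition.transpose_def split: if_splits)
    hence "2 * i = px \<or> 2 * i = py \<or> 2 * i + 1 = px \<or> 2 * i + 1 = py"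
      using us i assms(4) p by (auto simp: nth_eq_iff_index_eq)
    thus "i = px div 2 \<or> i = py div 2" by auto
  qed
  finally show ?thesis .
qed

lemma psum_upper_tail:
  assumes "finite A" "2 * t \<le> card A" "r > 0"
    and h: "\<And>x y. x \<in> A \<Longrightarrow> y \<in> A \<Longrightarrow> 0 \<le> h x y \<and> h x y \<le> 1"
  shows "measure_pmf.prob (uperm A) {us. psum h t us \<ge> real t * pair_avg A h + 1 + r} \<le> exp (- (r\<^sup>2 / (2 * real (card A))))"
proof (cases "t = 0")
  case True
  thus ?thesis using assms by (simp add: psum_def)
next
  case False
  hence t: "t > 0" by simp
  have fs: "finite (set_pmf (uperm A))" using assms by (simp add: set_uperm)
  have ln: "length us = card A" if "us \<in> set_pmf (uperm A)" for us
    using that assms(1) by (auto simp: set_uperm dest: length_finite_permutations_of_set)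
  have "expct (uperm A) (psum h t) = expct (uperm A) (\<lambda>us. \<Sum>i<t. h (us ! (2 * i)) (us ! (2 * i + 1)))"
    using ln assms(2) by (intro expct_cong) (simp add: psum_nth)
  also have "\<dots> = (\<Sum>i<t. expct (uperm A) (\<lambda>us. h (us ! (2 * i)) (us ! Suc (2 * i))))"
    by (subst Bochner_Integration.integral_sum) (auto intro: integrable_measure_pmf_finite fs)
  also have "\<dots> \<le> (\<Sum>i<t. pair_avg A h + 1 / real (card A - 1))"
    using assms by (intro sum_mono expct_nth_pair_le) auto
  also have "\<dots> = real t * pair_avg A h + real t / real (card A - 1)" by (simp add: algebra_simps)
  \<comment> \<open>From \<open>t > 0\<close> and \<open>2 * t \<le> card A\<close> follows
    \<open>t \<le> card A - 1\<close>, so the errors of the single means add up to at most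
    1.\<close>
  also have "\<dots> \<le> real t * pair_avg A h + 1"
    using t assms(2) by (intro add_left_mono) (auto simp: divide_le_eq_1)
  finally have E: "expct (uperm A) (psum h t) \<le> real t * pair_avg A h + 1" .
  have "measure_pmf.prob (uperm A) {us. psum h t us \<ge> real t * pair_avg A h + 1 + r} \<le>
        measure_pmf.prob (uperm A) {us. psum h t us \<ge> expct (uperm A) (psum h t) + r}"
    using E by (intro measure_pmf.finite_measure_mono) auto
  also have "\<dots> \<le> exp (- (2 * r\<^sup>2 / (2\<^sup>2 * real (2 * t))))"
  proof (rule uperm_tail)
    fix us vs assume "us \<in> permutations_of_set A" "vs \<in> permutations_of_set A" "take (2 * t) us = take (2 * t) vs"
    moreover from this(3) have "us ! i = vs ! i" if "i < 2 * t" for i using that by (metis nth_take)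
    ultimately show "psum h t us = psum h t vs" using assms(2)
      by (subst (1 2) psum_nth) (auto dest!: length_finite_permutations_of_set intro!: sum.cong)
  qed (use t assms in \<open>auto intro: psum_lipschitz\<close>)
  also have "\<dots> \<le> exp (- (r\<^sup>2 / (2 * real (card A))))"
  proof -
    have "r\<^sup>2 / (2 * real (card A)) \<le> r\<^sup>2 / (4 * real t)"
      using t assms(2) by (intro divide_left_mono) auto
    thus ?thesis by simp
  qed
  finally show ?thesis .
qed

lemma psum_diff: "psum (\<lambda>x y. f x y - g x y) t xs = psum f t xs - psum g t xs"
proof -
  have "(\<Sum>(x, y)\<leftarrow>zs. f x y - g x y) = (\<Sum>(x, y)\<leftarrow>zs. f x y) - (\<Sum>(x, y)\<leftarrow>zs. g x y)" for zs
    by (induction zs) auto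
  thus ?thesis by (simp add: psum_def)
qed

lemma psum_const: "2 * t \<le> length xs \<Longrightarrow> psum (\<lambda>x y. c) t xs = real t * c"
  by (simp add: psum_nth)

lemma pair_avg_diff: "pair_avg A (\<lambda>x y. f x y - g x y) = pair_avg A f - pair_avg A g"
  by (simp add: pair_avg_def sum_subtractf diff_divide_distrib)

lemma pair_avg_const: "finite A \<Longrightarrow> A \<noteq> {} \<Longrightarrow> pair_avg A (\<lambda>x y. c) = c"
  by (simp add: pair_avg_def power2_eq_square)

text \<open>Complementing \<open>h\<close> to \<open>1 - h\<close> exchanges the two tails.\<close>

lemma psum_lower_tail:
  assumes "finite A" "2 * t \<le> card A" "r > 0"
    and h: "\<And>x y. x \<in> A \<Longrightarrow> y \<in> A \<Longrightarrow> 0 \<le> h x y \<and> h x y \<le> 1"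
  shows "measure_pmf.prob (uperm A) {us. psum h t us \<le> real t * pair_avg A h - 1 - r} \<le> exp (- (r\<^sup>2 / (2 * real (card A))))"
proof (cases "A = {}")
  case True
  thus ?thesis using assms by (simp add: psum_def uperm_def pmf_of_set_singleton)
next
  case False
  have "measure_pmf.prob (uperm A) {us. psum h t us \<le> real t * pair_avg A h - 1 - r} \<le>
     measure_pmf.prob (uperm A) {us. psum (\<lambda>x y. 1 - h x y) t us \<ge> real t * pair_avg A (\<lambda>x y. 1 - h x y) + 1 + r}"
  proof (intro measure_pmf.finite_measure_mono_AE AE_pmfI impI)
    fix us assume "us \<in> set_pmf (uperm A)" and le: "us \<in> {us. psum h t us \<le> real t * pair_avg A h - 1 - r}"
    hence "2 * t \<le> length us"
      using assms(1,2) by (auto simp: set_uperm dest!: length_finite_permutations_of_set)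
    thus "us \<in> {us. psum (\<lambda>x y. 1 - h x y) t us \<ge> real t * pair_avg A (\<lambda>x y. 1 - h x y) + 1 + r}"
      using le by (simp add: psum_diff psum_const pair_avg_diff pair_avg_const assms False algebra_simps)
  qed auto
  also have "\<dots> \<le> exp (- (r\<^sup>2 / (2 * real (card A))))"
    using h by (intro psum_upper_tail assms) auto
  finally show ?thesis .
qed

section \<open>Sums over the first entries of a random permutation\<close>

definition ssum :: "('a \<Rightarrow> real) \<Rightarrow> nat \<Rightarrow> 'a list \<Rightarrow> real" where
  "ssum \<phi> s xs = (\<Sum>x\<leftarrow>take s xs. \<phi> x)"

lemma ssum_nth: "s \<le> length xs \<Longrightarrow> ssum \<phi> s xs = (\<Sum>i<s. \<phi> (xs ! i))"
  unfolding ssum_def by (subst sum_list_sum_nth) (auto simp: atLeast0LessThan)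

text \<open>Only the first \<open>s\<close> entries are revealed, so the exponent contains
  \<open>s\<close> in place of \<open>card A\<close>; this makes the bound strong enough for a small
  sample. The symmetric range of \<open>\<phi>\<close> admits a centred color indicator as well as
  its negative, which gives both tails.\<close>

lemma ssum_tail:
  assumes "finite A" "s \<le> card A" "s > 0" "r > 0" and \<phi>: "\<And>x. x \<in> A \<Longrightarrow> \<bar>\<phi> x\<bar> \<le> 1/2"
  shows "measure_pmf.prob (uperm A) {us. ssum \<phi> s us \<ge> real s * ((\<Sum>x\<in>A. \<phi> x) / card A) + r} \<le> exp (- (r\<^sup>2 / (2 * real s)))"
proof -
  have fs: "finite (set_pmf (uperm A))" using assms by (simp add: set_uperm)
  have ln: "length us = card A" if "us \<in> set_pmf (uperm A)" for us
    using that assms(1) by (auto simp: set_uperm dest: length_finite_permutations_of_set)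
  have "expct (uperm A) (ssum \<phi> s) = expct (uperm A) (\<lambda>us. \<Sum>i<s. \<phi> (us ! i))"
    using ln assms(2) by (intro expct_cong) (simp add: ssum_nth)
  also have "\<dots> = (\<Sum>i<s. expct (uperm A) (\<lambda>us. \<phi> (us ! i)))"
    by (subst Bochner_Integration.integral_sum) (auto intro: integrable_measure_pmf_finite fs)
  also have "\<dots> = real s * ((\<Sum>x\<in>A. \<phi> x) / card A)"
    using assms by (simp add: expct_nth)
  finally have E: "expct (uperm A) (ssum \<phi> s) = real s * ((\<Sum>x\<in>A. \<phi> x) / card A)" .
  have "measure_pmf.prob (uperm A) {us. ssum \<phi> s us \<ge> expct (uperm A) (ssum \<phi> s) + r} \<le> exp (- (2 * r\<^sup>2 / (2\<^sup>2 * real s)))"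
  proof (rule uperm_tail)
    fix us vs assume "us \<in> permutations_of_set A" "vs \<in> permutations_of_set A" "take s us = take s vs"
    thus "ssum \<phi> s us = ssum \<phi> s vs" by (simp add: ssum_def)
  next
    fix us x y assume us: "us \<in> permutations_of_set A" and xy: "x \<in> A" "y \<in> A"
    have us: "set us = A" "distinct us" "length us = card A"
      using us by (auto simp: permutations_of_set_def distinct_card)
    obtain px py where p: "px < length us" "us ! px = x" "py < length us" "us ! py = y"
      using xy us by (metis in_set_conv_nth)
    let ?f = "Transposition.transpose x y"
    have "ssum \<phi> s us - ssum \<phi> s (map ?f us) = (\<Sum>i<s. \<phi> (us ! i) - \<phi> (?f (us ! i)))"
      using us assms(2) by (simp add: ssum_nth sum_subtractf)
    also have "\<bar>\<dots>\<bar> \<le> 2"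
    proof (rule abs_sum_two_le[where a = px and b = py])
      fix i assume i: "i < s"
      have mem: "us ! i \<in> A" using i us assms(2) by (auto intro!: nth_mem simp flip: us(1))
      hence "?f (us ! i) \<in> A" using xy by (auto simp: Transposition.transpose_def)
      thus "\<bar>\<phi> (us ! i) - \<phi> (?f (us ! i))\<bar> \<le> 1" using \<phi>[OF mem] \<phi>[of "?f (us ! i)"] by linarith
      assume "\<phi> (us ! i) - \<phi> (?f (us ! i)) \<noteq> 0"
      hence "us ! i = us ! px \<or> us ! i = us ! py"
        using p by (auto simp: Transposition.transpose_def split: if_splits)
      thus "i = px \<or> i = py" using us i assms(2) p by (auto simp: nth_eq_iff_index_eq)
    qed
    finally show "\<bar>ssum \<phi> s us - ssum \<phi> s (map ?f us)\<bar> \<le> 2" .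
  qed (use assms in auto)
  thus ?thesis unfolding E by simp
qed

section \<open>Worst-case behaviour of the loops\<close>

text \<open>\<open>holds\<close> quantifies over all runs; a program without \<open>Random\<close> nodes has exactly one for each coloring.\<close>

definition holds :: "(ball \<Rightarrow> 'c) \<Rightarrow> 'r prog \<Rightarrow> ('r \<Rightarrow> nat \<Rightarrow> bool) \<Rightarrow> bool" where
  "holds col p Q \<longleftrightarrow> (\<forall>(r, c)\<in>set_pmf (run col p). Q r c)"

lemma holds_Return [simp]: "holds col (Return r) Q \<longleftrightarrow> Q r 0"
  by (simp add: holds_def)

lemma holds_cmp [simp]: "holds col (cmp x y) Q \<longleftrightarrow> Q (col x = col y) 1"
  by (simp add: holds_def cmp_def)

lemma holds_bind: "holds col (bind_prog p f) Q \<longleftrightarrow> holds col p (\<lambda>r c. holds col (f r) (\<lambda>r' d. Q r' (c + d)))"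
  by (fastforce simp: holds_def run_bind)

lemma holds_mono: "holds col p Q \<Longrightarrow> (\<And>r c. Q r c \<Longrightarrow> Q' r c) \<Longrightarrow> holds col p Q'"
  by (auto simp: holds_def)

lemma holds_bindI:
  assumes "holds col p Q1" "\<And>r c. Q1 r c \<Longrightarrow> holds col (f r) (\<lambda>r' d. Q r' (c + d))"
  shows "holds col (bind_prog p f) Q"
  using assms by (auto simp: holds_bind intro: holds_mono)

lemma holds_conj: "holds col p Q \<Longrightarrow> holds col p Q' \<Longrightarrow> holds col p (\<lambda>r c. Q r c \<and> Q' r c)"
  by (auto simp: holds_def)

lemma run_shuffle: "run col (shuffle xs) = map_pmf (\<lambda>ys. (ys, 0)) (pmf_of_set (permutations_of_multiset (mset xs)))"
  by (simp add: shuffle_def run_Random bind_map_pmf map_pmf_def[of "\<lambda>ys. (ys, 0)"] del: run.simps(3))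

lemma holds_shuffle: "holds col (shuffle xs) Q \<longleftrightarrow> (\<forall>ys. mset ys = mset xs \<longrightarrow> Q ys 0)"
  by (auto simp: holds_def run_shuffle permutations_of_multisetI dest: permutations_of_multisetD)

section \<open>Color counts and soundness of answers\<close>

definition color_count :: "(ball \<Rightarrow> 'c) \<Rightarrow> 'c \<Rightarrow> ball list \<Rightarrow> nat" where
  "color_count col c xs = length (filter (\<lambda>x. col x = c) xs)"

lemma color_count_Nil [simp]: "color_count col c [] = 0"
  and color_count_Cons [simp]: "color_count col c (x # xs) = (if col x = c then 1 else 0) + color_count col c xs"
  and color_count_append [simp]: "color_count col c (xs @ ys) = color_count col c xs + color_count col c ys"
  by (simp_all add: color_count_def)

lemma color_count_mset: "mset xs = mset ys \<Longrightarrow> color_count col c xs = color_count col c ys"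
  unfolding color_count_def by (metis mset_filter size_mset)

lemma color_count_le: "color_count col c xs \<le> length xs"
  by (simp add: color_count_def)

lemma color_count_0_iff: "color_count col c xs = 0 \<longleftrightarrow> c \<notin> col ` set xs"
  by (auto simp: color_count_def filter_empty_conv)

text \<open>One-sided: \<open>None\<close> is always accepted. The cost analysis only has to know
  that a returned candidate really is a majority, with its exact multiplicity.\<close>

definition correct_answer :: "(ball \<Rightarrow> 'c) \<Rightarrow> ball list \<Rightarrow> answer \<Rightarrow> bool" where
  "correct_answer col M ans \<longleftrightarrow> (\<forall>v k. ans = Some (v, k) \<longrightarrow> k = color_count col (col v) M \<and> 2 * k > length M)"

definition flat :: "('a \<times> 'a) list \<Rightarrow> 'a list" where
  "flat ps = concat (map (\<lambda>(a, b). [a, b]) ps)"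

lemma flat_simps [simp]: "flat [] = []" "flat ((a, b) # ps) = a # b # flat ps"
  by (simp_all add: flat_def)

definition same_pairs :: "(ball \<Rightarrow> 'c) \<Rightarrow> ball list \<Rightarrow> ball list" where
  "same_pairs col M = map snd (filter (\<lambda>(a, b). col a = col b) (pairs M))"

definition diff_pairs :: "(ball \<Rightarrow> 'c) \<Rightarrow> ball list \<Rightarrow> ball list" where
  "diff_pairs col M = flat (filter (\<lambda>(a, b). col a \<noteq> col b) (pairs M))"

lemma diff_pairs_simps [simp]:
  "diff_pairs col (a # b # M) = (if col a = col b then diff_pairs col M else a # b # diff_pairs col M)"
  "diff_pairs col [] = []" "diff_pairs col [a] = []"
  by (auto simp: diff_pairs_def)

lemma same_pairs_simps [simp]:
  "same_pairs col (a # b # M) = (if col a = col b then b # same_pairs col M else same_pairs col M)"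
  "same_pairs col [] = []" "same_pairs col [a] = []"
  by (auto simp: same_pairs_def)

lemma set_cmp [simp]: "set_prog (cmp x y) = UNIV"
  by (auto simp: cmp_def)

lemma run_cmp: "run col (cmp x y) = return_pmf (col x = col y, 1)"
  by (simp add: cmp_def)

lemma run_pair_up: "run col (pair_up M) = return_pmf ((same_pairs col M, diff_pairs col M), length M div 2)"
  by (induction M rule: pair_up.induct) (auto simp: run_bind run_cmp bind_return_pmf)

lemma run_count_color:
  "run col (count_color v xs) =
     return_pmf ((color_count col (col v) xs, filter (\<lambda>x. col x \<noteq> col v) xs), length xs)"
  by (induction v xs rule: count_color.induct) (auto simp: run_bind run_cmp bind_return_pmf)

lemma holds_pair_up:
  "holds col (pair_up M) (\<lambda>(X, Y) c. X = same_pairs col M \<and> Y = diff_pairs col M \<and> c = length M div 2)"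
  by (simp add: holds_def run_pair_up)

lemma holds_count_color:
  "holds col (count_color v xs) (\<lambda>(k, X) c. k = color_count col (col v) xs \<and> X = filter (\<lambda>x. col x \<noteq> col v) xs \<and> c = length xs)"
  by (simp add: holds_def run_count_color)

section \<open>Boyer-Moore and the heavy case\<close>

lemma holds_sweep: "holds col (sweep v k xs) (\<lambda>r c. c \<le> length xs)"
proof (induction v k xs rule: sweep.induct)
  case (2 v k x xs)
  then show ?case by (auto simp: holds_bind elim!: holds_mono)
qed auto

lemma holds_boyer_moore: "holds col (boyer_moore M) (\<lambda>ans c. correct_answer col M ans \<and> c \<le> 2 * length M)"
proof (cases M)
  case (Cons x xs)
  show ?thesis unfolding Cons boyer_moore.simps
    by (rule holds_bindI[OF holds_sweep], rule holds_bindI[OF holds_count_color])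
       (auto simp: correct_answer_def)
qed (auto simp: correct_answer_def)

definition differ :: "(ball \<Rightarrow> 'c) \<Rightarrow> ball \<Rightarrow> ball \<Rightarrow> real" where
  "differ col x y = of_bool (col x \<noteq> col y)"

lemma holds_heavy_loop_length: "holds col (heavy_loop X k) (\<lambda>r c. c \<le> length X div 2)"
proof (induction X k rule: heavy_loop.induct)
  case (1 a b X k)
  then show ?case by (auto simp: holds_bind Let_def elim!: holds_mono)
qed auto

lemma psum_Suc_Cons [simp]: "psum h (Suc t) (a # b # xs) = h a b + psum h t xs"
  by (simp add: psum_def)

lemma psum_0 [simp]: "psum h 0 xs = 0"
  by (simp add: psum_def)

text \<open>Each differing pair lowers the counter by 1. The counter is tested only after a
  comparison, hence \<open>0 < t\<close> even if \<open>k\<close> is not positive.\<close>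

lemma holds_heavy_loop_stop:
  "0 < t \<Longrightarrow> 2 * t \<le> length X \<Longrightarrow> psum (differ col) t X \<ge> k \<Longrightarrow> holds col (heavy_loop X k) (\<lambda>r c. r \<and> c \<le> t)"
proof (induction X k arbitrary: t rule: heavy_loop.induct)
  case (1 a b X k)
  obtain s where t: "t = Suc s" using 1 by (cases t) auto
  let ?k = "if col a = col b then k else k - 1"
  show ?case
  proof (cases "?k \<le> 0")
    case True
    then show ?thesis using t by (simp add: holds_bind Let_def)
  next
    case False
    have le: "psum (differ col) s X \<ge> ?k" using 1 t by (auto simp: differ_def[of col a b])
    with False have "0 < s" by (cases s) auto
    moreover have "2 * s \<le> length X" using 1 t by simp
    ultimately have "holds col (heavy_loop X ?k) (\<lambda>r c. r \<and> c \<le> s)"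
      using le False by (intro "1.IH") auto
    with False t show ?thesis by (auto simp: holds_bind Let_def elim!: holds_mono)
  qed
qed auto

text \<open>Counting takes n comparisons, the loop at most n/2 and Boyer-Moore at most 2n.\<close>

lemma holds_heavy: "holds col (heavy M v) (\<lambda>ans c. correct_answer col M ans \<and> c \<le> 4 * length M)"
  unfolding heavy_def
proof (rule holds_bindI[OF holds_count_color], clarify)
  fix cnt :: nat and X c
  show "holds col
        (if length M < 2 * color_count col (col v) M then Return (Some (v, color_count col (col v) M))
         else shuffle (filter (\<lambda>x. col x \<noteq> col v) M) \<bind> (\<lambda>X'.
              heavy_loop X' (real (length M) / 2 - real (color_count col (col v) M)) \<bind> (\<lambda>stop.
              if stop then Return None else boyer_moore M)))
        (\<lambda>r' d. correct_answer col M r' \<and> length M + d \<le> 4 * length M)" (is "holds _ (if ?b then _ else ?p) ?Q")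
  proof (cases ?b)
    case False
    have "holds col ?p ?Q"
    proof (rule holds_bindI[where ?Q1.0 = "\<lambda>X' c. length X' \<le> length M \<and> c = 0"])
      show "holds col (shuffle (filter (\<lambda>x. col x \<noteq> col v) M)) (\<lambda>X' c. length X' \<le> length M \<and> c = 0)"
        by (auto simp: holds_shuffle simp flip: mset_filter dest!: mset_eq_length)
    next
      fix X' :: "ball list" and c assume X': "length X' \<le> length M \<and> c = (0::nat)"
      show "holds col (heavy_loop X' (real (length M) / 2 - real (color_count col (col v) M)) \<bind>
          (\<lambda>stop. if stop then Return None else boyer_moore M)) (\<lambda>r' d. correct_answer col M r' \<and> length M + (c + d) \<le> 4 * length M)"
        using X' by (intro holds_bindI[OF holds_heavy_loop_length])
          (auto simp: correct_answer_def[of _ _ None] intro: holds_mono[OF holds_boyer_moore])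
    qed
    with False show ?thesis by simp
  qed (simp add: correct_answer_def)
qed

text \<open>The strict inequality makes the counter of \<open>light\<close> start positive; the
  parity rule of \<open>rec_input\<close> is designed for it. If \<open>X\<close> is odd, a majority
  of \<open>X\<close> gives \<open>2 * kX > length X\<close>. If the unpaired ball is added to an
  even \<open>X\<close>, then \<open>2 * (kX + kz) > length X + 1\<close>, and
  \<open>kz \<le> 1\<close>.\<close>

lemma holds_split_count:
  assumes k: "k = color_count col (col v) (rec_input M X)" "2 * k > length (rec_input M X)"
  shows "holds col (split_count M X v k) (\<lambda>(kX, kz) c. kX = color_count col (col v) X \<and>
     kz = color_count col (col v) (unpaired M) \<and> length X < 2 * kX + kz \<and> c \<le> 1)"
  using k by (auto simp: split_count_def unpaired_def rec_input_def holds_bind split: if_splits)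

text \<open>The pairs on which \<open>light_loop\<close> lowers its counter. Here and in
  \<open>loop_cost\<close>, pairs of equal colors contribute 0 since they never reach the loop. Thus
  both are sums over all pairs of the shuffled list, to which the tail bounds apply, and not over
  the random sublist of differing pairs.\<close>

definition misses :: "(ball \<Rightarrow> 'c) \<Rightarrow> 'c \<Rightarrow> ball \<Rightarrow> ball \<Rightarrow> real" where
  "misses col c x y = of_bool (col x \<noteq> col y \<and> col x \<noteq> c \<and> col y \<noteq> c)"

definition loop_cost :: "(ball \<Rightarrow> 'c) \<Rightarrow> 'c \<Rightarrow> ball \<Rightarrow> ball \<Rightarrow> real" where
  "loop_cost col c x y = (if col x = col y then 0 else if col x = c then 1 else 2)"

lemma unpaired_simps [simp]:
  "unpaired (a # b # M) = unpaired M" "unpaired [] = []" "unpaired [a] = [a]"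
  by (auto simp: unpaired_def)

text \<open>A pair of two colors contains the candidate's color at most once, so one increment per
  pair counts it exactly; a ball kept from a pair of equal colors stands for two.\<close>

lemma holds_balanced_loop:
  "holds col (balanced_loop v (diff_pairs col M) cnt) (\<lambda>r c.
     2 * color_count col (col v) (same_pairs col M) + color_count col (col v) (unpaired M) + r
        = cnt + color_count col (col v) M \<and>
     real c = psum (loop_cost col (col v)) (length M div 2) M)"
proof (induction M arbitrary: cnt rule: pairs.induct)
  case (1 a b M)
  have IH: "holds col (balanced_loop v (diff_pairs col M) k) P"
    if "\<And>r c. 2 * color_count col (col v) (same_pairs col M) + color_count col (col v) (unpaired M) + r
        = k + color_count col (col v) M \<Longrightarrow> real c = psum (loop_cost col (col v)) (length M div 2) M \<Longrightarrow> P r c" for P k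
    by (rule holds_mono[OF 1]) (use that in blast)
  have lc: "loop_cost col c a b = (if col a = col b then 0 else if col a = c then 1 else 2)" for c
    by (simp add: loop_cost_def)
  show ?case
  proof (cases "col a = col b")
    case True
    thus ?thesis by (simp add: lc) (rule IH; simp)
  next
    case False
    show ?thesis
    proof (cases "col v = col a")
      case True
      thus ?thesis using False by (simp add: lc holds_bind) (rule IH; simp)
    next
      case neq: False
      thus ?thesis using False
        by (cases "col v = col b") (simp add: lc holds_bind; rule IH; simp)+
    qed
  qed
qed auto

lemma loop_cost_nonneg: "psum (loop_cost col c) t M \<ge> 0"
  unfolding psum_def by (rule sum_list_nonneg) (auto simp: loop_cost_def)

text \<open>Multiplicity minus number of pairs gains 1 from a pair that has the candidate's color
  twice, 0 if it has it once, and loses 1 if it does not have it. The starting value of the counter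
  accounts for the pairs of equal colors, the loop for the others. With this starting value the
  bracket vanishes; the general form serves the induction.\<close>

lemma holds_light_loop:
  "holds col (light_loop v (diff_pairs col M) cnt) (\<lambda>r c.
     (\<forall>k. r = Some k \<longrightarrow> int (length M div 2) + k = int (color_count col (col v) M) +
        (cnt - (2 * int (color_count col (col v) (same_pairs col M)) - int (length (same_pairs col M))
          + int (color_count col (col v) (unpaired M))))
        \<and> (cnt > 0 \<longrightarrow> k > 0)) \<and>
     real c \<le> psum (loop_cost col (col v)) (length M div 2) M)"
proof (induction M arbitrary: cnt rule: pairs.induct)
  case (1 a b M)
  let ?S = "psum (loop_cost col (col v)) (length M div 2) M"
  have IH: "holds col (light_loop v (diff_pairs col M) k) P"
    if "\<And>r c. (\<And>n. r = Some n \<Longrightarrow> int (length M div 2) + n = int (color_count col (col v) M) +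
        (k - (2 * int (color_count col (col v) (same_pairs col M)) - int (length (same_pairs col M))
          + int (color_count col (col v) (unpaired M))))
        \<and> (k > 0 \<longrightarrow> n > 0)) \<Longrightarrow> real c \<le> ?S \<Longrightarrow> P r c" for P k
    by (rule holds_mono[OF 1]) (use that in blast)
  have nn: "?S \<ge> 0" by (rule loop_cost_nonneg)
  have lc: "loop_cost col c a b = (if col a = col b then 0 else if col a = c then 1 else 2)" for c
    by (simp add: loop_cost_def)
  show ?case
  proof (cases "col a = col b")
    case True
    thus ?thesis by (simp add: lc) (rule IH; fastforce)
  next
    case False
    show ?thesis
    proof (cases "col v = col a")
      case True
      show ?thesis
      proof (cases "cnt = 0")
        case zero: True
        show ?thesis using True False nn zero by (simp add: lc holds_bind)
      next
        case nz: False
        show ?thesis using True False nn nz by (simp add: lc holds_bind) (rule IH; fastforce)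
      qed
    next
      case neq: False
      let ?k = "if col v = col b then cnt else cnt - 1"
      show ?thesis
      proof (cases "?k = 0")
        case True
        thus ?thesis using neq False nn by (cases "col v = col b") (simp_all add: lc holds_bind)
      next
        case nz: False
        show ?thesis
        proof (cases "col v = col b")
          case True
          show ?thesis using neq False nn nz True by (simp add: lc holds_bind) (rule IH; fastforce)
        next
          case neq': False
          show ?thesis using neq False nn nz neq' by (simp add: lc holds_bind) (rule IH; fastforce)
        qed
      qed
    qed
  qed
qed auto

text \<open>As soon as the misses among the first \<open>t\<close> pairs reach the counter, the loop
  has stopped, so the later pairs cost nothing. The number \<open>t\<close> refers to the shuffled
  list, including the pairs of equal colors that the loop does not see.\<close>

lemma holds_light_loop_stop:
  "0 < cnt \<Longrightarrow> 2 * t \<le> length M \<Longrightarrow> psum (misses col (col v)) t M \<ge> real_of_int cnt \<Longrightarrow>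
   holds col (light_loop v (diff_pairs col M) cnt) (\<lambda>r c. real c \<le> psum (loop_cost col (col v)) t M)"
proof (induction M arbitrary: cnt t rule: pairs.induct)
  case (1 a b M)
  obtain s where t: "t = Suc s" using 1 by (cases t) auto
  have IH: "holds col (light_loop v (diff_pairs col M) k) (\<lambda>r c. P r c)"
    if "0 < k" "psum (misses col (col v)) s M \<ge> real_of_int k"
      "\<And>r c. real c \<le> psum (loop_cost col (col v)) s M \<Longrightarrow> P r c" for k P
    using "1.IH"[of k s] that t "1.prems" by (auto elim!: holds_mono)
  have nn: "psum (loop_cost col (col v)) s M \<ge> 0" by (rule loop_cost_nonneg)
  have lc: "loop_cost col c a b = (if col a = col b then 0 else if col a = c then 1 else 2)" for c
    by (simp add: loop_cost_def)
  have ms: "misses col c a b = (if col a = col b \<or> col a = c \<or> col b = c then 0 else 1)" for c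
    by (simp add: misses_def)
  let ?k = "if col a = col b \<or> col a = col v \<or> col b = col v then cnt else cnt - 1"
  have le: "psum (misses col (col v)) s M \<ge> real_of_int ?k"
    using "1.prems"(3) by (auto simp: t ms)
  show ?case
  proof (cases "?k = 0")
    case True
    thus ?thesis using "1.prems"(1) nn t by (auto simp: holds_bind lc split: if_splits)
  next
    case False
    hence pos: "?k > 0" using "1.prems"(1) by (auto split: if_splits)
    show ?thesis
    proof (cases "col a = col b")
      case True
      show ?thesis using pos le True t by (simp add: lc) (rule IH; simp)
    next
      case neq: False
      consider "col v = col a" | "col v \<noteq> col a" "col v = col b" | "col v \<noteq> col a" "col v \<noteq> col b" by blast
      thus ?thesis
      proof cases
        case 1
        thus ?thesis using pos le neq t by (simp add: lc holds_bind) (rule IH; simp)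
      next
        case 2
        thus ?thesis using pos le neq t by (simp add: lc holds_bind) (rule IH; simp)
      next
        case 3
        hence "col a \<noteq> col v" "col b \<noteq> col v" by auto
        with 3 show ?thesis using pos le neq t by (simp add: lc holds_bind) (rule IH; simp)
      qed
    qed
  qed
qed (auto simp: loop_cost_nonneg)

section \<open>Correctness and worst-case cost of the algorithm\<close>

definition class_inv :: "(ball \<Rightarrow> 'c) \<Rightarrow> (ball \<times> nat) list \<Rightarrow> ball list \<Rightarrow> bool" where
  "class_inv col cs xs \<longleftrightarrow> distinct (map (col \<circ> fst) cs) \<and>
     (\<forall>(v, k)\<in>set cs. k = color_count col (col v) xs) \<and> (col \<circ> fst) ` set cs = col ` set xs"

lemma holds_add_ball:
  "distinct (map (col \<circ> fst) cs) \<Longrightarrow> holds col (add_ball x cs) (\<lambda>cs' c. c \<le> length cs \<and>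
     cs' = (if col x \<in> (col \<circ> fst) ` set cs then map (\<lambda>(v, k). (v, if col v = col x then k + 1 else k)) cs
            else cs @ [(x, 1)]))"
proof (induction x cs rule: add_ball.induct)
  case (2 x v c cs)
  let ?f = "\<lambda>(v, k). (v, if col v = col x then k + 1 else k)"
  show ?case
  proof (cases "col v = col x")
    case True
    have "map ?f cs = cs"
      using True 2(2) by (intro map_idI) force
    thus ?thesis using True by (simp add: holds_bind)
  next
    case False
    have "holds col (add_ball x cs) (\<lambda>cs' c. c \<le> length cs \<and>
     cs' = (if col x \<in> (col \<circ> fst) ` set cs then map ?f cs else cs @ [(x, 1)]))"
      using 2(2) False by (intro 2(1)[of False]) auto
    thus ?thesis using False by (auto simp: holds_bind image_iff elim!: holds_mono) force+
  qed
qed auto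

lemma class_inv_length:
  assumes "class_inv col cs xs"
  shows "length cs \<le> length xs"
proof -
  have "length cs = card ((col \<circ> fst) ` set cs)"
    using assms distinct_card[of "map (col \<circ> fst) cs"] by (simp add: class_inv_def)
  also have "\<dots> = card (col ` set xs)" using assms by (simp add: class_inv_def)
  also have "\<dots> \<le> length xs"
    by (meson card_image_le card_length finite_set order_trans)
  finally show ?thesis .
qed

lemma class_inv_add:
  assumes "class_inv col cs xs"
  shows "class_inv col (if col x \<in> (col \<circ> fst) ` set cs then map (\<lambda>(v, k). (v, if col v = col x then k + 1 else k)) cs
            else cs @ [(x, 1)]) (xs @ [x])"
proof (cases "col x \<in> (col \<circ> fst) ` set cs")
  case True
  let ?f = "\<lambda>(v, k). (v, if col v = col x then k + 1 else k :: nat)"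
  have [simp]: "fst (?f p) = fst p" for p by (simp add: case_prod_beta)
  have m: "map (col \<circ> fst) (map ?f cs) = map (col \<circ> fst) cs" by simp
  have "(col \<circ> fst) ` set (map ?f cs) = (col \<circ> fst) ` set cs"
    by (metis list.set_map m)
  moreover have "col ` set (xs @ [x]) = col ` set xs"
    using True assms by (auto simp: class_inv_def)
  ultimately show ?thesis
    using assms True unfolding class_inv_def m if_P[OF True] by auto
next
  case False
  hence "col x \<notin> col ` set xs" using assms by (simp add: class_inv_def)
  hence "color_count col (col x) xs = 0" by (simp add: color_count_0_iff)
  moreover have "col v \<noteq> col x" if "(v, k) \<in> set cs" for v k using that False by force
  moreover have "k = color_count col (col v) xs" if "(v, k) \<in> set cs" for v k
    using assms that by (auto simp: class_inv_def)
  ultimately have "\<forall>(v, k)\<in>set (cs @ [(x, 1)]). k = color_count col (col v) (xs @ [x])"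
    by fastforce
  thus ?thesis using assms False unfolding class_inv_def if_not_P[OF False] by simp
qed

text \<open>A new ball costs at most one comparison per class, and there are never more classes than
  balls seen. The quadratic bound is affordable because the sample has about n^(1/3) balls.\<close>

lemma holds_color_classes:
  "class_inv col cs ys \<Longrightarrow> holds col (color_classes xs cs) (\<lambda>cs' c. class_inv col cs' (ys @ xs) \<and>
     c \<le> length xs * (length ys + length xs))"
proof (induction xs arbitrary: cs ys)
  case (Cons x xs)
  show ?case unfolding color_classes.simps
  proof (rule holds_bindI[OF holds_add_ball])
    show "distinct (map (col \<circ> fst) cs)" using Cons.prems by (simp add: class_inv_def)
  next
    fix cs' c
    assume *: "c \<le> length cs \<and> cs' = (if col x \<in> (col \<circ> fst) ` set cs then
      map (\<lambda>(v, k). (v, if col v = col x then k + 1 else k)) cs else cs @ [(x, 1)])"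
    hence "class_inv col cs' (ys @ [x])" using class_inv_add[OF Cons.prems] by auto
    hence "holds col (color_classes xs cs') (\<lambda>cs' c. class_inv col cs' ((ys @ [x]) @ xs) \<and>
       c \<le> length xs * (length (ys @ [x]) + length xs))"
      by (rule Cons.IH)
    moreover have "c \<le> length ys" using * class_inv_length[OF Cons.prems] by simp
    ultimately show "holds col (color_classes xs cs') (\<lambda>cs'' d. class_inv col cs'' (ys @ x # xs) \<and>
       c + d \<le> length (x # xs) * (length ys + length (x # xs)))"
      by (auto elim!: holds_mono)
  qed
qed auto

lemma holds_sorted_classes:
  "holds col (sorted_classes xs) (\<lambda>cs c. class_inv col cs xs \<and> sorted (rev (map snd cs)) \<and> c \<le> length xs * length xs)"
  unfolding sorted_classes_def
proof (rule holds_bindI[OF holds_color_classes[where ys = "[]"]])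
  show "class_inv col [] []" by (simp add: class_inv_def)
next
  fix cs c
  assume *: "class_inv col cs ([] @ xs) \<and> c \<le> length xs * (length ([]::ball list) + length xs)"
  define cs' where "cs' = rev (sort_key snd cs)"
  have m: "mset cs' = mset cs" by (simp add: cs'_def)
  have "mset (map (col \<circ> fst) cs') = mset (map (col \<circ> fst) cs)" using m by (metis mset_map)
  hence "distinct (map (col \<circ> fst) cs') = distinct (map (col \<circ> fst) cs)"
    by (rule mset_eq_imp_distinct_iff)
  moreover have "set cs' = set cs" using m by (rule mset_eq_setD)
  ultimately have "class_inv col cs' xs" using * by (simp add: class_inv_def)
  moreover have "sorted (rev (map snd cs'))" by (simp add: cs'_def flip: rev_map)
  ultimately show "holds col (Return (rev (sort_key snd cs))) (\<lambda>cs d. class_inv col cs xs \<and> sorted (rev (map snd cs)) \<and> c + d \<le> length xs * length xs)"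
    using * by (simp add: cs'_def)
qed

section \<open>Pairing rounds and the linear worst case\<close>

definition balanced_tail :: "ball list \<Rightarrow> ball list \<Rightarrow> ball list \<Rightarrow> ball list \<Rightarrow> answer \<Rightarrow> answer prog" where
  "balanced_tail M M' X Y ans = (case ans of
       None \<Rightarrow> Return None
     | Some (v, k) \<Rightarrow> do {
         (kX, kz) \<leftarrow> split_count M' X v k;
         cnt \<leftarrow> balanced_loop v Y (2 * kX + kz);
         Return (if 2 * cnt \<le> length M then None else Some (v, cnt))
       })"

definition light_tail :: "ball list \<Rightarrow> ball list \<Rightarrow> ball list \<Rightarrow> ball list \<Rightarrow> answer \<Rightarrow> answer prog" where
  "light_tail M M' X Y ans = (case ans of
       None \<Rightarrow> Return None
     | Some (v, k) \<Rightarrow> do {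
         (kX, kz) \<leftarrow> split_count M' X v k;
         r \<leftarrow> light_loop v Y (2 * int kX - int (length X) + int kz);
         case r of
           None \<Rightarrow> Return None
         | Some cnt \<Rightarrow> Return (Some (v, nat (int (length M div 2) + cnt)))
       })"

text \<open>The common form of \<open>balanced\<close> and \<open>light\<close>, which differ only
  in what follows the recursive call; it lets both share one analysis.\<close>

definition pairing :: "(ball list \<Rightarrow> ball list \<Rightarrow> ball list \<Rightarrow> answer \<Rightarrow> answer prog) \<Rightarrow> ball list \<Rightarrow> answer prog" where
  "pairing tail M = do {
     M' \<leftarrow> shuffle M;
     (X, Y) \<leftarrow> pair_up M';
     ans \<leftarrow> majority (rec_input M' X);
     tail M' X Y ans
   }"

lemma balanced_pairing: "balanced M = pairing (balanced_tail M) M"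
  unfolding pairing_def balanced_tail_def by (rule balanced.simps)

lemma light_pairing: "light M = pairing (light_tail M) M"
  unfolding pairing_def light_tail_def by (rule light.simps)

text \<open>
  \<open>T c\<close> is the number of pairs of the shuffled list after which the final loop is known to have
  stopped if the candidate has color \<open>c\<close>; the summand \<open>1\<close> is for the unpaired ball.
\<close>

definition tail_cost :: "(ball \<Rightarrow> 'c) \<Rightarrow> ('c \<Rightarrow> nat) \<Rightarrow> ball list \<Rightarrow> answer \<Rightarrow> real" where
  "tail_cost col T M ans = (case ans of None \<Rightarrow> 0 | Some (v, k) \<Rightarrow> 1 + psum (loop_cost col (col v)) (T (col v)) M)"

lemma holds_balanced_tail:
  assumes "mset M' = mset M" "correct_answer col (rec_input M' (same_pairs col M')) ans"
  shows "holds col (balanced_tail M M' (same_pairs col M') (diff_pairs col M') ans)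
    (\<lambda>r c. correct_answer col M r \<and> real c \<le> tail_cost col (\<lambda>_. length M' div 2) M' ans)"
proof (cases ans)
  case None
  thus ?thesis by (simp add: balanced_tail_def correct_answer_def tail_cost_def)
next
  case (Some p)
  obtain v k where p: "p = (v, k)" by (cases p)
  have cc: "color_count col c M' = color_count col c M" for c by (rule color_count_mset[OF assms(1)])
  have "holds col (split_count M' (same_pairs col M') v k) (\<lambda>(kX, kz) c. kX = color_count col (col v) (same_pairs col M') \<and>
     kz = color_count col (col v) (unpaired M') \<and> length (same_pairs col M') < 2 * kX + kz \<and> c \<le> 1)"
    using assms(2) Some p by (intro holds_split_count) (auto simp: correct_answer_def)
  thus ?thesis unfolding balanced_tail_def Some p tail_cost_def option.case prod.case
  proof (rule holds_bindI, clarify)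
    fix c :: nat
    assume c: "c \<le> 1"
    show "holds col (balanced_loop v (diff_pairs col M') (2 * color_count col (col v) (same_pairs col M') + color_count col (col v) (unpaired M'))
             \<bind> (\<lambda>cnt. Return (if 2 * cnt \<le> length M then None else Some (v, cnt))))
        (\<lambda>r' d. correct_answer col M r' \<and> real (c + d) \<le> 1 + psum (loop_cost col (col v)) (length M' div 2) M')"
      using c by (intro holds_bindI[OF holds_balanced_loop]) (auto simp: correct_answer_def cc)
  qed
qed

text \<open>\<open>T\<close> is either the number of all pairs, where the plain bound on the loop
  applies, or a point by which the misses have exhausted the counter. Since the counter starts
  positive, a run to the end leaves it positive, which makes the returned color a majority.\<close>

lemma holds_light_tail:
  assumes M': "mset M' = mset M" "correct_answer col (rec_input M' (same_pairs col M')) ans"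
    and T: "\<And>v k. ans = Some (v, k) \<Longrightarrow> T (col v) = length M' div 2 \<or>
        2 * T (col v) \<le> length M' \<and>
        real (2 * color_count col (col v) (same_pairs col M') + color_count col (col v) (unpaired M')) - real (length (same_pairs col M'))
          \<le> psum (misses col (col v)) (T (col v)) M'"
  shows "holds col (light_tail M M' (same_pairs col M') (diff_pairs col M') ans)
    (\<lambda>r c. correct_answer col M r \<and> real c \<le> tail_cost col T M' ans)"
proof (cases ans)
  case None
  thus ?thesis by (simp add: light_tail_def correct_answer_def tail_cost_def)
next
  case (Some p)
  obtain v k where p: "p = (v, k)" by (cases p)
  have cc: "color_count col c M' = color_count col c M" for c by (rule color_count_mset[OF M'(1)])
  have len: "length M' = length M" using M'(1) by (rule mset_eq_length)
  let ?X = "same_pairs col M'" and ?Y = "diff_pairs col M'"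
  let ?kX = "color_count col (col v) ?X" and ?kz = "color_count col (col v) (unpaired M')"
  let ?cnt = "2 * int ?kX - int (length ?X) + int ?kz"
  have "holds col (split_count M' ?X v k) (\<lambda>(kX, kz) c. kX = ?kX \<and> kz = ?kz \<and> length ?X < 2 * kX + kz \<and> c \<le> 1)"
    using assms(2) Some p by (intro holds_split_count) (auto simp: correct_answer_def)
  thus ?thesis unfolding light_tail_def Some p tail_cost_def option.case prod.case
  proof (rule holds_bindI, clarify)
    fix c :: nat
    assume c: "c \<le> 1" and pos: "length ?X < 2 * ?kX + ?kz"
    hence pos': "?cnt > 0" by linarith
    have "holds col (light_loop v ?Y ?cnt) (\<lambda>r d. real d \<le> psum (loop_cost col (col v)) (T (col v)) M')"
    proof (cases "T (col v) = length M' div 2")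
      case True
      show ?thesis unfolding True by (rule holds_mono[OF holds_light_loop]) blast
    next
      case False
      hence "2 * T (col v) \<le> length M'" "psum (misses col (col v)) (T (col v)) M' \<ge> real_of_int ?cnt"
        using T[of v k] Some p by auto
      thus ?thesis using pos' by (intro holds_light_loop_stop)
    qed
    from holds_conj[OF holds_light_loop[of col v M' ?cnt] this]
    show "holds col (light_loop v ?Y ?cnt \<bind> (\<lambda>r. case r of None \<Rightarrow> Return None
              | Some cnt \<Rightarrow> Return (Some (v, nat (int (length M div 2) + cnt)))))
        (\<lambda>r' d. correct_answer col M r' \<and> real (c + d) \<le> 1 + psum (loop_cost col (col v)) (T (col v)) M')"
    proof (rule holds_bindI, goal_cases)
      case (1 r d)
      show ?case
      proof (cases r)
        case (Some n)
        with 1 pos' have n: "int (length M div 2) + n = int (color_count col (col v) M)" "n > 0"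
          by (auto simp: cc len)
        hence "nat (int (length M div 2) + n) = color_count col (col v) M" "2 * color_count col (col v) M > length M"
          by auto
        with 1 c Some show ?thesis by (auto simp: correct_answer_def)
      qed (use 1 c in \<open>auto simp: correct_answer_def\<close>)
    qed
  qed
qed

lemma length_same_pairs: "length (same_pairs col M) \<le> length M div 2"
  by (induction M rule: pairs.induct) auto

lemma length_rec_input_same_pairs: "length (rec_input M (same_pairs col M)) \<le> (length M + 1) div 2"
  using length_same_pairs[of col M] by (auto simp: rec_input_def unpaired_def elim!: oddE)

lemma loop_cost_le: "psum (loop_cost col c) t M \<le> 2 * real t"
proof -
  have "(\<Sum>(x, y)\<leftarrow>zs. loop_cost col c x y) \<le> 2 * real (length zs)" for zs
    by (induction zs) (auto simp: loop_cost_def)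
  from this[of "take t (pairs M)"] show ?thesis unfolding psum_def by (rule order.trans) simp
qed

lemma holds_pairing:
  assumes rec: "\<And>N. length N \<le> (length M + 1) div 2 \<Longrightarrow> holds col (majority N) (\<lambda>ans c. correct_answer col N ans \<and> c \<le> 10 * length N)"
    and tail: "\<And>M' ans. mset M' = mset M \<Longrightarrow> correct_answer col (rec_input M' (same_pairs col M')) ans \<Longrightarrow>
      holds col (tail M' (same_pairs col M') (diff_pairs col M') ans)
        (\<lambda>r c. correct_answer col M r \<and> real c \<le> tail_cost col (\<lambda>_. length M' div 2) M' ans)"
  shows "holds col (pairing tail M) (\<lambda>r c. correct_answer col M r \<and> c \<le> 10 * ((length M + 1) div 2) + 3 * (length M div 2) + 1)"
  unfolding pairing_def
proof (rule holds_bindI[where ?Q1.0 = "\<lambda>M' c. mset M' = mset M \<and> c = 0"])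
  show "holds col (shuffle M) (\<lambda>M' c. mset M' = mset M \<and> c = 0)" by (simp add: holds_shuffle)
next
  fix M' and c0 :: nat
  assume M': "mset M' = mset M \<and> c0 = 0"
  hence len: "length M' = length M" by (auto dest: mset_eq_length)
  show "holds col (pair_up M' \<bind> (\<lambda>(X, Y). majority (rec_input M' X) \<bind> tail M' X Y))
    (\<lambda>r d. correct_answer col M r \<and> c0 + d \<le> 10 * ((length M + 1) div 2) + 3 * (length M div 2) + 1)"
  proof (rule holds_bindI[OF holds_pair_up], clarify)
    let ?X = "same_pairs col M'"
    have l: "length (rec_input M' ?X) \<le> (length M + 1) div 2"
      using length_rec_input_same_pairs[of M' col] by (simp add: len)
    show "holds col (majority (rec_input M' ?X) \<bind> tail M' ?X (diff_pairs col M'))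
      (\<lambda>r d. correct_answer col M r \<and> c0 + (length M' div 2 + d) \<le> 10 * ((length M + 1) div 2) + 3 * (length M div 2) + 1)"
    proof (rule holds_bindI[OF rec[OF l]])
      fix ans c
      assume *: "correct_answer col (rec_input M' ?X) ans \<and> c \<le> 10 * length (rec_input M' ?X)"
      have "tail_cost col (\<lambda>_. length M' div 2) M' ans \<le> 1 + 2 * real (length M div 2)"
        using loop_cost_le[of col _ "length M' div 2" M'] by (auto simp: tail_cost_def len split: option.splits)
      hence b: "d \<le> 1 + 2 * (length M div 2)" if "real d \<le> tail_cost col (\<lambda>_. length M' div 2) M' ans" for d
        using that by linarith
      have t: "holds col (tail M' ?X (diff_pairs col M') ans)
        (\<lambda>r c. correct_answer col M r \<and> real c \<le> tail_cost col (\<lambda>_. length M' div 2) M' ans)"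
        using * M' by (intro tail) auto
      show "holds col (tail M' ?X (diff_pairs col M') ans)
        (\<lambda>r d. correct_answer col M r \<and> c0 + (length M' div 2 + (c + d)) \<le> 10 * ((length M + 1) div 2) + 3 * (length M div 2) + 1)"
        by (rule holds_mono[OF t]) (use * l M' len b in fastforce)
    qed
  qed
qed

lemma sample_size_square:
  assumes "m > 0"
  shows "nat \<lfloor>real m powr (1 / 3)\<rfloor> * nat \<lfloor>real m powr (1 / 3)\<rfloor> \<le> m"
proof -
  have "real (nat \<lfloor>real m powr (1 / 3)\<rfloor>) \<le> real m powr (1 / 3)" by simp
  hence "real (nat \<lfloor>real m powr (1 / 3)\<rfloor>) * real (nat \<lfloor>real m powr (1 / 3)\<rfloor>) \<le> real m powr (1 / 3) * real m powr (1 / 3)"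
    by (intro mult_mono) auto
  also have "\<dots> = real m powr (2 / 3)" by (simp flip: powr_add)
  also have "\<dots> \<le> real m powr 1" using assms by (intro powr_mono) auto
  also have "\<dots> = real m" using assms by simp
  finally show ?thesis unfolding of_nat_mult[symmetric] of_nat_le_iff .
qed

lemma holds_sample: "holds col (sample s M) (\<lambda>M' c. length M' \<le> s \<and> c = 0)"
  by (simp add: sample_def holds_bind holds_shuffle)

text \<open>The bound is crude but deterministic. It covers calls on few balls and the failure event
  in the expectation, and its soundness part restricts the candidates of the recursive call. The
  factor 10 works because a round costs at most 10 times the size of the recursive call plus 3/2 n +
  1, and the sample at most n more; from n = 2 on this fits.\<close>

lemma holds_majority: "holds col (majority M) (\<lambda>ans c. correct_answer col M ans \<and> c \<le> 10 * length M)"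
proof (induction "length M" arbitrary: M rule: less_induct)
  case less
  consider "M = []" | "length M = 1" | "length M \<ge> 2" by (cases M rule: remdups_adj.cases) auto
  thus ?case
  proof cases
    case 3
    have IH: "holds col (majority N) (\<lambda>ans c. correct_answer col N ans \<and> c \<le> 10 * length N)"
      if "length N \<le> (length M + 1) div 2" for N
      using that 3 by (intro less) auto
    have b: "holds col (balanced M) (\<lambda>r c. correct_answer col M r \<and> c \<le> 10 * ((length M + 1) div 2) + 3 * (length M div 2) + 1)"
      unfolding balanced_pairing by (intro holds_pairing IH holds_balanced_tail)
    have l: "holds col (light M) (\<lambda>r c. correct_answer col M r \<and> c \<le> 10 * ((length M + 1) div 2) + 3 * (length M div 2) + 1)"
      unfolding light_pairing by (intro holds_pairing IH holds_light_tail) auto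
    have arith: "10 * ((length M + 1) div 2) + 3 * (length M div 2) + 1 + length M \<le> 10 * length M"
    proof -
      have "(length M + 1) div 2 + length M div 2 = length M" by presburger
      moreover have "2 * ((length M + 1) div 2) \<le> length M + 1" by simp
      ultimately show ?thesis using 3 by linarith
    qed
    define s where "s = nat \<lfloor>real (length M) powr (1 / 3)\<rfloor>"
    have s: "s * s \<le> length M" unfolding s_def using 3 by (intro sample_size_square) auto
    have "M \<noteq> []" "length M \<noteq> 1" using 3 by auto
    thus ?thesis unfolding majority.simps[of M] Let_def s_def[symmetric]
    proof (simp only: if_False, intro holds_bindI[OF holds_sample], goal_cases)
      case (1 M' c0)
      show ?case
      proof (rule holds_bindI[OF holds_sorted_classes], goal_cases)
        case (1 cs c1)
        have "length M' * length M' \<le> s * s" using \<open>length M' \<le> s \<and> c0 = 0\<close> by (intro mult_mono) auto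
        hence c: "c0 + c1 \<le> length M" using 1 s \<open>length M' \<le> s \<and> c0 = 0\<close> by linarith
        have Q: "c \<le> 10 * ((length M + 1) div 2) + 3 * (length M div 2) + 1 \<Longrightarrow> c0 + (c1 + c) \<le> 10 * length M"
          "c \<le> 4 * length M \<Longrightarrow> c0 + (c1 + c) \<le> 10 * length M" for c
          using c arith by linarith+
        have "holds col (balanced M) (\<lambda>r d. correct_answer col M r \<and> c0 + (c1 + d) \<le> 10 * length M)"
          by (rule holds_mono[OF b]) (use Q(1) in blast)
        moreover have "holds col (light M) (\<lambda>r d. correct_answer col M r \<and> c0 + (c1 + d) \<le> 10 * length M)"
          by (rule holds_mono[OF l]) (use Q(1) in blast)
        moreover have "holds col (heavy M (fst (hd cs))) (\<lambda>r d. correct_answer col M r \<and> c0 + (c1 + d) \<le> 10 * length M)"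
          by (rule holds_mono[OF holds_heavy]) (use Q(2) in blast)
        ultimately show ?case by simp
      qed
    qed
  qed (auto simp: majority.simps correct_answer_def length_Suc_conv)
qed

section \<open>Failure probabilities and color frequencies\<close>

text \<open>The union bound for a two-stage experiment: either the first stage leaves
  \<open>P\<close>, or it stays in \<open>P\<close> and the second stage, whatever the outcome so
  far, hits \<open>B\<close>.\<close>

lemma prob_bind_le:
  assumes "measure_pmf.prob p {x. \<not> P x} \<le> a" "0 \<le> b"
    and "\<And>x. x \<in> set_pmf p \<Longrightarrow> P x \<Longrightarrow> measure_pmf.prob (f x) B \<le> b"
  shows "measure_pmf.prob (bind_pmf p f) B \<le> a + b"
proof -
  have a: "0 \<le> a" using assms(1) measure_nonneg order.trans by blast
  have "emeasure (bind_pmf p f) B = (\<integral>\<^sup>+x. emeasure (f x) B \<partial>p)"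
    by (rule emeasure_bind_pmf)
  also have "\<dots> \<le> (\<integral>\<^sup>+x. indicator {x. \<not> P x} x + ennreal b \<partial>p)"
  proof (intro nn_integral_mono_AE AE_pmfI)
    fix x assume x: "x \<in> set_pmf p"
    show "emeasure (f x) B \<le> indicator {x. \<not> P x} x + ennreal b"
    proof (cases "P x")
      case True
      thus ?thesis using assms(3)[OF x True] by (simp add: measure_pmf.emeasure_eq_measure ennreal_leI)
    next
      case False
      have "emeasure (f x) B \<le> 1" by (simp add: measure_pmf.emeasure_eq_measure)
      also have "1 \<le> indicator {x. \<not> P x} x + ennreal b" using False by simp
      finally show ?thesis .
    qed
  qed
  also have "\<dots> = emeasure p {x. \<not> P x} + ennreal b"
    by (subst nn_integral_add) auto
  also have "\<dots> = ennreal (measure_pmf.prob p {x. \<not> P x} + b)"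
    using assms(2) by (simp add: measure_pmf.emeasure_eq_measure ennreal_plus)
  also have "\<dots> \<le> ennreal (a + b)" using assms(1) by (intro ennreal_leI) auto
  finally show ?thesis
    unfolding measure_pmf.emeasure_eq_measure using a assms(2) by (subst (asm) ennreal_le_iff) auto
qed

text \<open>A bound on \<open>fails\<close> is a Hoare triple with an error budget. The budgets add
  up along sequential composition, and facts that hold on all runs are free.\<close>

definition fails :: "(ball \<Rightarrow> 'c) \<Rightarrow> 'r prog \<Rightarrow> ('r \<Rightarrow> nat \<Rightarrow> bool) \<Rightarrow> real" where
  "fails col p Q = measure_pmf.prob (run col p) {(r, c). \<not> Q r c}"

lemma fails_bind:
  assumes "fails col p Q1 \<le> a" "0 \<le> b"
    and "\<And>r c. Q1 r c \<Longrightarrow> fails col (f r) (\<lambda>r' d. Q r' (c + d)) \<le> b"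
  shows "fails col (bind_prog p f) Q \<le> a + b"
  unfolding fails_def run_bind
proof (rule prob_bind_le)
  show "measure_pmf.prob (run col p) {x. \<not> (case x of (r, c) \<Rightarrow> Q1 r c)} \<le> a"
    using assms(1) by (simp add: fails_def case_prod_unfold)
next
  fix x assume "case x of (r, c) \<Rightarrow> Q1 r c"
  then obtain r c where x: "x = (r, c)" "Q1 r c" by (cases x) auto
  have "(\<lambda>(r', d). (r', c + d)) -` {(r', c). \<not> Q r' c} = {(r', d). \<not> Q r' (c + d)}" by auto
  thus "measure_pmf.prob (case x of (x, c) \<Rightarrow> map_pmf (\<lambda>(r, d). (r, c + d)) (run col (f x))) {(r, c). \<not> Q r c} \<le> b"
    using assms(3)[OF x(2)] by (simp add: x measure_map_pmf fails_def)
qed fact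

lemma fails_holds: "holds col p Q \<Longrightarrow> fails col p Q = 0"
  unfolding fails_def holds_def by (subst measure_pmf_zero_iff) auto

lemma fails_mono:
  assumes "\<And>r c. Q r c \<Longrightarrow> Q' r c"
  shows "fails col p Q' \<le> fails col p Q"
  unfolding fails_def using assms by (intro measure_pmf.finite_measure_mono) auto

lemma fails_conj_holds: "holds col p H \<Longrightarrow> fails col p (\<lambda>r c. H r c \<and> Q r c) \<le> fails col p Q"
  unfolding fails_def holds_def
  by (intro measure_pmf.finite_measure_mono_AE AE_pmfI impI) auto

lemma fails_bind_holds:
  assumes "holds col p Q1" "0 \<le> b" "\<And>r c. Q1 r c \<Longrightarrow> fails col (f r) (\<lambda>r' d. Q r' (c + d)) \<le> b"
  shows "fails col (bind_prog p f) Q \<le> b"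
  using fails_bind[of col p Q1 0 b f Q] assms by (simp add: fails_holds)

lemma run_shuffle_distinct:
  assumes "distinct xs"
  shows "run col (shuffle xs) = map_pmf (\<lambda>ys. (ys, 0)) (uperm (set xs))"
proof -
  have "mset_set (set xs) = mset xs" using assms by (rule mset_set_set)
  hence "permutations_of_multiset (mset xs) = permutations_of_set (set xs)"
    by (simp add: permutations_of_set_altdef)
  thus ?thesis by (simp add: run_shuffle uperm_def)
qed

lemma fails_shuffle:
  assumes "distinct xs"
  shows "fails col (shuffle xs) (\<lambda>ys c. mset ys = mset xs \<and> c = 0 \<and> P ys) \<le> measure_pmf.prob (uperm (set xs)) {ys. \<not> P ys}"
proof -
  have "fails col (shuffle xs) (\<lambda>ys c. (mset ys = mset xs \<and> c = 0) \<and> P ys) \<le> fails col (shuffle xs) (\<lambda>ys c. P ys)"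
    by (rule fails_conj_holds) (simp add: holds_shuffle)
  also have "\<dots> = measure_pmf.prob (uperm (set xs)) {ys. \<not> P ys}"
    by (simp add: fails_def run_shuffle_distinct assms measure_map_pmf vimage_def)
  finally show ?thesis by simp
qed

lemma prob_ball_le:
  assumes "finite C" "\<And>c. c \<in> C \<Longrightarrow> measure_pmf.prob p {x. \<not> P c x} \<le> e"
  shows "measure_pmf.prob p {x. \<not> (\<forall>c\<in>C. P c x)} \<le> real (card C) * e"
proof -
  have "{x. \<not> (\<forall>c\<in>C. P c x)} = (\<Union>c\<in>C. {x. \<not> P c x})" by auto
  also have "measure_pmf.prob p \<dots> \<le> (\<Sum>c\<in>C. measure_pmf.prob p {x. \<not> P c x})"
    using assms(1) by (intro measure_pmf.finite_measure_subadditive_finite) auto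
  also have "\<dots> \<le> (\<Sum>c\<in>C. e)" by (intro sum_mono assms(2))
  finally show ?thesis by simp
qed

lemma prob_conj_le:
  assumes "measure_pmf.prob p {x. \<not> P x} \<le> a" "measure_pmf.prob p {x. \<not> Q x} \<le> b"
  shows "measure_pmf.prob p {x. \<not> (P x \<and> Q x)} \<le> a + b"
proof -
  have "{x. \<not> (P x \<and> Q x)} = {x. \<not> P x} \<union> {x. \<not> Q x}" by auto
  also have "measure_pmf.prob p \<dots> \<le> measure_pmf.prob p {x. \<not> P x} + measure_pmf.prob p {x. \<not> Q x}"
    by (rule measure_Un_le) auto
  finally show ?thesis using assms by linarith
qed

section \<open>Color frequencies and the sum of their squares\<close>

definition color_freq :: "(ball \<Rightarrow> 'c) \<Rightarrow> 'c \<Rightarrow> ball list \<Rightarrow> real" where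
  "color_freq col c M = real (color_count col c M) / real (length M)"

definition square_sum :: "(ball \<Rightarrow> 'c) \<Rightarrow> ball list \<Rightarrow> real" where
  "square_sum col M = (\<Sum>c\<in>col ` set M. (color_freq col c M)\<^sup>2)"

lemma color_freq_nonneg [simp]: "0 \<le> color_freq col c M"
  by (simp add: color_freq_def)

lemma color_freq_le_1: "color_freq col c M \<le> 1"
  unfolding color_freq_def using color_count_le[of col c M] by (simp add: divide_le_eq_1)

lemma sum_color_count: "finite C \<Longrightarrow> col ` set M \<subseteq> C \<Longrightarrow> (\<Sum>c\<in>C. color_count col c M) = length M"
proof (induction M)
  case (Cons x M)
  have "(\<Sum>c\<in>C. (if col x = c then 1 else 0) + color_count col c M) = Suc (length M)"
    using Cons by (simp add: sum.distrib)
  thus ?case by simp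
qed simp

lemma sum_color_freq:
  assumes "finite C" "col ` set M \<subseteq> C" "M \<noteq> []"
  shows "(\<Sum>c\<in>C. color_freq col c M) = 1"
  using sum_color_count[OF assms(1,2)] assms(3)
  by (simp add: color_freq_def flip: sum_divide_distrib of_nat_sum)

lemma square_sum_superset:
  assumes "finite C" "col ` set M \<subseteq> C"
  shows "square_sum col M = (\<Sum>c\<in>C. (color_freq col c M)\<^sup>2)"
  unfolding square_sum_def using assms
  by (intro sum.mono_neutral_left) (auto simp: color_freq_def color_count_0_iff[symmetric])

lemma square_sum_ge: "(color_freq col c M)\<^sup>2 \<le> square_sum col M"
proof (cases "c \<in> col ` set M")
  case True
  thus ?thesis unfolding square_sum_def by (intro member_le_sum) auto
next
  case False
  hence "color_freq col c M = 0" by (simp add: color_freq_def color_count_0_iff)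
  thus ?thesis by (simp add: square_sum_def sum_nonneg)
qed

lemma square_sum_nonneg: "0 \<le> square_sum col M"
  by (simp add: square_sum_def sum_nonneg)

text \<open>The mass outside \<open>c\<close> has its largest sum of squares when it is concentrated
  on one color, since no other frequency exceeds that mass.\<close>

lemma square_sum_le:
  assumes "M \<noteq> []"
  shows "square_sum col M \<le> (color_freq col c M)\<^sup>2 + (1 - color_freq col c M)\<^sup>2"
proof -
  let ?C = "insert c (col ` set M)"
  let ?D = "?C - {c}"
  let ?f = "\<lambda>c. color_freq col c M"
  have "(\<Sum>c\<in>?C. ?f c) = ?f c + (\<Sum>c\<in>?D. ?f c)" by (subst sum.remove[of _ c]) auto
  moreover have "(\<Sum>c\<in>?C. ?f c) = 1" using assms by (intro sum_color_freq) auto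
  ultimately have D: "(\<Sum>c\<in>?D. ?f c) = 1 - ?f c" by linarith
  have le: "?f d \<le> 1 - ?f c" if "d \<in> ?D" for d
    unfolding D[symmetric] using that by (intro member_le_sum) auto
  have "square_sum col M = (\<Sum>c\<in>?C. (?f c)\<^sup>2)" by (intro square_sum_superset) auto
  also have "\<dots> = (?f c)\<^sup>2 + (\<Sum>c\<in>?D. (?f c)\<^sup>2)" by (subst sum.remove[of _ c]) auto
  also have "(\<Sum>c\<in>?D. (?f c)\<^sup>2) \<le> (\<Sum>d\<in>?D. ?f d * (1 - ?f c))"
    unfolding power2_eq_square by (intro sum_mono mult_left_mono le) auto
  also have "\<dots> = (1 - ?f c)\<^sup>2" unfolding sum_distrib_right[symmetric] D power2_eq_square ..
  finally show ?thesis by simp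
qed

lemma color_freq_add_le:
  assumes "c \<noteq> d" "M \<noteq> []"
  shows "color_freq col c M + color_freq col d M \<le> 1"
proof -
  have "(\<Sum>e\<in>{c, d}. color_freq col e M) \<le> (\<Sum>e\<in>{c, d} \<union> col ` set M. color_freq col e M)"
    by (intro sum_mono2) auto
  also have "\<dots> = 1" using assms by (intro sum_color_freq) auto
  finally show ?thesis using assms by simp
qed

lemma square_sum_ge_two:
  assumes "c \<noteq> d"
  shows "(color_freq col c M)\<^sup>2 + (color_freq col d M)\<^sup>2 \<le> square_sum col M"
proof -
  have "(\<Sum>e\<in>{c, d}. (color_freq col e M)\<^sup>2) \<le> (\<Sum>e\<in>{c, d} \<union> col ` set M. (color_freq col e M)\<^sup>2)"
    by (intro sum_mono2) auto
  also have "\<dots> = square_sum col M" by (intro square_sum_superset[symmetric]) auto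
  finally show ?thesis using assms by simp
qed

section \<open>Averages over pairs as polynomials in the frequencies\<close>

lemma color_count_sum: "distinct M \<Longrightarrow> real (color_count col c M) = (\<Sum>x\<in>set M. of_bool (col x = c))"
  by (induction M) auto

lemma pair_avg_agree:
  assumes "distinct M"
  shows "pair_avg (set M) (\<lambda>x y. of_bool (col x = col y)) = square_sum col M"
proof -
  have "(\<Sum>x\<in>set M. \<Sum>y\<in>set M. of_bool (col x = col y)) = (\<Sum>x\<in>set M. real (color_count col (col x) M))"
    using assms by (simp add: color_count_sum eq_commute)
  also have "\<dots> = (\<Sum>c\<in>col ` set M. \<Sum>x | x \<in> set M \<and> col x = c. real (color_count col (col x) M))"
    by (rule sum.image_gen) simp
  also have "\<dots> = (\<Sum>c\<in>col ` set M. (real (color_count col c M))\<^sup>2)"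
  proof (intro sum.cong refl)
    fix c
    have "card {x \<in> set M. col x = c} = color_count col c M"
      using assms by (simp add: color_count_def flip: distinct_card)
    thus "(\<Sum>x | x \<in> set M \<and> col x = c. real (color_count col (col x) M)) = (real (color_count col c M))\<^sup>2"
      by (simp add: power2_eq_square)
  qed
  finally show ?thesis
    using assms by (simp add: pair_avg_def square_sum_def color_freq_def power_divide sum_divide_distrib distinct_card)
qed

lemma pair_avg_fst:
  assumes "distinct M"
  shows "pair_avg (set M) (\<lambda>x y. of_bool (col x = c)) = color_freq col c M"
  using assms by (simp add: pair_avg_def color_freq_def distinct_card power2_eq_square color_count_sum flip: sum_distrib_left)

lemma pair_avg_snd:
  assumes "distinct M"
  shows "pair_avg (set M) (\<lambda>x y. of_bool (col y = c)) = color_freq col c M"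
  using assms by (simp add: pair_avg_def color_freq_def distinct_card power2_eq_square color_count_sum)

lemma pair_avg_both:
  assumes "distinct M"
  shows "pair_avg (set M) (\<lambda>x y. of_bool (col x = c) * of_bool (col y = c)) = (color_freq col c M)\<^sup>2"
proof -
  have "(\<Sum>x\<in>set M. \<Sum>y\<in>set M. of_bool (col x = c) * of_bool (col y = c) :: real) = (real (color_count col c M))\<^sup>2"
    unfolding color_count_sum[OF assms] power2_eq_square sum_product ..
  thus ?thesis using assms by (simp add: pair_avg_def color_freq_def distinct_card power_divide)
qed

lemma pair_avg_linear:
  assumes "finite A" "A \<noteq> {}"
  shows "pair_avg A (\<lambda>x y. k + k1 * f1 x y + k2 * f2 x y + k3 * f3 x y + k4 * f4 x y) =
    k + k1 * pair_avg A f1 + k2 * pair_avg A f2 + k3 * pair_avg A f3 + k4 * pair_avg A f4"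
proof -
  have 1: "pair_avg A (\<lambda>x y. f x y + g x y) = pair_avg A f + pair_avg A g" for f g :: "'a \<Rightarrow> 'a \<Rightarrow> real"
    by (simp add: pair_avg_def sum.distrib add_divide_distrib)
  have 2: "pair_avg A (\<lambda>x y. d * f x y) = d * pair_avg A f" for d f
    by (simp add: pair_avg_def flip: sum_distrib_left)
  show ?thesis by (simp only: 1 2 pair_avg_const[OF assms])
qed

lemma pair_avg_indicators:
  assumes "distinct M" "M \<noteq> []"
  shows "pair_avg (set M) (\<lambda>x y. k + k1 * of_bool (col x = col y) + k2 * of_bool (col x = c)
      + k3 * of_bool (col y = c) + k4 * (of_bool (col x = c) * of_bool (col y = c))) =
    k + k1 * square_sum col M + k2 * color_freq col c M + k3 * color_freq col c M + k4 * (color_freq col c M)\<^sup>2"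
  by (subst pair_avg_linear[where ?f1.0 = "\<lambda>x y. of_bool (col x = col y)" and ?f2.0 = "\<lambda>x y. of_bool (col x = c)"
        and ?f3.0 = "\<lambda>x y. of_bool (col y = c)" and ?f4.0 = "\<lambda>x y. of_bool (col x = c) * of_bool (col y = c)"])
     (use assms in \<open>simp_all only: pair_avg_agree pair_avg_fst pair_avg_snd pair_avg_both set_empty finite_set not_False_eq_True\<close>)

text \<open>A differing pair costs 2, with 1 saved if its first ball has color \<open>c\<close> and
  its second does not. The cost is halved to lie in [0, 1], as the tail bounds require; undoing this
  gives the \<open>2 * r\<close> in \<open>good_pairs\<close>.\<close>

lemma pair_avg_loop_cost:
  assumes "distinct M" "M \<noteq> []"
  shows "pair_avg (set M) (\<lambda>x y. loop_cost col c x y / 2) =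
    1 - square_sum col M - color_freq col c M / 2 + (color_freq col c M)\<^sup>2 / 2"
proof -
  have eq: "(\<lambda>x y. loop_cost col c x y / 2) = (\<lambda>x y. 1 + (-1) * of_bool (col x = col y) + (-1/2) * of_bool (col x = c)
      + 0 * of_bool (col y = c) + 1/2 * (of_bool (col x = c) * of_bool (col y = c)))"
    by (intro ext) (auto simp: loop_cost_def)
  show ?thesis unfolding eq using assms
    by (subst pair_avg_indicators) simp_all
qed

text \<open>The differing pairs have weight 1 - S, and those that contain \<open>c\<close> exactly
  once have weight 2 * p * (1 - p).\<close>

lemma pair_avg_misses:
  assumes "distinct M" "M \<noteq> []"
  shows "pair_avg (set M) (misses col c) = 1 - square_sum col M - 2 * color_freq col c M + 2 * (color_freq col c M)\<^sup>2"
proof -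
  have eq: "misses col c = (\<lambda>x y. 1 + (-1) * of_bool (col x = col y) + (-1) * of_bool (col x = c)
      + (-1) * of_bool (col y = c) + 2 * (of_bool (col x = c) * of_bool (col y = c)))"
    by (intro ext) (auto simp: misses_def)
  show ?thesis unfolding eq using assms
    by (subst pair_avg_indicators) simp_all
qed

lemma pair_avg_differ:
  assumes "distinct M" "M \<noteq> []"
  shows "pair_avg (set M) (differ col) = 1 - square_sum col M"
proof -
  \<comment> \<open>The terms in \<open>undefined\<close> have coefficient 0; this arbitrary color
    only brings the function into the shape of \<open>pair_avg_indicators\<close>.\<close>
  have eq: "differ col = (\<lambda>x y. 1 + (-1) * of_bool (col x = col y) + 0 * of_bool (col x = undefined)
      + 0 * of_bool (col y = undefined) + 0 * (of_bool (col x = undefined) * of_bool (col y = undefined)))"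
    by (intro ext) (auto simp: differ_def)
  show ?thesis unfolding eq using assms
    by (subst pair_avg_indicators) simp_all
qed

lemma length_same_pairs_psum: "real (length (same_pairs col M)) = psum (\<lambda>x y. of_bool (col x = col y)) (length M div 2) M"
  by (induction M rule: pairs.induct) auto

lemma color_count_same_pairs_psum:
  "real (color_count col c (same_pairs col M)) = psum (\<lambda>x y. of_bool (col x = c) * of_bool (col y = c)) (length M div 2) M"
  by (induction M rule: pairs.induct) auto

text \<open>Quantified over all colors, because the candidate is determined by the recursive call on
  a list that depends on this very shuffle. The prefix lengths \<open>T\<close> depend on
  \<open>M\<close> alone, so that they are fixed before shuffling.\<close>

definition good_pairs :: "(ball \<Rightarrow> 'c) \<Rightarrow> real \<Rightarrow> ('c \<Rightarrow> nat) \<Rightarrow> ball list \<Rightarrow> ball list \<Rightarrow> bool" where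
  "good_pairs col r T M M' \<longleftrightarrow> (let S = square_sum col M; h = real (length M div 2); X = same_pairs col M' in
     (real (length X) \<le> h * S + r \<and> real (length X) \<ge> h * S - r) \<and>
     (\<forall>c\<in>col ` set M. let p = color_freq col c M in
        real (color_count col c X) \<le> h * p\<^sup>2 + r \<and>
        psum (loop_cost col c) (T c) M' \<le> real (T c) * (2 - 2 * S - p + p\<^sup>2) + 2 * r \<and>
        psum (misses col c) (T c) M' \<ge> real (T c) * (1 - S - 2 * p + 2 * p\<^sup>2) - r))"

lemma psum_half: "psum (\<lambda>x y. f x y / 2) t M = psum f t M / 2"
proof -
  have "(\<Sum>(x, y)\<leftarrow>zs. f x y / 2) = (\<Sum>(x, y)\<leftarrow>zs. f x y) / 2" for zs
    by (induction zs) (auto simp: add_divide_distrib)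
  thus ?thesis by (simp add: psum_def)
qed

lemma prob_good_pairs:
  assumes M: "distinct M" "length M \<ge> 2" and T: "\<And>c. 2 * T c \<le> length M" and r: "r > 0"
  shows "measure_pmf.prob (uperm (set M)) {M'. \<not> good_pairs col (1 + r) T M M'} \<le>
    5 * real (length M) * exp (- (r\<^sup>2 / (2 * real (length M))))"
proof -
  define e where "e = exp (- (r\<^sup>2 / (2 * real (length M))))"
  let ?P = "measure_pmf.prob (uperm (set M))"
  define h where "h = length M div 2"
  have cardM: "card (set M) = length M" using M by (simp add: distinct_card)
  have ne: "M \<noteq> []" using M by auto
  have h: "2 * h \<le> card (set M)" by (simp add: h_def cardM)
  have len: "length us = length M" if "us \<in> set_pmf (uperm (set M))" for us
    using that by (auto simp: set_uperm cardM dest: length_finite_permutations_of_set)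
  have up: "?P {us. \<not> psum f t us \<le> real t * pair_avg (set M) f + (1 + r)} \<le> e"
    if "2 * t \<le> card (set M)" "\<And>x y. 0 \<le> f x y \<and> f x y \<le> 1" for t f
  proof -
    have "?P {us. \<not> psum f t us \<le> real t * pair_avg (set M) f + (1 + r)} \<le>
      ?P {us. psum f t us \<ge> real t * pair_avg (set M) f + 1 + r}"
      by (intro measure_pmf.finite_measure_mono) auto
    also have "\<dots> \<le> e" unfolding e_def cardM[symmetric] using that r by (intro psum_upper_tail) auto
    finally show ?thesis .
  qed
  have lo: "?P {us. \<not> psum f t us \<ge> real t * pair_avg (set M) f - (1 + r)} \<le> e"
    if "2 * t \<le> card (set M)" "\<And>x y. 0 \<le> f x y \<and> f x y \<le> 1" for t f
  proof -
    have "?P {us. \<not> psum f t us \<ge> real t * pair_avg (set M) f - (1 + r)} \<le>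
      ?P {us. psum f t us \<le> real t * pair_avg (set M) f - 1 - r}"
      by (intro measure_pmf.finite_measure_mono) auto
    also have "\<dots> \<le> e" unfolding e_def cardM[symmetric] using that r by (intro psum_lower_tail) auto
    finally show ?thesis .
  qed
  let ?agree = "\<lambda>x y. of_bool (col x = col y)"
  let ?both = "\<lambda>c x y. of_bool (col x = c) * of_bool (col y = c)"
  let ?E = "\<lambda>us. (psum ?agree h us \<le> real h * square_sum col M + (1 + r) \<and> psum ?agree h us \<ge> real h * square_sum col M - (1 + r)) \<and>
    (\<forall>c\<in>col ` set M. psum (?both c) h us \<le> real h * (color_freq col c M)\<^sup>2 + (1 + r) \<and>
      psum (\<lambda>x y. loop_cost col c x y / 2) (T c) us \<le> real (T c) * pair_avg (set M) (\<lambda>x y. loop_cost col c x y / 2) + (1 + r) \<and>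
      psum (misses col c) (T c) us \<ge> real (T c) * pair_avg (set M) (misses col c) - (1 + r))"
  \<comment> \<open>Two events, and three more for each of at most n colors; 2 + 3n is at most
    5n.\<close>
  have "?P {us. \<not> ?E us} \<le> (e + e) + real (card (col ` set M)) * (e + (e + e))"
  proof (intro prob_conj_le prob_ball_le)
    show "?P {us. \<not> psum ?agree h us \<le> real h * square_sum col M + (1 + r)} \<le> e"
      using up[OF h, of ?agree] by (simp add: pair_avg_agree M)
    show "?P {us. \<not> psum ?agree h us \<ge> real h * square_sum col M - (1 + r)} \<le> e"
      using lo[OF h, of ?agree] by (simp add: pair_avg_agree M)
  next
    fix c assume "c \<in> col ` set M"
    show "?P {us. \<not> psum (?both c) h us \<le> real h * (color_freq col c M)\<^sup>2 + (1 + r)} \<le> e"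
      using up[OF h, of "?both c"] by (simp add: pair_avg_both M)
    show "?P {us. \<not> psum (\<lambda>x y. loop_cost col c x y / 2) (T c) us \<le> real (T c) * pair_avg (set M) (\<lambda>x y. loop_cost col c x y / 2) + (1 + r)} \<le> e"
      using T[of c] by (intro up) (auto simp: cardM loop_cost_def)
    show "?P {us. \<not> psum (misses col c) (T c) us \<ge> real (T c) * pair_avg (set M) (misses col c) - (1 + r)} \<le> e"
      using T[of c] by (intro lo) (auto simp: cardM misses_def)
  qed auto
  also have "\<dots> \<le> 5 * real (length M) * e"
  proof -
    have "card (col ` set M) \<le> length M" using card_image_le[of "set M" col] by (simp add: cardM)
    hence "real (card (col ` set M)) * (3 * e) \<le> real (length M) * (3 * e)"
      by (intro mult_right_mono) (auto simp: e_def)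
    moreover have "2 * e \<le> real (length M) * (2 * e)" using M(2) by (simp add: e_def)
    ultimately show ?thesis by (simp add: algebra_simps)
  qed
  finally have "?P {us. \<not> ?E us} \<le> 5 * real (length M) * e" .
  moreover have "?P {M'. \<not> good_pairs col (1 + r) T M M'} \<le> ?P {us. \<not> ?E us}"
  proof (intro measure_pmf.finite_measure_mono_AE AE_pmfI impI)
    fix us assume us: "us \<in> set_pmf (uperm (set M))" and bad: "us \<in> {M'. \<not> good_pairs col (1 + r) T M M'}"
    note l = len[OF us]
    have "good_pairs col (1 + r) T M us" if "?E us"
      unfolding good_pairs_def Let_def length_same_pairs_psum color_count_same_pairs_psum l h_def[symmetric]
      using that by (auto simp: pair_avg_misses pair_avg_loop_cost M ne psum_half field_simps)
    thus "us \<in> {us. \<not> ?E us}" using bad by blast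
  qed auto
  ultimately show ?thesis unfolding e_def by linarith
qed

section \<open>The cost of a pairing round\<close>

text \<open>
  Let \<open>p\<close> be the frequency of the candidate's color, \<open>S\<close> the sum of the squared frequencies and
  \<open>A = 2 * p\<^sup>2 - S\<close>. The counter of \<open>light\<close> starts at about \<open>A * n / 2\<close>, and a pair lowers it with
  probability \<open>1 - 2 * p + A\<close>, so that the loop stops after a fraction \<open>A / (1 - 2 * p + A)\<close> of the
  pairs. The inequality says that the resulting cost is at most \<open>7 / 6 * n\<close>. The difference of its
  two sides is concave in \<open>A\<close>, which leaves the endpoints \<open>A = 0\<close> and \<open>A = p\<^sup>2\<close>.
\<close>

lemma early_stop_polynomial:
  fixes p A :: real
  assumes p: "0 \<le> p" "p \<le> 451 / 1000" and A: "0 \<le> A" "A \<le> p\<^sup>2"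
  shows "A * (2 - p - 3 * p\<^sup>2 + 2 * A) \<le> (4 / 3 - 7 / 3 * p\<^sup>2 + 7 / 6 * A) * (1 - 2 * p + A)"
proof -
  define G where "G = (\<lambda>A. (4 / 3 - 7 / 3 * p\<^sup>2 + 7 / 6 * A) * (1 - 2 * p + A) - A * (2 - p - 3 * p\<^sup>2 + 2 * A))"
  \<comment> \<open>The slope of the chord of \<open>G\<close> between \<open>A = 0\<close> and
    \<open>A = p\<^sup>2\<close>. The excess of \<open>G\<close> over the chord is 5/6 * A * (p^2 -
    A), so \<open>G\<close> is bounded below by its chord and hence by the smaller endpoint
    value.\<close>
  define b where "b = 1 / 2 - 4 / 3 * p + 2 / 3 * p\<^sup>2 - 5 / 6 * p\<^sup>2"
  have pp: "p\<^sup>2 \<le> (451 / 1000)\<^sup>2" using p by (intro power_mono) auto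
  have G0: "0 \<le> G 0" unfolding G_def using p pp by (auto simp: power2_eq_square intro!: mult_nonneg_nonneg)
  \<comment> \<open>This is the endpoint with S = p^2. The second factor below is negative at p =
    1/2, so here the threshold 0.45 of the heavy case matters; 451/1000 is this threshold with room
    for the sampling error.\<close>
  have Gp: "0 \<le> G (p\<^sup>2)"
  proof -
    have "G (p\<^sup>2) = (1 - p) * (4 / 3 - 4 / 3 * p - 19 / 6 * p\<^sup>2 + p * p\<^sup>2 / 6)"
      by (simp add: G_def power2_eq_square field_simps)
    moreover have "0 \<le> p * p\<^sup>2" using p by simp
    ultimately show ?thesis using p pp by (simp add: power2_eq_square)
  qed
  have "G A = G 0 + A * b + 5 / 6 * (A * (p\<^sup>2 - A))"
    by (simp add: G_def b_def power2_eq_square field_simps)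
  hence G: "G A \<ge> G 0 + A * b" using A by simp
  have Gp': "G (p\<^sup>2) = G 0 + p\<^sup>2 * b"
    by (simp add: G_def b_def power2_eq_square field_simps)
  have "0 \<le> G A"
  proof (cases "0 \<le> b")
    case True
    thus ?thesis using G G0 A mult_nonneg_nonneg[of A b] by linarith
  next
    case False
    hence "p\<^sup>2 * b \<le> A * b" using A by (intro mult_right_mono_neg) auto
    thus ?thesis using G Gp Gp' by linarith
  qed
  thus ?thesis by (simp add: G_def)
qed

text \<open>
  The loop may be stopped after \<open>x * n\<close> pairs, where \<open>n / 2\<close> is their total number. The tolerance
  \<open>10 * \<delta>\<close> absorbs the deviations of the random shuffle.
\<close>

lemma early_stop_fraction:
  fixes p S \<delta> :: real
  assumes p: "0 \<le> p" "p \<le> 1" and \<delta>: "0 < \<delta>" "\<delta> \<le> 1 / 10000"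
    and S: "p\<^sup>2 \<le> S" "S \<le> p\<^sup>2 + (1 - p)\<^sup>2" "- 20 * \<delta> \<le> 2 * p\<^sup>2 - S"
    and cond: "p \<le> 451 / 1000 \<or> 2 * p\<^sup>2 \<le> S + \<delta>"
  shows "\<exists>x\<ge>0. (x = 1 / 2 \<or> (2 * p\<^sup>2 - S) / 2 + 10 * \<delta> \<le> x * (1 - S - 2 * p + 2 * p\<^sup>2)) \<and>
    x * (2 - 2 * S - p + p\<^sup>2) \<le> 2 / 3 + 1000 * \<delta> - 7 / 12 * S"
proof -
  define A where "A = 2 * p\<^sup>2 - S"
  have S_eq: "S = 2 * p\<^sup>2 - A" by (simp add: A_def)
  have A: "A \<le> p\<^sup>2" "- 20 * \<delta> \<le> A" using S by (auto simp: A_def)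
  have R: "- A \<le> 1 - 2 * p" using S(2) by (simp add: A_def power2_eq_square algebra_simps)
  have D: "1 - S - 2 * p + 2 * p\<^sup>2 = 1 - 2 * p + A" by (simp add: A_def)
  have W: "2 - 2 * S - p + p\<^sup>2 = 2 - p - 3 * p\<^sup>2 + 2 * A" by (simp add: A_def)
  have W2: "2 - 2 * S - p + p\<^sup>2 \<le> 2"
  proof -
    have "0 \<le> S" using S(1) by (meson order.trans zero_le_power2)
    moreover have "p\<^sup>2 \<le> p" using p by (simp add: power2_eq_square mult_left_le)
    ultimately show ?thesis by linarith
  qed
  show ?thesis
  proof (cases "p \<le> 451 / 1000")
    case True
    have pp: "p\<^sup>2 \<le> (451 / 1000)\<^sup>2" using True p by (intro power_mono) auto
    show ?thesis
    proof (cases "0 \<le> A")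
      case nn: True
      \<comment> \<open>The first summand times the miss rate is exactly A/2. The rate is at least
        0.098, so the reserve of 120 * \<delta> buys 11.76 * \<delta> and thus the required
        tolerance.\<close>
      define x where "x = A / (2 * (1 - 2 * p + A)) + 120 * \<delta>"
      have d: "1 - 2 * p + A \<ge> 98 / 1000" using True nn by simp
      have "x * (1 - 2 * p + A) = A / 2 + 120 * \<delta> * (1 - 2 * p + A)"
        using d by (simp add: x_def field_simps)
      moreover have "120 * \<delta> * (1 - 2 * p + A) \<ge> 120 * \<delta> * (98 / 1000)"
        using d \<delta> by (intro mult_left_mono) auto
      ultimately have 1: "A / 2 + 10 * \<delta> \<le> x * (1 - 2 * p + A)" using \<delta> by linarith
      have "A / (2 * (1 - 2 * p + A)) * (2 - p - 3 * p\<^sup>2 + 2 * A) \<le> (4 / 3 - 7 / 3 * p\<^sup>2 + 7 / 6 * A) / 2"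
        using early_stop_polynomial[OF p(1) True nn A(1)] d by (simp add: field_simps)
      moreover have "120 * \<delta> * (2 - 2 * S - p + p\<^sup>2) \<le> 120 * \<delta> * 2"
        using W2 \<delta> by (intro mult_left_mono) auto
      moreover have "x * (2 - 2 * S - p + p\<^sup>2) = A / (2 * (1 - 2 * p + A)) * (2 - p - 3 * p\<^sup>2 + 2 * A) + 120 * \<delta> * (2 - 2 * S - p + p\<^sup>2)"
        by (simp only: x_def distrib_right W)
      ultimately have "x * (2 - 2 * S - p + p\<^sup>2) \<le> (4 / 3 - 7 / 3 * p\<^sup>2 + 7 / 6 * A) / 2 + 240 * \<delta>"
        by linarith
      also have "\<dots> = 2 / 3 + 240 * \<delta> - 7 / 12 * S" by (simp add: S_eq field_simps)
      also have "\<dots> \<le> 2 / 3 + 1000 * \<delta> - 7 / 12 * S" using \<delta> by simp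
      finally have 2: "x * (2 - 2 * S - p + p\<^sup>2) \<le> 2 / 3 + 1000 * \<delta> - 7 / 12 * S" .
      have "0 \<le> x" unfolding x_def using nn d \<delta> by (intro add_nonneg_nonneg divide_nonneg_nonneg) auto
      with 1 2 show ?thesis unfolding D A_def[symmetric] by blast
    next
      case neg: False
      \<comment> \<open>With \<open>A\<close> negative only the tolerance has to be bought, at a
        miss rate of at least 0.098 - 20 * \<delta>, that is, 0.096.\<close>
      define x where "x = 120 * \<delta>"
      have "1 - 2 * p + A \<ge> 96 / 1000" using True A(2) \<delta> by linarith
      hence "120 * \<delta> * (1 - 2 * p + A) \<ge> 120 * \<delta> * (96 / 1000)"
        using \<delta> by (intro mult_left_mono) auto
      hence 1: "A / 2 + 10 * \<delta> \<le> x * (1 - 2 * p + A)" unfolding x_def using \<delta> neg by linarith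
      have "S \<le> 2 * (451 / 1000)\<^sup>2 + 20 * \<delta>" using pp A(2) by (simp add: S_eq)
      hence "S \<le> 1 / 2" using \<delta> by (simp add: power2_eq_square)
      moreover have "x * (2 - 2 * S - p + p\<^sup>2) \<le> x * 2"
        using W2 \<delta> by (intro mult_left_mono) (auto simp: x_def)
      ultimately have 2: "x * (2 - 2 * S - p + p\<^sup>2) \<le> 2 / 3 + 1000 * \<delta> - 7 / 12 * S"
        using \<delta> unfolding x_def by linarith
      have "0 \<le> x" unfolding x_def using \<delta> by simp
      with 1 2 show ?thesis unfolding D A_def[symmetric] by blast
    qed
  next
    case False
    with cond have A1: "A \<le> \<delta>" by (simp add: A_def)
    \<comment> \<open>The counter is small now, and \<open>\<rho>\<close> separates two situations:
      either \<open>p\<close> is clearly below 1/2 and misses are frequent enough for an early stop,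
      or \<open>p\<close> is near 1/2 and the whole loop is affordable.\<close>
    define \<rho> where "\<rho> = 1000 * \<delta>"
    have \<rho>: "0 < \<rho>" "\<rho> \<le> 1 / 10" using \<delta> by (auto simp: \<rho>_def)
    show ?thesis
    proof (cases "\<rho> \<le> 1 - 2 * p")
      case True
      \<comment> \<open>The miss rate is at least 980 * \<delta>, so x times the rate exceeds 20 *
        \<delta>, while 10.5 * \<delta> is required. The cost of at most 0.042 is far below 2/3 -
        7/24 = 3/8.\<close>
      define x :: real where "x = 21 / 1000"
      have "x * (1 - 2 * p + A) \<ge> x * (980 * \<delta>)"
        using True A(2) \<delta> by (intro mult_left_mono) (auto simp: x_def \<rho>_def)
      hence 1: "A / 2 + 10 * \<delta> \<le> x * (1 - 2 * p + A)" using A1 \<delta> by (simp add: x_def)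
      have "p\<^sup>2 \<le> (1 / 2)\<^sup>2" using True \<rho> p by (intro power_mono) auto
      hence "S \<le> 1 / 2 + 20 * \<delta>" using A(2) by (simp add: S_eq power2_eq_square)
      moreover have "x * (2 - 2 * S - p + p\<^sup>2) \<le> x * 2" using W2 by (intro mult_left_mono) (auto simp: x_def)
      ultimately have 2: "x * (2 - 2 * S - p + p\<^sup>2) \<le> 2 / 3 + 1000 * \<delta> - 7 / 12 * S"
        using \<delta> unfolding x_def by linarith
      have "0 \<le> x" by (simp add: x_def)
      with 1 2 show ?thesis unfolding D A_def[symmetric] by blast
    next
      case False
      \<comment> \<open>A complete loop, with equality at p = S = 1/2 up to the error terms.
        Frequencies clearly above 1/2 are excluded: \<open>R\<close> says that they would force a
        large \<open>A\<close>.\<close>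
      define y where "y = 1 - 2 * p"
      have y: "\<bar>y\<bar> \<le> \<rho>" using False R A1 \<delta> by (auto simp: y_def \<rho>_def)
      have p_eq: "p = (1 - y) / 2" by (simp add: y_def)
      have "1 / 2 * (2 - 2 * S - p + p\<^sup>2) + 7 / 12 * S = 1 - 5 / 12 * S - p / 2 + p\<^sup>2 / 2" by (simp add: field_simps)
      also have "\<dots> \<le> 1 - 5 / 12 * (2 * p\<^sup>2 - \<delta>) - p / 2 + p\<^sup>2 / 2" using A1 by (simp add: S_eq)
      also have "\<dots> = 2 / 3 + 5 / 12 * \<delta> + 5 / 12 * y - y\<^sup>2 / 12"
        by (simp add: p_eq power2_eq_square field_simps)
      also have "\<dots> \<le> 2 / 3 + 1000 * \<delta>"
      proof -
        have "y \<le> 1000 * \<delta>" using y by (simp add: \<rho>_def)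
        moreover have "0 \<le> y\<^sup>2" by simp
        ultimately show ?thesis using \<delta> by linarith
      qed
      finally have "1 / 2 * (2 - 2 * S - p + p\<^sup>2) \<le> 2 / 3 + 1000 * \<delta> - 7 / 12 * S" by linarith
      thus ?thesis by (intro exI[of _ "1 / 2"] conjI) auto
    qed
  qed
qed

text \<open>The color of frequency \<open>q\<close> keeps \<open>p\<close> from exceeding 1/2 by
  more than \<delta>, and a \<open>p\<close> clearly below 1/2 could not win the recursive call.
  Hence \<open>p\<close> is within O(\<delta>) of 1/2, where cost plus 7/12 * S is 7/8 - 5/12 * S up
  to a square, which is 2/3 for S = 1/2.\<close>

lemma balanced_fraction:
  fixes p q S \<delta> :: real
  assumes p: "0 \<le> p" and \<delta>: "0 < \<delta>" "\<delta> \<le> 1 / 10000"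
    and q: "1 / 2 - \<delta> \<le> q" "p + q \<le> 1"
    and S: "1 / 2 - 2 * \<delta> \<le> S" "- 20 * \<delta> \<le> 2 * p\<^sup>2 - S"
  shows "1 / 2 * (2 - 2 * S - p + p\<^sup>2) \<le> 2 / 3 + 1000 * \<delta> - 7 / 12 * S"
proof -
  have p22: "p \<ge> 1 / 2 - 22 * \<delta>"
  proof (rule ccontr)
    assume "\<not> ?thesis"
    hence "p \<le> 1 / 2 - 22 * \<delta>" by simp
    hence "p\<^sup>2 \<le> (1 / 2 - 22 * \<delta>)\<^sup>2" using p by (intro power_mono) auto
    also have "\<dots> = 1 / 4 - 22 * \<delta> + 484 * (\<delta> * \<delta>)" by (simp add: power2_eq_square algebra_simps)
    also have "\<delta> * \<delta> \<le> \<delta> * (1 / 10000)" using \<delta> by (intro mult_left_mono) auto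
    finally show False using S \<delta> by simp
  qed
  define y where "y = 1 - 2 * p"
  have p_eq: "p = (1 - y) / 2" by (simp add: y_def)
  have y: "\<bar>y\<bar> \<le> 44 * \<delta>" using p22 q by (simp add: y_def)
  have "y\<^sup>2 = \<bar>y\<bar> * \<bar>y\<bar>" by (simp add: power2_eq_square)
  also have "\<dots> \<le> 44 * \<delta> * 1" using y \<delta> by (intro mult_mono) auto
  finally have y2: "y\<^sup>2 \<le> 44 * \<delta>" by simp
  have "1 / 2 * (2 - 2 * S - p + p\<^sup>2) + 7 / 12 * S = 1 - 5 / 12 * S - 1 / 8 + y\<^sup>2 / 8"
    by (simp add: p_eq power2_eq_square field_simps)
  also have "\<dots> \<le> 2 / 3 + 1000 * \<delta>" using y2 S \<delta> by linarith
  finally show ?thesis by linarith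
qed

section \<open>From the inequalities to a bound for a pairing round\<close>

lemma mset_same_pairs: "mset (same_pairs col M @ unpaired M) \<subseteq># mset M"
proof (induction M rule: pairs.induct)
  case (1 a b M)
  have "mset (same_pairs col (a # b # M) @ unpaired (a # b # M)) \<subseteq># add_mset b (mset (same_pairs col M @ unpaired M))"
    by simp
  also have "\<dots> \<subseteq># add_mset b (mset M)" using 1 by simp
  also have "\<dots> \<subseteq># mset (a # b # M)" by simp
  finally show ?case .
qed auto

lemma mset_rec_input: "mset (rec_input M (same_pairs col M)) \<subseteq># mset M"
proof -
  have "mset (rec_input M (same_pairs col M)) \<subseteq># mset (same_pairs col M @ unpaired M)"
    by (simp add: rec_input_def)
  thus ?thesis using mset_same_pairs subset_mset.order_trans by blast
qed

lemma distinct_rec_input: "distinct M \<Longrightarrow> distinct (rec_input M (same_pairs col M))"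
  using mset_rec_input[of M col]
  by (metis distinct_append ex_mset mset_append mset_eq_imp_distinct_iff mset_subset_eq_exists_conv)

text \<open>With h pairs, \<open>X\<close> has about h * S balls, of which about h * p^2 have the
  candidate's color. A majority therefore forces h * (2 * p^2 - S) above -3 * \<delta> * m - 5,
  whereas a violation would put it below -10 * \<delta> * (m - 1).\<close>

lemma answer_freq:
  assumes M: "mset M' = mset M" and good: "good_pairs col (1 + \<delta> * real (length M)) T M M'"
    and ans: "correct_answer col (rec_input M' (same_pairs col M')) (Some (v, k))"
    and \<delta>: "0 < \<delta>" "\<delta> \<le> 1 / 10000" "10 \<le> \<delta> * real (length M)"
  shows "col v \<in> col ` set M" "- 20 * \<delta> \<le> 2 * (color_freq col (col v) M)\<^sup>2 - square_sum col M"
proof -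
  let ?N = "rec_input M' (same_pairs col M')" and ?X = "same_pairs col M'"
  define m where "m = real (length M)"
  define h where "h = real (length M div 2)"
  define A where "A = 2 * (color_freq col (col v) M)\<^sup>2 - square_sum col M"
  have k: "k = color_count col (col v) ?N" "length ?N < 2 * k"
    using ans by (auto simp: correct_answer_def)
  hence "color_count col (col v) ?N \<noteq> 0" by auto
  hence "col v \<in> col ` set ?N" using color_count_0_iff by metis
  moreover have "set ?N \<subseteq> set M"
    using mset_rec_input[of M' col] M by (metis set_mset_mono set_mset_mset)
  ultimately show c: "col v \<in> col ` set M" by auto
  have "length ?X < 2 * color_count col (col v) ?X + 2"
    using k by (auto simp: rec_input_def unpaired_def split: if_splits)
  hence "real (length ?X) < 2 * real (color_count col (col v) ?X) + 2" by linarith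
  moreover have "real (length ?X) \<ge> h * square_sum col M - (1 + \<delta> * m)"
    "real (color_count col (col v) ?X) \<le> h * (color_freq col (col v) M)\<^sup>2 + (1 + \<delta> * m)"
    using good c by (auto simp: good_pairs_def Let_def h_def m_def)
  ultimately have hA: "h * A > - 3 * (\<delta> * m) - 5"
    unfolding A_def by (simp add: algebra_simps)
  have h: "2 * h \<ge> m - 1" unfolding h_def m_def by linarith
  show "- 20 * \<delta> \<le> 2 * (color_freq col (col v) M)\<^sup>2 - square_sum col M"
  proof (rule ccontr)
    assume "\<not> ?thesis"
    hence "A \<le> - 20 * \<delta>" by (simp add: A_def)
    hence "h * A \<le> h * (- 20 * \<delta>)" by (intro mult_left_mono) (auto simp: h_def)
    also have "\<dots> = - 10 * (\<delta> * (2 * h))" by simp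
    also have "\<dots> \<le> - 10 * (\<delta> * (m - 1))" using h \<delta> by simp
    finally show False using hA \<delta> unfolding m_def[symmetric] by (simp add: algebra_simps)
  qed
qed

text \<open>The induction step common to both pairing cases. The terms in S cancel: pairing costs
  m/2, the recursive call 7/12 * S * m, and \<open>cost\<close> allows the final loop 2/3 * m - 7/12
  * S * m, in total 7/6 * m. The errors amount to 3004 * \<delta> * m + 9; the conclusion keeps
  \<delta> * m in reserve for the comparisons inside the sample.\<close>

lemma fails_pairing:
  assumes M: "distinct M" and T: "\<And>c. T c \<le> length M div 2"
    and \<delta>: "0 < \<delta>" "\<delta> \<le> 1 / 10000" "10 \<le> \<delta> * real (length M)"
    and cost: "\<And>c. c \<in> col ` set M \<Longrightarrow> - 20 * \<delta> \<le> 2 * (color_freq col c M)\<^sup>2 - square_sum col M \<Longrightarrow>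
      real (T c) * (2 - 2 * square_sum col M - color_freq col c M + (color_freq col c M)\<^sup>2) \<le>
        real (length M) * (2 / 3 + 1000 * \<delta> - 7 / 12 * square_sum col M) + 2"
    and tail: "\<And>M' ans. mset M' = mset M \<Longrightarrow> good_pairs col (1 + \<delta> * real (length M)) T M M' \<Longrightarrow>
      correct_answer col (rec_input M' (same_pairs col M')) ans \<Longrightarrow>
      holds col (tail M' (same_pairs col M') (diff_pairs col M') ans) (\<lambda>r c. real c \<le> tail_cost col T M' ans)"
    and rec: "\<And>N. distinct N \<Longrightarrow> length N \<le> (length M + 1) div 2 \<Longrightarrow>
      fails col (majority N) (\<lambda>r c. real c \<le> (7 / 6 + 4000 * \<delta>) * real (length N) + D) \<le> \<beta>"
    and nn: "0 \<le> \<beta>" "0 \<le> D"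
  shows "fails col (pairing tail M) (\<lambda>r c. real c \<le> (7 / 6 + 4000 * \<delta>) * real (length M) - \<delta> * real (length M) + D)
    \<le> 5 * real (length M) * exp (- (\<delta>\<^sup>2 * real (length M) / 2)) + \<beta>"
  unfolding pairing_def
proof (rule fails_bind)
  define m where "m = real (length M)"
  define h where "h = length M div 2"
  define S where "S = square_sum col M"
  have "100000 * \<delta> * m \<le> 10 * m" using \<delta> by (intro mult_right_mono) (auto simp: m_def)
  hence mge: "m \<ge> 100000" using \<delta>(3) unfolding m_def[symmetric] by linarith
  have m2: "length M \<ge> 2" using mge by (simp add: m_def)
  have hm: "2 * real h \<le> m" unfolding h_def m_def by linarith
  have S01: "0 \<le> S" unfolding S_def by (rule square_sum_nonneg)
  have "M \<noteq> []" using m2 by auto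
  let ?G = "\<lambda>M'. good_pairs col (1 + \<delta> * m) T M M'"
  show "fails col (shuffle M) (\<lambda>M' c. mset M' = mset M \<and> c = 0 \<and> ?G M') \<le>
     5 * real (length M) * exp (- (\<delta>\<^sup>2 * real (length M) / 2))"
  proof -
    have "fails col (shuffle M) (\<lambda>M' c. mset M' = mset M \<and> c = 0 \<and> ?G M') \<le> measure_pmf.prob (uperm (set M)) {M'. \<not> ?G M'}"
      by (rule fails_shuffle) fact
    also have "\<dots> \<le> 5 * real (length M) * exp (- ((\<delta> * m)\<^sup>2 / (2 * real (length M))))"
    proof (rule prob_good_pairs[OF M m2])
      show "2 * T c \<le> length M" for c using T[of c] by linarith
      show "\<delta> * m > 0" using \<delta> mge by simp
    qed
    also have "(\<delta> * m)\<^sup>2 / (2 * real (length M)) = \<delta>\<^sup>2 * real (length M) / 2"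
      using mge by (simp add: m_def power2_eq_square)
    finally show ?thesis .
  qed
  show "0 \<le> \<beta>" by fact
  fix M' and c0 :: nat
  assume M': "mset M' = mset M \<and> c0 = 0 \<and> ?G M'"
  have len: "length M' = length M" using M' by (auto dest: mset_eq_length)
  have dist': "distinct M'" using M M' by (auto dest: mset_eq_imp_distinct_iff)
  let ?X = "same_pairs col M'" and ?Y = "diff_pairs col M'"
  let ?N = "rec_input M' ?X"
  let ?bound = "(7 / 6 + 4000 * \<delta>) * real (length M) - \<delta> * real (length M) + D"
  have lN: "length ?N \<le> (length M + 1) div 2"
    using length_rec_input_same_pairs[of M' col] by (simp add: len)
  have lN1: "real (length ?N) \<le> real (length ?X) + 1"
    by (auto simp: rec_input_def unpaired_def)
  have X: "real (length ?X) \<le> real h * S + (1 + \<delta> * m)"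
    using M' by (auto simp: good_pairs_def Let_def h_def S_def)
  have Xh: "real (length ?X) \<le> real h" using length_same_pairs[of col M'] by (simp add: h_def len)
  show "fails col (pair_up M' \<bind> (\<lambda>(X, Y). majority (rec_input M' X) \<bind> tail M' X Y))
     (\<lambda>r' d. real (c0 + d) \<le> ?bound) \<le> \<beta>"
  proof (rule fails_bind_holds[OF holds_pair_up nn(1)], clarify)
    have "fails col (majority ?N) (\<lambda>ans c. (correct_answer col ?N ans \<and> c \<le> 10 * length ?N) \<and> real c \<le> (7 / 6 + 4000 * \<delta>) * real (length ?N) + D) \<le> \<beta>"
      by (rule order.trans[OF fails_conj_holds[OF holds_majority] rec[OF distinct_rec_input[OF dist'] lN]])
    hence "fails col (majority ?N \<bind> tail M' ?X ?Y) (\<lambda>r d. real (c0 + (length M' div 2 + d)) \<le> ?bound) \<le> \<beta> + 0"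
    proof (rule fails_bind)
      fix ans c
      assume a: "(correct_answer col ?N ans \<and> c \<le> 10 * length ?N) \<and> real c \<le> (7 / 6 + 4000 * \<delta>) * real (length ?N) + D"
      have c: "real c \<le> (7 / 6 + 4000 * \<delta>) * (real (length ?X) + 1) + D"
      proof -
        have "(7 / 6 + 4000 * \<delta>) * real (length ?N) \<le> (7 / 6 + 4000 * \<delta>) * (real (length ?X) + 1)"
          using lN1 \<delta> by (intro mult_left_mono) auto
        with a show ?thesis by linarith
      qed
      have total: "real h + ((7 / 6 + 4000 * \<delta>) * (real (length ?X) + 1) + D) + tail_cost col T M' ans \<le> ?bound"
      proof (cases ans)
        \<comment> \<open>There is no final loop, so even the trivial bound of m/2 on
          \<open>X\<close> suffices: 1/2 + 7/12 = 13/12 < 7/6.\<close>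
        case None
        have "(7 / 6 + 4000 * \<delta>) * (real (length ?X) + 1) \<le> (7 / 6 + 4000 * \<delta>) * (m / 2 + 1)"
          using Xh hm \<delta> by (intro mult_left_mono) auto
        also have "\<dots> = 7 / 12 * m + 2000 * (\<delta> * m) + 7 / 6 + 4000 * \<delta>" by (simp add: algebra_simps)
        finally have "real h + ((7 / 6 + 4000 * \<delta>) * (real (length ?X) + 1) + D) \<le> 13 / 12 * m + 2000 * (\<delta> * m) + 2 + D"
          using hm \<delta> by linarith
        also have "\<dots> \<le> 7 / 6 * m + 4000 * (\<delta> * m) - \<delta> * m + D" using mge \<delta> unfolding m_def[symmetric] by linarith
        finally show ?thesis using None by (simp add: tail_cost_def m_def algebra_simps)
      next
        case (Some p)
        obtain v k where vk: "ans = Some (v, k)" using Some by (cases p) auto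
        have "correct_answer col ?N (Some (v, k))" using a vk by simp
        moreover have G: "?G M'" "mset M' = mset M" using M' by auto
        ultimately have f: "col v \<in> col ` set M"
          "- 20 * \<delta> \<le> 2 * (color_freq col (col v) M)\<^sup>2 - square_sum col M"
          using answer_freq[OF _ _ _ \<delta>, of M' col T v k] unfolding m_def by blast+
        define q where "q = color_freq col (col v) M"
        have "psum (loop_cost col (col v)) (T (col v)) M' \<le> real (T (col v)) * (2 - 2 * S - q + q\<^sup>2) + 2 * (1 + \<delta> * m)"
        proof -
          have "\<forall>c\<in>col ` set M. psum (loop_cost col c) (T c) M' \<le>
              real (T c) * (2 - 2 * S - color_freq col c M + (color_freq col c M)\<^sup>2) + 2 * (1 + \<delta> * m)"
            using G(1) by (simp add: good_pairs_def Let_def S_def)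
          thus ?thesis using f(1) unfolding q_def by blast
        qed
        also have "real (T (col v)) * (2 - 2 * S - q + q\<^sup>2) \<le> m * (2 / 3 + 1000 * \<delta> - 7 / 12 * S) + 2"
          unfolding S_def q_def m_def by (intro cost f)
        finally have 1: "tail_cost col T M' ans \<le> m * (2 / 3 + 1000 * \<delta> - 7 / 12 * S) + 5 + 2 * (\<delta> * m)"
          by (simp add: vk tail_cost_def)
        have S1: "S \<le> 1"
        proof -
          have "q\<^sup>2 \<le> q" "(1 - q)\<^sup>2 \<le> 1 - q"
            using color_freq_nonneg[of col "col v" M] color_freq_le_1[of col "col v" M]
            by (auto simp: q_def power2_eq_square mult_left_le intro: mult_left_le)
          thus ?thesis using square_sum_le[OF \<open>M \<noteq> []\<close>, of col "col v"] unfolding S_def q_def by linarith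
        qed
        have "real h * S \<le> m / 2 * S" using hm S01 by (intro mult_right_mono) auto
        hence "(7 / 6 + 4000 * \<delta>) * (real (length ?X) + 1) \<le> (7 / 6 + 4000 * \<delta>) * (m / 2 * S + (2 + \<delta> * m))"
          using X \<delta> by (intro mult_left_mono) auto
        also have "\<dots> = 7 / 12 * m * S + 2000 * (\<delta> * m) * S + (7 / 6 + 4000 * \<delta>) * (2 + \<delta> * m)"
          by (simp add: algebra_simps)
        also have "(7 / 6 + 4000 * \<delta>) * (2 + \<delta> * m) \<le> 2 * (2 + \<delta> * m)"
          using \<delta> unfolding m_def[symmetric] by (intro mult_right_mono) auto
        also have "2000 * (\<delta> * m) * S \<le> 2000 * (\<delta> * m) * 1"
          using S1 \<delta> unfolding m_def[symmetric] by (intro mult_left_mono) auto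
        finally have 2: "(7 / 6 + 4000 * \<delta>) * (real (length ?X) + 1) \<le> 7 / 12 * m * S + 2002 * (\<delta> * m) + 4"
          by simp
        have "real h + ((7 / 6 + 4000 * \<delta>) * (real (length ?X) + 1) + D) + tail_cost col T M' ans \<le>
          m / 2 + (7 / 12 * m * S + 2002 * (\<delta> * m) + 4 + D) + (m * (2 / 3 + 1000 * \<delta> - 7 / 12 * S) + 5 + 2 * (\<delta> * m))"
          using 1 2 hm by linarith
        also have "\<dots> = 7 / 6 * m + 3004 * (\<delta> * m) + 9 + D" by (simp add: algebra_simps)
        also have "\<dots> \<le> 7 / 6 * m + 4000 * (\<delta> * m) - \<delta> * m + D" using \<delta>(3) unfolding m_def[symmetric] by linarith
        finally show ?thesis by (simp add: m_def algebra_simps)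
      qed
      have "holds col (tail M' ?X ?Y ans) (\<lambda>r d. real d \<le> tail_cost col T M' ans)"
        using M' a by (intro tail) (auto simp: m_def)
      hence "holds col (tail M' ?X ?Y ans) (\<lambda>r d. real (c0 + (length M' div 2 + (c + d))) \<le> ?bound)"
      proof (rule holds_mono)
        fix r d assume "real d \<le> tail_cost col T M' ans"
        thus "real (c0 + (length M' div 2 + (c + d))) \<le> ?bound"
          using total c M' by (simp add: len h_def)
      qed
      thus "fails col (tail M' ?X ?Y ans) (\<lambda>r d. real (c0 + (length M' div 2 + (c + d))) \<le> ?bound) \<le> 0"
        by (simp add: fails_holds)
    qed simp
    thus "fails col (majority ?N \<bind> tail M' ?X ?Y) (\<lambda>r d. real (c0 + (length M' div 2 + d)) \<le> ?bound) \<le> \<beta>" by simp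
  qed
qed

section \<open>The three cases\<close>

lemma fails_light:
  assumes M: "distinct M" and \<delta>: "0 < \<delta>" "\<delta> \<le> 1 / 10000" "10 \<le> \<delta> * real (length M)"
    and cond: "\<And>c. color_freq col c M \<le> 451 / 1000 \<or> 2 * (color_freq col c M)\<^sup>2 \<le> square_sum col M + \<delta>"
    and rec: "\<And>N. distinct N \<Longrightarrow> length N \<le> (length M + 1) div 2 \<Longrightarrow>
      fails col (majority N) (\<lambda>r c. real c \<le> (7 / 6 + 4000 * \<delta>) * real (length N) + D) \<le> \<beta>"
    and nn: "0 \<le> \<beta>" "0 \<le> D"
  shows "fails col (light M) (\<lambda>r c. real c \<le> (7 / 6 + 4000 * \<delta>) * real (length M) - \<delta> * real (length M) + D)
    \<le> 5 * real (length M) * exp (- (\<delta>\<^sup>2 * real (length M) / 2)) + \<beta>"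
proof -
  define m where "m = real (length M)"
  define h where "h = length M div 2"
  define S where "S = square_sum col M"
  let ?p = "\<lambda>c. color_freq col c M"
  have ne: "M \<noteq> []" using \<delta> by auto
  have hm: "2 * real h \<le> m" "m \<le> 2 * real h + 1" unfolding h_def m_def by linarith+
  have sq: "(?p c)\<^sup>2 \<le> S" "S \<le> (?p c)\<^sup>2 + (1 - ?p c)\<^sup>2" for c
    unfolding S_def by (rule square_sum_ge square_sum_le[OF ne])+
  \<comment> \<open>Colors that violate the premise are harmless: by \<open>answer_freq\<close> they
    are never returned after a good shuffle. The implication makes the choice of \<open>x\<close>
    total.\<close>
  have "\<exists>x\<ge>0. - 20 * \<delta> \<le> 2 * (?p c)\<^sup>2 - S \<longrightarrow>
      (x = 1 / 2 \<or> (2 * (?p c)\<^sup>2 - S) / 2 + 10 * \<delta> \<le> x * (1 - S - 2 * ?p c + 2 * (?p c)\<^sup>2)) \<and>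
      x * (2 - 2 * S - ?p c + (?p c)\<^sup>2) \<le> 2 / 3 + 1000 * \<delta> - 7 / 12 * S" for c
  proof (cases "- 20 * \<delta> \<le> 2 * (?p c)\<^sup>2 - S")
    case True
    show ?thesis
      using early_stop_fraction[OF color_freq_nonneg color_freq_le_1 \<delta>(1,2) sq True] cond[of c] unfolding S_def by blast
  qed auto
  then obtain x where x: "\<And>c. 0 \<le> x c"
    "\<And>c. - 20 * \<delta> \<le> 2 * (?p c)\<^sup>2 - S \<Longrightarrow> x c = 1 / 2 \<or> (2 * (?p c)\<^sup>2 - S) / 2 + 10 * \<delta> \<le> x c * (1 - S - 2 * ?p c + 2 * (?p c)\<^sup>2)"
    "\<And>c. - 20 * \<delta> \<le> 2 * (?p c)\<^sup>2 - S \<Longrightarrow> x c * (2 - 2 * S - ?p c + (?p c)\<^sup>2) \<le> 2 / 3 + 1000 * \<delta> - 7 / 12 * S"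
    by metis
  \<comment> \<open>Rounded up so that the misses suffice; rounding costs at most one pair, that is,
    2 comparisons. Once the cap \<open>h\<close> is reached, the loop ends anyway.\<close>
  define T where "T c = min h (nat \<lceil>x c * m\<rceil>)" for c
  have xm: "0 \<le> x c * m" for c using x(1) by (simp add: m_def)
  have T1: "real (T c) \<le> x c * m + 1" for c
    using xm[of c] by (auto simp: T_def min_def; linarith)
  have T2: "T c = h \<or> x c * m \<le> real (T c)" for c
    using xm[of c] by (auto simp: T_def min_def; linarith)
  have W: "0 \<le> 2 - 2 * S - ?p c + (?p c)\<^sup>2" "2 - 2 * S - ?p c + (?p c)\<^sup>2 \<le> 2" for c
  proof -
    have "(?p c)\<^sup>2 \<le> ?p c" using color_freq_nonneg[of col c M] color_freq_le_1[of col c M] by (simp add: power2_eq_square mult_left_le)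
    moreover have "0 \<le> S" unfolding S_def by (rule square_sum_nonneg)
    ultimately show "2 - 2 * S - ?p c + (?p c)\<^sup>2 \<le> 2" by linarith
    have "(1 - ?p c)\<^sup>2 = 1 - 2 * ?p c + (?p c)\<^sup>2" by (simp add: power2_eq_square algebra_simps)
    with sq(2)[of c] \<open>(?p c)\<^sup>2 \<le> ?p c\<close> show "0 \<le> 2 - 2 * S - ?p c + (?p c)\<^sup>2" by linarith
  qed
  show ?thesis unfolding light_pairing
  proof (rule fails_pairing[OF M _ \<delta> _ _ rec nn])
    show "T c \<le> length M div 2" for c by (simp add: T_def h_def)
  next
    fix c assume A: "- 20 * \<delta> \<le> 2 * (?p c)\<^sup>2 - square_sum col M"
    have "real (T c) * (2 - 2 * S - ?p c + (?p c)\<^sup>2) \<le> (x c * m + 1) * (2 - 2 * S - ?p c + (?p c)\<^sup>2)"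
      by (intro mult_right_mono T1 W)
    also have "\<dots> = m * (x c * (2 - 2 * S - ?p c + (?p c)\<^sup>2)) + (2 - 2 * S - ?p c + (?p c)\<^sup>2)"
      by (simp add: algebra_simps)
    also have "\<dots> \<le> m * (2 / 3 + 1000 * \<delta> - 7 / 12 * S) + 2"
      using x(3)[of c] A W(2)[of c] by (intro add_mono mult_left_mono) (auto simp: S_def m_def)
    finally show "real (T c) * (2 - 2 * square_sum col M - ?p c + (?p c)\<^sup>2) \<le>
        real (length M) * (2 / 3 + 1000 * \<delta> - 7 / 12 * square_sum col M) + 2"
      by (simp add: S_def m_def)
  next
    fix M' ans
    assume M': "mset M' = mset M" and good: "good_pairs col (1 + \<delta> * real (length M)) T M M'"
      and ans: "correct_answer col (rec_input M' (same_pairs col M')) ans"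
    have len: "length M' = length M" using M' by (rule mset_eq_length)
    have "holds col (light_tail M M' (same_pairs col M') (diff_pairs col M') ans)
      (\<lambda>r c. correct_answer col M r \<and> real c \<le> tail_cost col T M' ans)"
    proof (rule holds_light_tail[OF M' ans])
      fix v k assume vk: "ans = Some (v, k)"
      let ?c = "col v"
      define A where "A = 2 * (?p ?c)\<^sup>2 - S"
      note f = answer_freq[OF M' good ans[unfolded vk] \<delta>]
      have A: "- 20 * \<delta> \<le> A" using f(2) by (simp add: A_def S_def)
      have X: "real (length (same_pairs col M')) \<ge> real h * S - (1 + \<delta> * m)"
        using good by (auto simp: good_pairs_def Let_def S_def h_def m_def)
      have "\<forall>c\<in>col ` set M. real (color_count col c (same_pairs col M')) \<le> real h * (?p c)\<^sup>2 + (1 + \<delta> * m) \<and>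
          psum (misses col c) (T c) M' \<ge> real (T c) * (1 - S - 2 * ?p c + 2 * (?p c)\<^sup>2) - (1 + \<delta> * m)"
        using good by (simp add: good_pairs_def Let_def S_def h_def m_def)
      with f(1) have G: "real (color_count col ?c (same_pairs col M')) \<le> real h * (?p ?c)\<^sup>2 + (1 + \<delta> * m)"
        "psum (misses col ?c) (T ?c) M' \<ge> real (T ?c) * (1 - S - 2 * ?p ?c + 2 * (?p ?c)\<^sup>2) - (1 + \<delta> * m)" by blast+
      show "T ?c = length M' div 2 \<or> 2 * T ?c \<le> length M' \<and>
        real (2 * color_count col ?c (same_pairs col M') + color_count col ?c (unpaired M')) - real (length (same_pairs col M'))
          \<le> psum (misses col ?c) (T ?c) M'"
      proof (cases "T ?c = h")
        case False
        hence Tx: "x ?c * m \<le> real (T ?c)" using T2 by blast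
        have "x ?c \<noteq> 1 / 2"
        proof
          assume half: "x ?c = 1 / 2"
          have "m / 2 \<le> real (T ?c)" using Tx[unfolded half] by simp
          hence "real h \<le> real (T ?c)" using hm by linarith
          thus False using False by (simp add: T_def)
        qed
        hence x2: "A / 2 + 10 * \<delta> \<le> x ?c * (1 - S - 2 * ?p ?c + 2 * (?p ?c)\<^sup>2)"
          using x(2)[of ?c] A by (simp add: A_def)
        have R: "0 \<le> 1 - S - 2 * ?p ?c + 2 * (?p ?c)\<^sup>2"
          using sq(2)[of ?c] by (simp add: power2_eq_square algebra_simps)
        have "m * (A / 2 + 10 * \<delta>) \<le> m * (x ?c * (1 - S - 2 * ?p ?c + 2 * (?p ?c)\<^sup>2))"
          using x2 by (intro mult_left_mono) (auto simp: m_def)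
        also have "\<dots> = (x ?c * m) * (1 - S - 2 * ?p ?c + 2 * (?p ?c)\<^sup>2)" by simp
        also have "\<dots> \<le> real (T ?c) * (1 - S - 2 * ?p ?c + 2 * (?p ?c)\<^sup>2)"
          by (intro mult_right_mono Tx R)
        finally have 1: "m * A / 2 + 10 * (\<delta> * m) - (1 + \<delta> * m) \<le> psum (misses col ?c) (T ?c) M'"
          using G(2) by (simp add: algebra_simps)
        \<comment> \<open>For odd m the number of pairs is (m - 1) / 2; as \<bar>A\<bar> \<le> 1,
          replacing it by m/2 changes the counter by at most 1/2.\<close>
        have "(2 * real h - m) * A \<le> 1"
        proof -
          have "\<bar>2 * real h - m\<bar> * \<bar>A\<bar> \<le> 1 * 1"
          proof (intro mult_mono)
            have "(?p ?c)\<^sup>2 \<le> 1" using color_freq_nonneg[of col ?c M] color_freq_le_1[of col ?c M]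
              by (simp add: power_le_one)
            thus "\<bar>A\<bar> \<le> 1" using sq(1)[of ?c] A \<delta> by (auto simp: A_def abs_le_iff)
          qed (use hm in auto)
          thus ?thesis by (metis abs_le_D1 abs_mult mult_1)
        qed
        hence hA: "real h * A \<le> m * A / 2 + 1 / 2" by (simp add: algebra_simps)
        have "real (color_count col ?c (unpaired M')) \<le> 1" by (simp add: unpaired_def)
        hence "real (2 * color_count col ?c (same_pairs col M') + color_count col ?c (unpaired M')) - real (length (same_pairs col M'))
          \<le> real h * A + 3 * (1 + \<delta> * m) + 1"
          using G(1) X by (simp add: A_def algebra_simps)
        \<comment> \<open>The counter exceeds m * A / 2 by at most 3 * \<delta> * m plus a constant,
          and the misses exceed it by at least 9 * \<delta> * m - 1. As \<delta> * m \<ge> 10, the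
          difference absorbs all constants.\<close>
        also have "\<dots> \<le> psum (misses col ?c) (T ?c) M'"
        proof -
          have "3 * (1 + \<delta> * m) = 3 + 3 * (\<delta> * m)" by simp
          moreover have "10 \<le> \<delta> * m" using \<delta>(3) by (simp add: m_def)
          ultimately show ?thesis using hA 1 by linarith
        qed
        finally have "real (2 * color_count col ?c (same_pairs col M') + color_count col ?c (unpaired M')) - real (length (same_pairs col M'))
          \<le> psum (misses col ?c) (T ?c) M'" .
        moreover have "2 * T ?c \<le> length M'"
        proof -
          have "T ?c \<le> length M div 2" by (simp add: T_def h_def)
          thus ?thesis unfolding len by linarith
        qed
        ultimately show ?thesis by blast
      qed (simp add: h_def len)
    qed
    thus "holds col (light_tail M M' (same_pairs col M') (diff_pairs col M') ans) (\<lambda>r c. real c \<le> tail_cost col T M' ans)"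
      by (rule holds_mono) simp
  qed
qed

text \<open>\<open>balanced_loop\<close> has no early exit, so \<open>T\<close> is the number of all
  pairs. What makes the complete loop affordable is that two colors together make up nearly
  everything.\<close>

lemma fails_balanced:
  assumes M: "distinct M" and \<delta>: "0 < \<delta>" "\<delta> \<le> 1 / 10000" "10 \<le> \<delta> * real (length M)"
    and cond: "c1 \<noteq> c2" "1 / 2 - \<delta> \<le> color_freq col c1 M" "1 / 2 - \<delta> \<le> color_freq col c2 M"
    and rec: "\<And>N. distinct N \<Longrightarrow> length N \<le> (length M + 1) div 2 \<Longrightarrow>
      fails col (majority N) (\<lambda>r c. real c \<le> (7 / 6 + 4000 * \<delta>) * real (length N) + D) \<le> \<beta>"
    and nn: "0 \<le> \<beta>" "0 \<le> D"
  shows "fails col (balanced M) (\<lambda>r c. real c \<le> (7 / 6 + 4000 * \<delta>) * real (length M) - \<delta> * real (length M) + D)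
    \<le> 5 * real (length M) * exp (- (\<delta>\<^sup>2 * real (length M) / 2)) + \<beta>"
  unfolding balanced_pairing
proof (rule fails_pairing[OF M, where T = "\<lambda>_. length M div 2", OF order.refl \<delta> _ _ rec nn])
  define m where "m = real (length M)"
  define S where "S = square_sum col M"
  let ?p = "\<lambda>c. color_freq col c M"
  have ne: "M \<noteq> []" using \<delta> by auto
  have S: "1 / 2 - 2 * \<delta> \<le> S"
  proof -
    have *: "1 / 4 - \<delta> \<le> q\<^sup>2" if "1 / 2 - \<delta> \<le> q" for q
    proof -
      have "(1 / 2 - \<delta>)\<^sup>2 \<le> q\<^sup>2" using that \<delta> by (intro power_mono) auto
      thus ?thesis by (simp add: power2_eq_square algebra_simps) (use zero_le_square[of \<delta>] in linarith)
    qed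
    have "(?p c1)\<^sup>2 + (?p c2)\<^sup>2 \<le> S" unfolding S_def by (rule square_sum_ge_two[OF cond(1)])
    with *[OF cond(2)] *[OF cond(3)] show ?thesis by linarith
  qed
  fix c assume A: "- 20 * \<delta> \<le> 2 * (?p c)\<^sup>2 - square_sum col M"
  have W: "0 \<le> 2 - 2 * S - ?p c + (?p c)\<^sup>2"
  proof -
    have "(?p c)\<^sup>2 \<le> ?p c" using color_freq_nonneg[of col c M] color_freq_le_1[of col c M] by (simp add: power2_eq_square mult_left_le)
    moreover have "(1 - ?p c)\<^sup>2 = 1 - 2 * ?p c + (?p c)\<^sup>2" by (simp add: power2_eq_square algebra_simps)
    ultimately show ?thesis using square_sum_le[OF ne, of col c] unfolding S_def by linarith
  qed
  \<comment> \<open>Whatever color the recursive call returns, at least one of the two colors near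
    1/2 is a different one and bounds its frequency from above.\<close>
  obtain c' where c': "c \<noteq> c'" "1 / 2 - \<delta> \<le> ?p c'" using cond by metis
  have "1 / 2 * (2 - 2 * S - ?p c + (?p c)\<^sup>2) \<le> 2 / 3 + 1000 * \<delta> - 7 / 12 * S"
    using c' A S color_freq_add_le[OF c'(1) ne, of col] \<delta> by (intro balanced_fraction[where q = "?p c'"]) (auto simp: S_def)
  hence "m * (1 / 2 * (2 - 2 * S - ?p c + (?p c)\<^sup>2)) \<le> m * (2 / 3 + 1000 * \<delta> - 7 / 12 * S)"
    by (intro mult_left_mono) (auto simp: m_def)
  moreover have "real (length M div 2) * (2 - 2 * S - ?p c + (?p c)\<^sup>2) \<le> m / 2 * (2 - 2 * S - ?p c + (?p c)\<^sup>2)"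
    unfolding m_def by (intro mult_right_mono W) linarith
  ultimately show "real (length M div 2) * (2 - 2 * square_sum col M - ?p c + (?p c)\<^sup>2) \<le>
      real (length M) * (2 / 3 + 1000 * \<delta> - 7 / 12 * square_sum col M) + 2"
    unfolding S_def m_def by (simp add: algebra_simps)
next
  fix M' ans
  assume M': "mset M' = mset M" and ans: "correct_answer col (rec_input M' (same_pairs col M')) ans"
  have "length M' = length M" using M' by (rule mset_eq_length)
  with holds_balanced_tail[OF M' ans]
  show "holds col (balanced_tail M M' (same_pairs col M') (diff_pairs col M') ans) (\<lambda>r c. real c \<le> tail_cost col (\<lambda>_. length M div 2) M' ans)"
    by (auto elim: holds_mono)
qed

lemma color_count_filter:
  "color_count col c (filter (\<lambda>x. col x \<noteq> d) M) = (if c = d then 0 else color_count col c M)"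
  by (induction M) auto

text \<open>Inspecting \<open>n / 6\<close> pairs exhausts the counter because \<open>(1 - p)\<^sup>2 / 2 < 1 / 6\<close> for \<open>p \<ge> 0.44\<close>.\<close>

lemma fails_heavy:
  assumes M: "distinct M" and e: "0 < e" "4 \<le> e * real (length M)" and m: "600 \<le> length M"
    and p: "44 / 100 \<le> color_freq col (col v) M" "square_sum col M + e \<le> 2 * (color_freq col (col v) M)\<^sup>2"
  shows "fails col (heavy M v) (\<lambda>r c. real c \<le> 7 / 6 * real (length M)) \<le> exp (- (e\<^sup>2 * real (length M) / 32))"
proof -
  define n where "n = real (length M)"
  define cnt where "cnt = color_count col (col v) M"
  define q where "q = color_freq col (col v) M"
  have n: "n \<ge> 600" using m by (simp add: n_def)
  have cnt: "real cnt = q * n" using n by (simp add: cnt_def q_def color_freq_def n_def)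
  define X where "X = filter (\<lambda>x. col x \<noteq> col v) M"
  show ?thesis unfolding heavy_def
  proof (rule fails_bind_holds[OF holds_count_color], simp, clarify)
    fix cnt' :: nat and X' c'
    show "fails col (if length M < 2 * color_count col (col v) M then Return (Some (v, color_count col (col v) M))
           else shuffle (filter (\<lambda>x. col x \<noteq> col v) M) \<bind> (\<lambda>X'. heavy_loop X' (real (length M) / 2 - real (color_count col (col v) M)) \<bind>
              (\<lambda>stop. if stop then Return None else boyer_moore M)))
        (\<lambda>r' d. real (length M + d) \<le> 7 / 6 * real (length M)) \<le> exp (- (e\<^sup>2 * real (length M) / 32))"
      unfolding cnt_def[symmetric] X_def[symmetric]
    proof (cases "length M < 2 * cnt")
      case True
      thus "fails col (if length M < 2 * cnt then Return (Some (v, cnt))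
           else shuffle X \<bind> (\<lambda>X'. heavy_loop X' (real (length M) / 2 - real cnt) \<bind>
              (\<lambda>stop. if stop then Return None else boyer_moore M)))
        (\<lambda>r' d. real (length M + d) \<le> 7 / 6 * real (length M)) \<le> exp (- (e\<^sup>2 * real (length M) / 32))"
        by (simp add: fails_holds)
    next
      case False
      define t where "t = length M div 6"
      have t: "real t \<le> n / 6" "n / 6 - 1 \<le> real t" unfolding t_def n_def by linarith+
      have "length X + cnt = length M"
        unfolding X_def cnt_def color_count_def using sum_length_filter_compl[of "\<lambda>x. col x = col v" M] by simp
      hence "real (length X) + real cnt = n" unfolding n_def by linarith
      hence lX: "real (length X) = (1 - q) * n" unfolding cnt by (simp add: algebra_simps)
      have q: "q \<le> 1 / 2"
      proof -
        have "2 * real cnt \<le> n" using False unfolding n_def by linarith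
        thus ?thesis using n by (simp add: cnt)
      qed
      have q': "44 / 100 \<le> q" using p by (simp add: q_def)
      have lX2: "2 * t \<le> length X"
      proof -
        have "n / 2 \<le> (1 - q) * n" using q n mult_right_mono[of "1/2" "1 - q" n] by simp
        thus ?thesis using t lX by linarith
      qed
      have dX: "distinct X" using M by (simp add: X_def)
      have neX: "X \<noteq> []" using lX2 t n by auto
      have cX: "card (set X) = length X" using dX by (rule distinct_card)
      \<comment> \<open>Removing the color of \<open>v\<close> divides the remaining frequencies by
        1 - q.\<close>
      have SX: "square_sum col X * (1 - q)\<^sup>2 = square_sum col M - q\<^sup>2"
      proof -
        have fX: "color_freq col c X * (1 - q) = (if c = col v then 0 else color_freq col c M)" for c
          using n q by (simp add: color_freq_def X_def[symmetric] lX) (simp add: X_def color_count_filter n_def)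
        have "square_sum col X = (\<Sum>c\<in>insert (col v) (col ` set M). (color_freq col c X)\<^sup>2)"
          by (intro square_sum_superset) (auto simp: X_def)
        hence "square_sum col X * (1 - q)\<^sup>2 = (\<Sum>c\<in>insert (col v) (col ` set M). (if c = col v then 0 else color_freq col c M)\<^sup>2)"
          unfolding fX[symmetric] by (simp add: sum_distrib_right power_mult_distrib)
        also have "\<dots> = (\<Sum>c\<in>insert (col v) (col ` set M) - {col v}. (color_freq col c M)\<^sup>2)"
          by (subst sum.remove[of _ "col v"]) (auto intro!: sum.cong)
        also have "\<dots> = square_sum col M - q\<^sup>2"
        proof -
          have "square_sum col M = (\<Sum>c\<in>insert (col v) (col ` set M). (color_freq col c M)\<^sup>2)"
            by (rule square_sum_superset) auto
          also have "\<dots> = q\<^sup>2 + (\<Sum>c\<in>insert (col v) (col ` set M) - {col v}. (color_freq col c M)\<^sup>2)"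
            unfolding q_def by (rule sum.remove) auto
          finally show ?thesis by simp
        qed
        finally show ?thesis .
      qed
      define r where "r = e * n / 4"
      have r: "1 \<le> r" "0 < r" using e by (auto simp: r_def n_def)
      define k where "k = n / 2 - real cnt"
      \<comment> \<open>In \<open>X\<close> two balls differ with weight at least (1 - 2 * q + e) /
        (1 - q)^2. Since (1 - q)^2 \<le> 0.314 and t \<ge> 0.164 * n, the first t pairs contain on
        average at least (1 - 2 * q + e) * n / 2 differing ones, which is k + e * n / 2; the surplus
        covers 1 + r.\<close>
      have k_le: "k \<le> real t * pair_avg (set X) (differ col) - 1 - r"
      proof -
        have "(1 - q)\<^sup>2 \<le> (56 / 100)\<^sup>2" using q q' by (intro power_mono) auto
        hence q2: "(1 - q)\<^sup>2 \<le> 314 / 1000" by (simp add: power2_eq_square)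
        have pos: "0 < (1 - q)\<^sup>2" using q by simp
        have D: "pair_avg (set X) (differ col) * (1 - q)\<^sup>2 = (1 - q)\<^sup>2 - (square_sum col M - q\<^sup>2)"
          unfolding pair_avg_differ[OF dX neX] SX[symmetric] by (simp add: algebra_simps)
        also have "\<dots> \<ge> 1 - 2 * q + e" using p(2) by (simp add: q_def power2_eq_square algebra_simps)
        finally have D': "1 - 2 * q + e \<le> pair_avg (set X) (differ col) * (1 - q)\<^sup>2" .
        have avg: "1 - 2 * q + e \<le> pair_avg (set X) (differ col) * (314 / 1000)"
        proof -
          have "0 \<le> pair_avg (set X) (differ col)" by (intro pair_avg_nonneg) (auto simp: differ_def)
          hence "pair_avg (set X) (differ col) * (1 - q)\<^sup>2 \<le> pair_avg (set X) (differ col) * (314 / 1000)"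
            using q2 by (intro mult_left_mono)
          with D' show ?thesis by linarith
        qed
        have "real t \<ge> 164 / 1000 * n" using t n by linarith
        hence "164 / 1000 * n * ((1 - 2 * q + e) / (314 / 1000)) \<le> real t * pair_avg (set X) (differ col)"
          using avg q e n by (intro mult_mono) auto
        moreover have "n * (1 - 2 * q) / 2 + n * e / 2 \<le> 164 / 1000 * n * ((1 - 2 * q + e) / (314 / 1000))"
        proof -
          define w where "w = n * (1 - 2 * q + e)"
          have "0 \<le> w" unfolding w_def using q e n by (intro mult_nonneg_nonneg) auto
          moreover have "n * (1 - 2 * q) / 2 + n * e / 2 = w / 2" by (simp add: w_def field_simps)
          moreover have "164 / 1000 * n * ((1 - 2 * q + e) / (314 / 1000)) = 164 / 314 * w" by (simp add: w_def)
          ultimately show ?thesis by linarith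
        qed
        moreover have "k = n * (1 - 2 * q) / 2" by (simp add: k_def cnt algebra_simps)
        moreover have "1 + r \<le> n * e / 2" using r(1) by (simp add: r_def mult.commute[of n e])
        ultimately show ?thesis by linarith
      qed
      let ?Q1 = "\<lambda>X' c. mset X' = mset X \<and> c = 0 \<and> k \<le> psum (differ col) t X'"
      have "fails col (shuffle X) ?Q1 \<le> measure_pmf.prob (uperm (set X)) {X'. \<not> k \<le> psum (differ col) t X'}"
        by (rule fails_shuffle[OF dX])
      also have "\<dots> \<le> measure_pmf.prob (uperm (set X)) {X'. psum (differ col) t X' \<le> real t * pair_avg (set X) (differ col) - 1 - r}"
        using k_le by (intro measure_pmf.finite_measure_mono) auto
      also have "\<dots> \<le> exp (- (r\<^sup>2 / (2 * real (card (set X)))))"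
        using r lX2 by (intro psum_lower_tail) (auto simp: cX differ_def)
      also have "\<dots> \<le> exp (- (e\<^sup>2 * real (length M) / 32))"
      proof -
        have lpos: "0 < real (length X)" using neX by simp
        have "e\<^sup>2 * n / 32 = r\<^sup>2 / (2 * n)" using n by (simp add: r_def power2_eq_square)
        also have "\<dots> \<le> r\<^sup>2 / (2 * real (length X))"
        proof (intro divide_left_mono mult_pos_pos)
          show "2 * real (length X) \<le> 2 * n" using \<open>length X + cnt = length M\<close> by (simp add: n_def)
        qed (use lpos n in auto)
        finally show ?thesis by (simp add: cX n_def)
      qed
      finally have sh: "fails col (shuffle X) ?Q1 \<le> exp (- (e\<^sup>2 * real (length M) / 32))" .
      have "fails col (shuffle X \<bind> (\<lambda>X'. heavy_loop X' k \<bind> (\<lambda>stop. if stop then Return None else boyer_moore M)))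
        (\<lambda>r' d. real (length M + d) \<le> 7 / 6 * real (length M)) \<le> exp (- (e\<^sup>2 * real (length M) / 32)) + 0"
      proof (rule fails_bind[OF sh])
        fix X' and c :: nat assume X': "?Q1 X' c"
        hence "length X' = length X" by (auto dest: mset_eq_length)
        hence "holds col (heavy_loop X' k) (\<lambda>r c. r \<and> c \<le> t)"
          using X' lX2 t n by (intro holds_heavy_loop_stop) auto
        hence "holds col (heavy_loop X' k \<bind> (\<lambda>stop. if stop then Return None else boyer_moore M))
          (\<lambda>r' d. real (length M + (c + d)) \<le> 7 / 6 * real (length M))"
          by (rule holds_bindI) (use X' t in \<open>auto simp: n_def\<close>)
        thus "fails col (heavy_loop X' k \<bind> (\<lambda>stop. if stop then Return None else boyer_moore M))
          (\<lambda>r' d. real (length M + (c + d)) \<le> 7 / 6 * real (length M)) \<le> 0" by (simp add: fails_holds)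
      qed simp
      with False show "fails col (if length M < 2 * cnt then Return (Some (v, cnt))
           else shuffle X \<bind> (\<lambda>X'. heavy_loop X' (real (length M) / 2 - real cnt) \<bind>
              (\<lambda>stop. if stop then Return None else boyer_moore M)))
        (\<lambda>r' d. real (length M + d) \<le> 7 / 6 * real (length M)) \<le> exp (- (e\<^sup>2 * real (length M) / 32))"
        by (simp add: k_def n_def)
    qed
  qed
qed

section \<open>One level of the recursion\<close>

text \<open>Both tails for each color, obtained from the indicator shifted by 1/2 and from its
  negative, and a union bound over at most n colors.\<close>

lemma prob_good_sample:
  assumes M: "distinct M" "M \<noteq> []" and s: "0 < s" "s \<le> length M" and d: "0 < d"
  shows "measure_pmf.prob (uperm (set M))
      {M'. \<not> (\<forall>c\<in>col ` set M. color_freq col c (take s M') \<le> color_freq col c M + d \<and>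
                 color_freq col c M - d \<le> color_freq col c (take s M'))}
    \<le> 2 * real (length M) * exp (- (real s * d\<^sup>2 / 2))"
proof -
  let ?P = "measure_pmf.prob (uperm (set M))"
  have cardM: "card (set M) = length M" using M by (simp add: distinct_card)
  have pos: "0 < real (length M)" using M by simp
  define e where "e = exp (- (real s * d\<^sup>2 / 2))"
  have ee: "exp (- ((real s * d)\<^sup>2 / (2 * real s))) = e"
    using s by (simp add: e_def power2_eq_square)
  let ?f = "\<lambda>c x. of_bool (col x = c) - 1 / 2 :: real"
  let ?g = "\<lambda>c x. 1 / 2 - of_bool (col x = c) :: real"
  have len: "length us = length M" if "us \<in> set_pmf (uperm (set M))" for us
    using that by (auto simp: set_uperm cardM dest: length_finite_permutations_of_set)
  have f: "ssum (?f c) s us = real s * (color_freq col c (take s us) - 1 / 2)"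
    and g: "ssum (?g c) s us = real s * (1 / 2 - color_freq col c (take s us))"
    if "us \<in> set_pmf (uperm (set M))" for us c
  proof -
    have l: "length (take s us) = s" using len[OF that] s by simp
    have "(\<Sum>x\<leftarrow>zs. ?f c x) = real (color_count col c zs) - real (length zs) / 2"
      "(\<Sum>x\<leftarrow>zs. ?g c x) = real (length zs) / 2 - real (color_count col c zs)" for zs
      by (induction zs) (auto simp: field_simps)
    thus "ssum (?f c) s us = real s * (color_freq col c (take s us) - 1 / 2)"
      "ssum (?g c) s us = real s * (1 / 2 - color_freq col c (take s us))"
      unfolding ssum_def using s l by (simp_all add: color_freq_def right_diff_distrib)
  qed
  have fa: "(\<Sum>x\<in>set M. ?f c x) / real (card (set M)) = color_freq col c M - 1 / 2" for c
    using pos unfolding sum_subtractf color_count_sum[OF M(1), symmetric] by (simp add: cardM color_freq_def field_simps)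
  have ga: "(\<Sum>x\<in>set M. ?g c x) / real (card (set M)) = 1 / 2 - color_freq col c M" for c
    using pos unfolding sum_subtractf color_count_sum[OF M(1), symmetric] by (simp add: cardM color_freq_def field_simps)
  have sd: "0 < real s * d" using s d by simp
  have up: "?P {M'. \<not> color_freq col c (take s M') \<le> color_freq col c M + d} \<le> e" for c
  proof -
    have "?P {M'. \<not> color_freq col c (take s M') \<le> color_freq col c M + d} \<le>
      ?P {us. ssum (?f c) s us \<ge> real s * ((\<Sum>x\<in>set M. ?f c x) / real (card (set M))) + real s * d}"
    proof (intro measure_pmf.finite_measure_mono_AE AE_pmfI impI)
      fix us assume us: "us \<in> set_pmf (uperm (set M))" and "us \<in> {M'. \<not> color_freq col c (take s M') \<le> color_freq col c M + d}"
      hence "real s * (color_freq col c M - 1 / 2 + d) \<le> real s * (color_freq col c (take s us) - 1 / 2)"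
        by (intro mult_left_mono) auto
      thus "us \<in> {us. ssum (?f c) s us \<ge> real s * ((\<Sum>x\<in>set M. ?f c x) / real (card (set M))) + real s * d}"
        unfolding mem_Collect_eq f[OF us] fa by (simp add: algebra_simps)
    qed auto
    also have "\<dots> \<le> e" unfolding ee[symmetric] using s sd by (intro ssum_tail) (auto simp: cardM)
    finally show ?thesis .
  qed
  have lo: "?P {M'. \<not> color_freq col c M - d \<le> color_freq col c (take s M')} \<le> e" for c
  proof -
    have "?P {M'. \<not> color_freq col c M - d \<le> color_freq col c (take s M')} \<le>
      ?P {us. ssum (?g c) s us \<ge> real s * ((\<Sum>x\<in>set M. ?g c x) / real (card (set M))) + real s * d}"
    proof (intro measure_pmf.finite_measure_mono_AE AE_pmfI impI)
      fix us assume us: "us \<in> set_pmf (uperm (set M))" and "us \<in> {M'. \<not> color_freq col c M - d \<le> color_freq col c (take s M')}"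
      hence "real s * (1 / 2 - color_freq col c M + d) \<le> real s * (1 / 2 - color_freq col c (take s us))"
        by (intro mult_left_mono) auto
      thus "us \<in> {us. ssum (?g c) s us \<ge> real s * ((\<Sum>x\<in>set M. ?g c x) / real (card (set M))) + real s * d}"
        unfolding mem_Collect_eq g[OF us] ga by (simp add: algebra_simps)
    qed auto
    also have "\<dots> \<le> e" unfolding ee[symmetric] using s sd by (intro ssum_tail) (auto simp: cardM)
    finally show ?thesis .
  qed
  have "?P {M'. \<not> (\<forall>c\<in>col ` set M. color_freq col c (take s M') \<le> color_freq col c M + d \<and>
                 color_freq col c M - d \<le> color_freq col c (take s M'))} \<le> real (card (col ` set M)) * (e + e)"
    by (intro prob_ball_le prob_conj_le up lo) auto
  also have "\<dots> \<le> real (length M) * (e + e)"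
    using card_image_le[of "set M" col] by (intro mult_right_mono) (auto simp: cardM e_def)
  finally show ?thesis by (simp add: e_def algebra_simps)
qed

lemma sorted_classes_freqs:
  assumes inv: "class_inv col cs xs" "sorted (rev (map snd cs))" "xs \<noteq> []"
  defines "qs \<equiv> map (\<lambda>(v, c). real c / real (length xs)) cs"
  shows "cs \<noteq> []" "hd qs = color_freq col (col (fst (hd cs))) xs" "color_freq col c xs \<le> hd qs"
    "(\<Sum>q\<leftarrow>tl qs. q\<^sup>2) = square_sum col xs - (hd qs)\<^sup>2"
    "length qs \<ge> 2 \<Longrightarrow> \<exists>c'. c' \<noteq> col (fst (hd cs)) \<and> qs ! 1 = color_freq col c' xs"
proof -
  have qs: "qs = map (\<lambda>p. color_freq col (col (fst p)) xs) cs"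
    unfolding qs_def using inv(1) by (intro map_cong refl) (auto simp: class_inv_def color_freq_def)
  have C: "(col \<circ> fst) ` set cs = col ` set xs" and dist: "distinct (map (col \<circ> fst) cs)"
    using inv(1) by (auto simp: class_inv_def)
  show ne: "cs \<noteq> []" using C inv(3) by auto
  then obtain p cs' where cs: "cs = p # cs'" by (cases cs) auto
  show hd: "hd qs = color_freq col (col (fst (hd cs))) xs" by (simp add: qs cs)
  show "color_freq col c xs \<le> hd qs"
  proof (cases "c \<in> col ` set xs")
    case True
    then obtain p' where p': "p' \<in> set cs" "c = col (fst p')" using C by force
    have "snd p' \<le> snd p" using inv(2) p'(1) by (auto simp: cs sorted_append)
    moreover have "snd p' = color_count col c xs" "snd p = color_count col (col (fst p)) xs"
      using inv(1) p' by (auto simp: class_inv_def cs)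
    ultimately have "real (color_count col c xs) \<le> real (color_count col (col (fst p)) xs)" by simp
    thus ?thesis unfolding hd cs by (simp add: color_freq_def divide_right_mono)
  next
    case False
    hence "color_freq col c xs = 0" by (simp add: color_freq_def color_count_0_iff)
    thus ?thesis unfolding hd by simp
  qed
  have "(\<Sum>q\<leftarrow>qs. q\<^sup>2) = (\<Sum>c\<leftarrow>map (col \<circ> fst) cs. (color_freq col c xs)\<^sup>2)"
    by (simp add: qs comp_def)
  also have "\<dots> = (\<Sum>c\<in>set (map (col \<circ> fst) cs). (color_freq col c xs)\<^sup>2)"
    using dist by (rule sum_list_distinct_conv_sum_set)
  also have "\<dots> = square_sum col xs"
    by (simp only: list.set_map C square_sum_def)
  finally show "(\<Sum>q\<leftarrow>tl qs. q\<^sup>2) = square_sum col xs - (hd qs)\<^sup>2"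
    by (simp add: qs cs)
  show "\<exists>c'. c' \<noteq> col (fst (hd cs)) \<and> qs ! 1 = color_freq col c' xs" if "length qs \<ge> 2"
  proof -
    from that obtain p' cs'' where cs': "cs' = p' # cs''" by (cases cs') (auto simp: qs cs)
    show ?thesis using dist by (intro exI[of _ "col (fst p')"]) (auto simp: qs cs cs')
  qed
qed

text \<open>Each difference of squares factors into the difference times the sum of two frequencies.
  As frequencies sum to 1, the bound does not depend on the number of colors.\<close>

lemma square_sum_diff_le:
  assumes sub: "set N \<subseteq> set M" "N \<noteq> []"
    and d: "\<And>c. \<bar>color_freq col c N - color_freq col c M\<bar> \<le> d"
  shows "\<bar>square_sum col N - square_sum col M\<bar> \<le> 2 * d"
proof -
  have ne: "M \<noteq> []" using sub by auto
  let ?C = "col ` set M"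
  have "square_sum col N = (\<Sum>c\<in>?C. (color_freq col c N)\<^sup>2)"
    using sub by (intro square_sum_superset) auto
  hence "\<bar>square_sum col N - square_sum col M\<bar> = \<bar>\<Sum>c\<in>?C. (color_freq col c N)\<^sup>2 - (color_freq col c M)\<^sup>2\<bar>"
    by (simp add: sum_subtractf square_sum_def)
  also have "\<dots> \<le> (\<Sum>c\<in>?C. d * (color_freq col c N + color_freq col c M))"
  proof (intro order.trans[OF sum_abs] sum_mono)
    fix c
    have "\<bar>(color_freq col c N)\<^sup>2 - (color_freq col c M)\<^sup>2\<bar> =
      \<bar>color_freq col c N - color_freq col c M\<bar> * (color_freq col c N + color_freq col c M)"
      by (simp add: power2_eq_square square_diff_square_factored abs_mult)
    also have "\<dots> \<le> d * (color_freq col c N + color_freq col c M)"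
      using d by (intro mult_right_mono) auto
    finally show "\<bar>(color_freq col c N)\<^sup>2 - (color_freq col c M)\<^sup>2\<bar> \<le> d * (color_freq col c N + color_freq col c M)" .
  qed
  also have "\<dots> = d * ((\<Sum>c\<in>?C. color_freq col c N) + (\<Sum>c\<in>?C. color_freq col c M))"
    by (simp add: sum_distrib_left sum.distrib distrib_left)
  also have "\<dots> = 2 * d" using sub ne by (simp add: sum_color_freq image_mono)
  finally show ?thesis .
qed

lemma square_diff_le:
  fixes p q :: real
  assumes "\<bar>q - p\<bar> \<le> d" "0 \<le> p" "p \<le> 1" "0 \<le> q" "q \<le> 1"
  shows "\<bar>q\<^sup>2 - p\<^sup>2\<bar> \<le> 2 * d"
proof -
  have "\<bar>q\<^sup>2 - p\<^sup>2\<bar> = \<bar>q - p\<bar> * (q + p)"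
    using assms by (simp add: power2_eq_square square_diff_square_factored abs_mult)
  also have "\<dots> \<le> d * 2" using assms by (intro mult_mono) auto
  finally show ?thesis by simp
qed

text \<open>Sample frequencies are within e/10, so squares and sums of squares are within e/5. The
  heavy test with margin 2e thus certifies a true margin of at least 1.4e, its failure a margin of
  at most 2.6e, and the balanced interval widens from 4e to 4.1e;
  \<open>e \<le> \<delta> / 5\<close> turns the last two into \<delta>.\<close>

lemma fails_majority_step:
  fixes \<delta> D \<beta> :: real and M :: "ball list"
  defines "m \<equiv> real (length M)" and "e \<equiv> eps (length M)" and "s \<equiv> nat \<lfloor>real (length M) powr (1 / 3)\<rfloor>"
  assumes M: "distinct M" "600 \<le> length M" and \<delta>: "0 < \<delta>" "\<delta> \<le> 1 / 10000" "10 \<le> \<delta> * m"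
    and e: "e \<le> \<delta> / 5" "4 \<le> e * m" and s: "1 \<le> s" "s \<le> length M" "real s * real s \<le> \<delta> * m"
    and rec: "\<And>N. distinct N \<Longrightarrow> length N \<le> (length M + 1) div 2 \<Longrightarrow>
      fails col (majority N) (\<lambda>r c. real c \<le> (7 / 6 + 4000 * \<delta>) * real (length N) + D) \<le> \<beta>"
    and nn: "0 \<le> \<beta>" "0 \<le> D"
  shows "fails col (majority M) (\<lambda>r c. real c \<le> (7 / 6 + 4000 * \<delta>) * m + D) \<le>
    2 * m * exp (- (real s * (e / 10)\<^sup>2 / 2)) + (5 * m * exp (- (\<delta>\<^sup>2 * m / 2)) + exp (- (e\<^sup>2 * m / 32)) + \<beta>)"
proof -
  have "0 < length M" "length M \<noteq> 1" using M(2) by linarith+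
  hence M0: "M \<noteq> []" "length M \<noteq> 1" by simp_all
  have e0: "0 < e" using M0 by (simp add: e_def eps_def)
  define b where "b = 5 * m * exp (- (\<delta>\<^sup>2 * m / 2)) + exp (- (e\<^sup>2 * m / 32)) + \<beta>"
  have b0: "0 \<le> b" using nn by (simp add: b_def m_def)
  let ?G = "\<lambda>N. \<forall>c\<in>col ` set M. color_freq col c N \<le> color_freq col c M + e / 10 \<and> color_freq col c M - e / 10 \<le> color_freq col c N"
  let ?Q1 = "\<lambda>N c. length N = s \<and> set N \<subseteq> set M \<and> c = 0 \<and> ?G N"
  have "fails col (shuffle M) (\<lambda>M' c. mset M' = mset M \<and> c = 0 \<and> ?G (take s M')) \<le> 2 * m * exp (- (real s * (e / 10)\<^sup>2 / 2))"
    unfolding m_def using s M0 e0 by (intro order.trans[OF fails_shuffle[OF M(1)] prob_good_sample[OF M(1)]]) auto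
  hence "fails col (sample s M) ?Q1 \<le> 2 * m * exp (- (real s * (e / 10)\<^sup>2 / 2)) + 0"
    unfolding sample_def
  proof (rule fails_bind)
    fix M' and c :: nat assume *: "mset M' = mset M \<and> c = 0 \<and> ?G (take s M')"
    have "length M' = length M" "set M' = set M" using * by (auto dest: mset_eq_length mset_eq_setD)
    hence "?Q1 (take s M') c" using * s set_take_subset[of s M'] by auto
    thus "fails col (Return (take s M')) (\<lambda>N d. ?Q1 N (c + d)) \<le> 0"
      by (subst fails_holds) auto
  qed simp
  hence sample: "fails col (sample s M) ?Q1 \<le> 2 * m * exp (- (real s * (e / 10)\<^sup>2 / 2))" by simp
  show ?thesis unfolding majority.simps[of M] Let_def s_def[symmetric] b_def[symmetric]
  proof (simp only: if_False M0, rule fails_bind[OF sample b0])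
    fix N and c0 :: nat assume N: "?Q1 N c0"
    have neN: "N \<noteq> []" using N s by auto
    have d: "\<bar>color_freq col c N - color_freq col c M\<bar> \<le> e / 10" for c
    proof (cases "c \<in> col ` set M")
      case True
      hence "color_freq col c N \<le> color_freq col c M + e / 10" "color_freq col c M - e / 10 \<le> color_freq col c N"
        using N by blast+
      thus ?thesis by linarith
    next
      case False
      moreover from this have "c \<notin> col ` set N" using N by auto
      ultimately show ?thesis using e0 by (simp add: color_freq_def flip: color_count_0_iff)
    qed
    have Sd: "\<bar>square_sum col N - square_sum col M\<bar> \<le> 2 * (e / 10)"
      using N by (intro square_sum_diff_le neN d) auto
    have sqd: "\<bar>(color_freq col c N)\<^sup>2 - (color_freq col c M)\<^sup>2\<bar> \<le> 2 * (e / 10)" for c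
      by (intro square_diff_le d color_freq_nonneg color_freq_le_1)
    show "fails col (sorted_classes N \<bind> (\<lambda>cs. if balanced_case (length M) (map (\<lambda>(v, c). real c / real s) cs) then balanced M
            else if heavy_case (length M) (map (\<lambda>(v, c). real c / real s) cs) then heavy M (fst (hd cs)) else light M))
        (\<lambda>r' d. real (c0 + d) \<le> (7 / 6 + 4000 * \<delta>) * m + D) \<le> b"
    proof (rule fails_bind_holds[OF holds_sorted_classes b0])
      fix cs c1
      assume cs: "class_inv col cs N \<and> sorted (rev (map snd cs)) \<and> c1 \<le> length N * length N"
      define qs where "qs = map (\<lambda>(v, c). real c / real s) cs"
      define v where "v = fst (hd cs)"
      have c1: "real c1 \<le> \<delta> * m"
      proof -
        have "c1 \<le> s * s" using cs N by simp
        hence "real c1 \<le> real (s * s)" by linarith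
        with s show ?thesis by simp
      qed
      have "qs = map (\<lambda>(v, c). real c / real (length N)) cs" using N by (simp add: qs_def)
      note qs_facts = sorted_classes_freqs[OF conjunct1[OF cs] conjunct1[OF conjunct2[OF cs]] neN, folded this v_def]
      have c0: "c0 = 0" using N by simp
      have bal: "fails col (balanced M) (\<lambda>r' d. real (c0 + (c1 + d)) \<le> (7 / 6 + 4000 * \<delta>) * m + D) \<le> b"
        if "balanced_case (length M) qs"
      proof -
        have q: "1 / 2 - 4 * e \<le> hd qs" "1 / 2 - 4 * e \<le> (if length qs \<ge> 2 then qs ! 1 else 0)"
          using that by (auto simp: balanced_case_def Let_def e_def)
        \<comment> \<open>For a single color the second frequency is read as 0, which lies outside
          the interval around 1/2.\<close>
        have "length qs \<ge> 2"
        proof (rule ccontr)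
          assume "\<not> ?thesis"
          hence "1 / 2 - 4 * e \<le> 0" using q(2) by simp
          thus False using e \<delta> by linarith
        qed
        with qs_facts(5) q(2) obtain c where c: "c \<noteq> col v" "1 / 2 - 4 * e \<le> color_freq col c N" by auto
        have "1 / 2 - \<delta> \<le> color_freq col c M" using c(2) d[of c] e by linarith
        moreover have "1 / 2 - \<delta> \<le> color_freq col (col v) M" using q(1) d[of "col v"] e unfolding qs_facts(2) by linarith
        ultimately have "fails col (balanced M) (\<lambda>r c. real c \<le> (7 / 6 + 4000 * \<delta>) * real (length M) - \<delta> * real (length M) + D)
          \<le> 5 * real (length M) * exp (- (\<delta>\<^sup>2 * real (length M) / 2)) + \<beta>"
          using \<delta> by (intro fails_balanced[OF M(1) _ _ _ c(1) _ _ rec nn]) (auto simp: m_def)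
        also have "\<dots> \<le> b" by (simp add: b_def m_def)
        finally show ?thesis
          by (rule order.trans[rotated]) (rule fails_mono, use c1 c0 in \<open>simp add: m_def\<close>)
      qed
      have heavy: "fails col (heavy M v) (\<lambda>r' d. real (c0 + (c1 + d)) \<le> (7 / 6 + 4000 * \<delta>) * m + D) \<le> b"
        if "heavy_case (length M) qs"
      proof -
        have q: "45 / 100 \<le> hd qs" "square_sum col N - (hd qs)\<^sup>2 + 2 * e \<le> (hd qs)\<^sup>2"
          using that qs_facts(4) by (auto simp: heavy_case_def e_def)
        have "44 / 100 \<le> color_freq col (col v) M"
          using q(1) d[of "col v"] e \<delta> unfolding qs_facts(2) by linarith
        moreover have "square_sum col M + e \<le> 2 * (color_freq col (col v) M)\<^sup>2"
          using q(2) Sd sqd[of "col v"] e0 unfolding qs_facts(2) by linarith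
        ultimately have "fails col (heavy M v) (\<lambda>r c. real c \<le> 7 / 6 * real (length M)) \<le> exp (- (e\<^sup>2 * real (length M) / 32))"
          using e0 e M by (intro fails_heavy) (auto simp: m_def)
        also have "\<dots> \<le> b" using nn by (simp add: b_def m_def)
        finally show ?thesis
        proof (rule order.trans[rotated], intro fails_mono)
          fix r c assume "real c \<le> 7 / 6 * real (length M)"
          moreover have "0 \<le> \<delta> * m" using \<delta> by simp
          ultimately show "real (c0 + (c1 + c)) \<le> (7 / 6 + 4000 * \<delta>) * m + D"
            using c1 c0 nn by (simp add: m_def algebra_simps)
        qed
      qed
      have light: "fails col (light M) (\<lambda>r' d. real (c0 + (c1 + d)) \<le> (7 / 6 + 4000 * \<delta>) * m + D) \<le> b"
        if "\<not> heavy_case (length M) qs"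
      proof -
        \<comment> \<open>Required for every color, since any could become the candidate; the
          largest sample frequency dominates all others, so the test on it speaks for all of
          them.\<close>
        have "color_freq col c M \<le> 451 / 1000 \<or> 2 * (color_freq col c M)\<^sup>2 \<le> square_sum col M + \<delta>" for c
        proof (cases "45 / 100 \<le> hd qs")
          case True
          hence q: "(hd qs)\<^sup>2 < square_sum col N - (hd qs)\<^sup>2 + 2 * e"
            using that qs_facts(4) by (auto simp: heavy_case_def e_def)
          have "(color_freq col c N)\<^sup>2 \<le> (hd qs)\<^sup>2" using qs_facts(3) by (intro power_mono) auto
          thus ?thesis using q Sd sqd[of c] e e0 by linarith
        next
          case False
          thus ?thesis using qs_facts(3)[of c] d[of c] e \<delta> by linarith
        qed
        hence "fails col (light M) (\<lambda>r c. real c \<le> (7 / 6 + 4000 * \<delta>) * real (length M) - \<delta> * real (length M) + D)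
          \<le> 5 * real (length M) * exp (- (\<delta>\<^sup>2 * real (length M) / 2)) + \<beta>"
          using \<delta> by (intro fails_light[OF M(1) _ _ _ _ rec nn]) (auto simp: m_def)
        also have "\<dots> \<le> b" by (simp add: b_def m_def)
        finally show ?thesis
          by (rule order.trans[rotated]) (rule fails_mono, use c1 c0 in \<open>simp add: m_def\<close>)
      qed
      show "fails col (if balanced_case (length M) (map (\<lambda>(v, c). real c / real s) cs) then balanced M
            else if heavy_case (length M) (map (\<lambda>(v, c). real c / real s) cs) then heavy M (fst (hd cs)) else light M)
        (\<lambda>r' d. real (c0 + (c1 + d)) \<le> (7 / 6 + 4000 * \<delta>) * m + D) \<le> b"
        unfolding qs_def[symmetric] v_def[symmetric] using bal heavy light by simp
    qed
  qed
qed

section \<open>The whole recursion\<close>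

text \<open>The sampling error dominates the failure probability: its exponent has order m^(1/3) *
  m^(-1/5) = m^(2/15), which still beats m^(1/10) together with the factor m in front. The other two
  exponents have order m and m^(4/5).\<close>

lemma eventually_step_conditions:
  fixes \<delta> :: real
  assumes "0 < \<delta>"
  shows "\<forall>\<^sub>F m :: nat in sequentially. 600 \<le> m \<and> 10 \<le> \<delta> * real m \<and> eps m \<le> \<delta> / 5 \<and> 4 \<le> eps m * real m \<and>
    1 \<le> nat \<lfloor>real m powr (1 / 3)\<rfloor> \<and> nat \<lfloor>real m powr (1 / 3)\<rfloor> \<le> m \<and>
    real (nat \<lfloor>real m powr (1 / 3)\<rfloor>) * real (nat \<lfloor>real m powr (1 / 3)\<rfloor>) \<le> \<delta> * real m \<and>
    2 * real m * exp (- (real (nat \<lfloor>real m powr (1 / 3)\<rfloor>) * (eps m / 10)\<^sup>2 / 2)) +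
      (5 * real m * exp (- (\<delta>\<^sup>2 * real m / 2)) + exp (- ((eps m)\<^sup>2 * real m / 32))) \<le> exp (- (real m powr (1 / 10)))"
proof -
  have 1: "\<forall>\<^sub>F m :: nat in sequentially. 10 \<le> \<delta> * real m" using assms by real_asymp
  have 2: "\<forall>\<^sub>F m :: nat in sequentially. real m powr (- 1 / 10) \<le> \<delta> / 5" using assms by real_asymp
  have 3: "\<forall>\<^sub>F m :: nat in sequentially. 4 \<le> real m powr (- 1 / 10) * real m" by real_asymp
  have 4: "\<forall>\<^sub>F m :: nat in sequentially. 1 \<le> real m powr (1 / 3)" by real_asymp
  have 5: "\<forall>\<^sub>F m :: nat in sequentially. real m powr (1 / 3) \<le> real m" by real_asymp
  have 6: "\<forall>\<^sub>F m :: nat in sequentially. real m powr (1 / 3) * real m powr (1 / 3) \<le> \<delta> * real m" using assms by real_asymp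
  have 7: "\<forall>\<^sub>F m :: nat in sequentially. 2 * real m * exp (- ((real m powr (1 / 3) - 1) * (real m powr (- 1 / 10) / 10)\<^sup>2 / 2)) +
      (5 * real m * exp (- (\<delta>\<^sup>2 * real m / 2)) + exp (- ((real m powr (- 1 / 10))\<^sup>2 * real m / 32))) \<le> exp (- (real m powr (1 / 10)))"
    using assms by real_asymp
  show ?thesis
    using 1 2 3 4 5 6 7 eventually_ge_at_top[of 600]
  proof eventually_elim
    case (elim m)
    define s where "s = nat \<lfloor>real m powr (1 / 3)\<rfloor>"
    have s: "real s \<le> real m powr (1 / 3)" "real m powr (1 / 3) - 1 \<le> real s"
      unfolding s_def by (simp, linarith)
    have "1 \<le> s" using elim(4) by (simp add: s_def le_nat_iff)
    moreover have "s \<le> m" using s elim(5) by linarith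
    moreover have "real s * real s \<le> \<delta> * real m"
      using elim(6) mult_mono[OF s(1) s(1)] by simp
    moreover have "2 * real m * exp (- (real s * (eps m / 10)\<^sup>2 / 2)) \<le>
        2 * real m * exp (- ((real m powr (1 / 3) - 1) * (eps m / 10)\<^sup>2 / 2))"
      using s by (auto intro!: mult_left_mono mult_right_mono divide_right_mono)
    ultimately show ?case using elim unfolding s_def[symmetric] eps_def by linarith
  qed
qed

text \<open>The cutoff \<open>L\<close> separates two regimes: calls on at most \<open>L\<close>
  balls are charged their worst case, and every larger call fails with probability at most
  exp(-L^(1/10)). Leaving \<open>L\<close> free lets it grow with the original input. The factor
  \<open>length M\<close> bounds the number of levels, since the next size k satisfies k + 1 \<le>
  length M.\<close>

lemma fails_majority:
  fixes \<delta> :: real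
  assumes \<delta>: "0 < \<delta>" "\<delta> \<le> 1 / 10000"
  shows "\<exists>m0. \<forall>(col :: ball \<Rightarrow> 'c) L M. m0 \<le> L \<longrightarrow> distinct M \<longrightarrow>
    fails col (majority M) (\<lambda>r c. real c \<le> (7 / 6 + 4000 * \<delta>) * real (length M) + 10 * real L)
      \<le> real (length M) * exp (- (real L powr (1 / 10)))"
proof -
  obtain m0 where m0: "\<And>m. m \<ge> m0 \<Longrightarrow> 600 \<le> m \<and> 10 \<le> \<delta> * real m \<and> eps m \<le> \<delta> / 5 \<and> 4 \<le> eps m * real m \<and>
    1 \<le> nat \<lfloor>real m powr (1 / 3)\<rfloor> \<and> nat \<lfloor>real m powr (1 / 3)\<rfloor> \<le> m \<and>
    real (nat \<lfloor>real m powr (1 / 3)\<rfloor>) * real (nat \<lfloor>real m powr (1 / 3)\<rfloor>) \<le> \<delta> * real m \<and>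
    2 * real m * exp (- (real (nat \<lfloor>real m powr (1 / 3)\<rfloor>) * (eps m / 10)\<^sup>2 / 2)) +
      (5 * real m * exp (- (\<delta>\<^sup>2 * real m / 2)) + exp (- ((eps m)\<^sup>2 * real m / 32))) \<le> exp (- (real m powr (1 / 10)))"
    using eventually_step_conditions[OF \<delta>(1)] unfolding eventually_sequentially by blast
  show ?thesis
  proof (intro exI[of _ m0] allI impI)
    fix col :: "ball \<Rightarrow> 'c" and L :: nat and M :: "ball list"
    assume L: "m0 \<le> L"
    define E where "E = exp (- (real L powr (1 / 10)))"
    assume "distinct M"
    thus "fails col (majority M) (\<lambda>r c. real c \<le> (7 / 6 + 4000 * \<delta>) * real (length M) + 10 * real L)
      \<le> real (length M) * exp (- (real L powr (1 / 10)))"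
      unfolding E_def[symmetric]
    proof (induction "length M" arbitrary: M rule: less_induct)
      case less
      show ?case
      proof (cases "length M \<le> L")
        case True
        have "0 \<le> (7 / 6 + 4000 * \<delta>) * real (length M)" using \<delta> by simp
        hence "holds col (majority M) (\<lambda>r c. real c \<le> (7 / 6 + 4000 * \<delta>) * real (length M) + 10 * real L)"
          using True by (intro holds_mono[OF holds_majority[of col M]]) linarith
        thus ?thesis by (simp add: fails_holds E_def)
      next
        case False
        hence big: "m0 \<le> length M" using L by simp
        note c = m0[OF big]
        define k where "k = (length M + 1) div 2"
        have k: "k < length M" "2 * k \<le> length M + 1" using c unfolding k_def by linarith+
        have "fails col (majority M) (\<lambda>r c. real c \<le> (7 / 6 + 4000 * \<delta>) * real (length M) + 10 * real L) \<le>
          2 * real (length M) * exp (- (real (nat \<lfloor>real (length M) powr (1 / 3)\<rfloor>) * (eps (length M) / 10)\<^sup>2 / 2)) +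
          (5 * real (length M) * exp (- (\<delta>\<^sup>2 * real (length M) / 2)) + exp (- ((eps (length M))\<^sup>2 * real (length M) / 32)) + real k * E)"
        proof (rule fails_majority_step[OF less.prems _ \<delta>])
          fix N :: "ball list" assume N: "distinct N" "length N \<le> (length M + 1) div 2"
          have "length N < length M" using N k by (simp add: k_def)
          hence "fails col (majority N) (\<lambda>r c. real c \<le> (7 / 6 + 4000 * \<delta>) * real (length N) + 10 * real L) \<le> real (length N) * E"
            by (rule less.hyps[OF _ N(1)])
          also have "\<dots> \<le> real k * E" using N(2) by (intro mult_right_mono) (auto simp: k_def E_def)
          finally show "fails col (majority N) (\<lambda>r c. real c \<le> (7 / 6 + 4000 * \<delta>) * real (length N) + 10 * real L) \<le> real k * E" .
        qed (use c in \<open>auto simp: E_def\<close>)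
        also have "\<dots> \<le> exp (- (real (length M) powr (1 / 10))) + real k * E" using c by linarith
        also have "exp (- (real (length M) powr (1 / 10))) \<le> E"
          unfolding E_def using False by (auto intro!: powr_mono2)
        also have "E + real k * E = real (k + 1) * E" by (simp add: algebra_simps)
        also have "\<dots> \<le> real (length M) * E" using k by (intro mult_right_mono) (auto simp: E_def)
        finally show ?thesis by simp
      qed
    qed
  qed
qed

section \<open>The distribution of the number of comparisons\<close>

lemma comparisons_le:
  assumes "t \<in> set_pmf (comparisons col n)"
  shows "t \<le> 10 * n"
proof -
  obtain r where "(r, t) \<in> set_pmf (run col (majority [1..<n + 1]))"
    using assms by (auto simp: comparisons_def simp del: upt_Suc)
  with holds_majority[of col "[1..<n + 1]"] have "t \<le> 10 * length [1..<n + 1]"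
    unfolding holds_def by blast
  thus ?thesis by (simp del: upt_Suc)
qed

lemma prob_comparisons:
  fixes col :: "ball \<Rightarrow> nat"
  shows "measure_pmf.prob (comparisons col n) {t. \<not> real t \<le> b} = fails col (majority [1..<n + 1]) (\<lambda>r c. real c \<le> b)"
  by (simp add: comparisons_def fails_def measure_map_pmf vimage_def case_prod_unfold)

text \<open>The cutoff is about sqrt n: then 10 * L is sublinear, while L^(1/10), about n^(1/20),
  outgrows (ln n)^2. Of 5000 * \<delta> \<le> \<kappa>, the recursion takes 4000 * \<delta> and the
  cutoff term 1000 * \<delta>.\<close>

lemma comparisons_tail:
  fixes \<kappa> :: real
  assumes "0 < \<kappa>"
  shows "\<forall>\<^sub>F n in sequentially. \<forall>col :: ball \<Rightarrow> nat.
    measure_pmf.prob (comparisons col n) {t. \<not> real t \<le> 7 / 6 * real n + \<kappa> * real n} \<le> exp (- ((ln (real n))\<^sup>2))"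
proof -
  define \<delta> where "\<delta> = min (\<kappa> / 5000) (1 / 10000)"
  have \<delta>: "0 < \<delta>" "\<delta> \<le> 1 / 10000" "5000 * \<delta> \<le> \<kappa>" using assms by (auto simp: \<delta>_def min_def)
  obtain m0 where m0: "\<And>(col :: ball \<Rightarrow> nat) L M. m0 \<le> L \<Longrightarrow> distinct M \<Longrightarrow>
    fails col (majority M) (\<lambda>r c. real c \<le> (7 / 6 + 4000 * \<delta>) * real (length M) + 10 * real L)
      \<le> real (length M) * exp (- (real L powr (1 / 10)))" using fails_majority[OF \<delta>(1,2)] by blast
  have 1: "\<forall>\<^sub>F n :: nat in sequentially. real m0 \<le> sqrt (real n)" by real_asymp
  have 2: "\<forall>\<^sub>F n :: nat in sequentially. 10 * (sqrt (real n) + 1) \<le> 1000 * \<delta> * real n" using \<delta> by real_asymp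
  have 3: "\<forall>\<^sub>F n :: nat in sequentially. real n * exp (- (sqrt (real n) powr (1 / 10))) \<le> exp (- ((ln (real n))\<^sup>2))"
    by real_asymp
  show ?thesis using 1 2 3
  proof eventually_elim
    case (elim n)
    define L where "L = nat \<lceil>sqrt (real n)\<rceil>"
    have L: "sqrt (real n) \<le> real L" "real L \<le> sqrt (real n) + 1" proof -
      have "real L = of_int \<lceil>sqrt (real n)\<rceil>" by (simp add: L_def)
      thus "sqrt (real n) \<le> real L" "real L \<le> sqrt (real n) + 1" by linarith+
    qed
    show ?case
    proof
      fix col :: "ball \<Rightarrow> nat"
      have "m0 \<le> L" using L elim(1) by linarith
      have "measure_pmf.prob (comparisons col n) {t. \<not> real t \<le> 7 / 6 * real n + \<kappa> * real n} \<le>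
        measure_pmf.prob (comparisons col n) {t. \<not> real t \<le> (7 / 6 + 4000 * \<delta>) * real (length [1..<n + 1]) + 10 * real L}"
      proof (intro measure_pmf.finite_measure_mono subsetI)
        fix t assume "t \<in> {t. \<not> real t \<le> 7 / 6 * real n + \<kappa> * real n}"
        moreover have "5000 * \<delta> * real n \<le> \<kappa> * real n" using \<delta> by (intro mult_right_mono) auto
        ultimately show "t \<in> {t. \<not> real t \<le> (7 / 6 + 4000 * \<delta>) * real (length [1..<n + 1]) + 10 * real L}"
          using elim(2) L by (simp add: algebra_simps)
      qed auto
      also have "\<dots> \<le> real (length [1..<n + 1]) * exp (- (real L powr (1 / 10)))"
        unfolding prob_comparisons using \<open>m0 \<le> L\<close> by (intro m0) auto
      also have "\<dots> \<le> real n * exp (- (sqrt (real n) powr (1 / 10)))"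
        using L by (auto intro!: mult_left_mono powr_mono2)
      also have "\<dots> \<le> exp (- ((ln (real n))\<^sup>2))" by (rule elim(3))
      finally show "measure_pmf.prob (comparisons col n) {t. \<not> real t \<le> 7 / 6 * real n + \<kappa> * real n} \<le> exp (- ((ln (real n))\<^sup>2))" .
    qed
  qed
qed

text \<open>
  Taking the least admissible additive term turns \<open>comparisons_tail\<close>, which holds for each fixed
  \<open>\<kappa>\<close>, into a single sublinear function. The worst case of \<open>10 * n\<close> comparisons makes it well defined.
\<close>

definition overhead :: "nat \<Rightarrow> nat" where
  "overhead n = (LEAST k. \<forall>col :: ball \<Rightarrow> nat.
     measure_pmf.prob (comparisons col n) {t. \<not> real t \<le> 7 / 6 * real n + real k} \<le> exp (- ((ln (real n))\<^sup>2)))"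

lemma overhead:
  fixes col :: "ball \<Rightarrow> nat"
  shows "measure_pmf.prob (comparisons col n) {t. \<not> real t \<le> 7 / 6 * real n + real (overhead n)} \<le> exp (- ((ln (real n))\<^sup>2))"
proof -
  have "\<forall>col :: ball \<Rightarrow> nat. measure_pmf.prob (comparisons col n) {t. \<not> real t \<le> 7 / 6 * real n + real (10 * n)} \<le> exp (- ((ln (real n))\<^sup>2))"
  proof
    fix col :: "ball \<Rightarrow> nat"
    have "measure_pmf.prob (comparisons col n) {t. \<not> real t \<le> 7 / 6 * real n + real (10 * n)} = 0"
    proof (subst measure_pmf_zero_iff, intro equals0I)
      fix t assume "t \<in> set_pmf (comparisons col n) \<inter> {t. \<not> real t \<le> 7 / 6 * real n + real (10 * n)}"
      thus False using comparisons_le[of t col n] by auto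
    qed
    thus "measure_pmf.prob (comparisons col n) {t. \<not> real t \<le> 7 / 6 * real n + real (10 * n)} \<le> exp (- ((ln (real n))\<^sup>2))" by simp
  qed
  thus ?thesis unfolding overhead_def by (rule LeastI2) blast
qed

lemma overhead_smallo: "(\<lambda>n. real (overhead n)) \<in> o(\<lambda>n. real n)"
proof (rule landau_o.smallI)
  fix \<kappa> :: real assume \<kappa>: "0 < \<kappa>"
  \<comment> \<open>The other half of \<open>\<kappa>\<close> pays for rounding up to a natural
    number.\<close>
  have "0 < \<kappa> / 2" using \<kappa> by simp
  note tail = comparisons_tail[OF this]
  have "\<forall>\<^sub>F n :: nat in sequentially. 1 \<le> \<kappa> / 2 * real n" using \<kappa> by real_asymp
  with tail show "\<forall>\<^sub>F n in sequentially. norm (real (overhead n)) \<le> \<kappa> * norm (real n)"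
  proof eventually_elim
    case (elim n)
    define k where "k = nat \<lceil>\<kappa> / 2 * real n\<rceil>"
    have k: "\<kappa> / 2 * real n \<le> real k" "real k \<le> \<kappa> / 2 * real n + 1"
    proof -
      have "real k = of_int \<lceil>\<kappa> / 2 * real n\<rceil>" using elim(2) by (simp add: k_def)
      thus "\<kappa> / 2 * real n \<le> real k" "real k \<le> \<kappa> / 2 * real n + 1" by linarith+
    qed
    have "overhead n \<le> k" unfolding overhead_def
    proof (rule Least_le, rule allI)
      fix col :: "ball \<Rightarrow> nat"
      have "measure_pmf.prob (comparisons col n) {t. \<not> real t \<le> 7 / 6 * real n + real k} \<le>
        measure_pmf.prob (comparisons col n) {t. \<not> real t \<le> 7 / 6 * real n + \<kappa> / 2 * real n}"
        using k by (intro measure_pmf.finite_measure_mono) auto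
      with elim(1) show "measure_pmf.prob (comparisons col n) {t. \<not> real t \<le> 7 / 6 * real n + real k} \<le> exp (- ((ln (real n))\<^sup>2))"
        by (meson order.trans)
    qed
    hence "real (overhead n) \<le> \<kappa> / 2 * real n + 1" using k by linarith
    thus ?case using elim(2) by simp
  qed
qed

theorem theorem3p3:
  shows "(\<exists>f \<in> o(\<lambda>n. real n). \<exists>c > 0. \<forall>n \<ge> 1. \<forall>col :: ball \<Rightarrow> nat.
            measure_pmf.prob (comparisons col n) {t. real t \<le> 7 / 6 * real n + f n}
              \<ge> 1 - exp (- c * (ln (real n))\<^sup>2))
       \<and> (\<exists>f \<in> o(\<lambda>n. real n). \<forall>n \<ge> 1. \<forall>col :: ball \<Rightarrow> nat.
            measure_pmf.expectation (comparisons col n) real \<le> 7 / 6 * real n + f n)"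
proof (intro conjI bexI exI[of _ 1] allI impI)
  fix n :: nat and col :: "ball \<Rightarrow> nat"
  let ?B = "{t. \<not> real t \<le> 7 / 6 * real n + real (overhead n)}"
  have "measure_pmf.prob (comparisons col n) {t. real t \<le> 7 / 6 * real n + real (overhead n)} =
    1 - measure_pmf.prob (comparisons col n) ?B"
    using measure_pmf.prob_compl[of ?B "comparisons col n"] by (simp add: Compl_eq_Diff_UNIV[symmetric] Collect_neg_eq[symmetric])
  with overhead[of col n]
  show "measure_pmf.prob (comparisons col n) {t. real t \<le> 7 / 6 * real n + real (overhead n)} \<ge> 1 - exp (- 1 * (ln (real n))\<^sup>2)"
    by simp
  \<comment> \<open>On the failure event the worst case of 10 * n is charged, which adds 10 * n *
    exp(-(ln n)^2) to the expectation; this is o(n).\<close>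
  have "expct (comparisons col n) real \<le> expct (comparisons col n) (\<lambda>t. (7 / 6 * real n + real (overhead n)) + 10 * real n * indicator ?B t)"
  proof (intro expct_mono finite_comparisons)
    fix t assume "t \<in> set_pmf (comparisons col n)"
    hence "t \<le> 10 * n" by (rule comparisons_le)
    thus "real t \<le> (7 / 6 * real n + real (overhead n)) + 10 * real n * indicator ?B t"
      by (auto simp: indicator_def)
  qed
  also have "\<dots> = (7 / 6 * real n + real (overhead n)) + 10 * real n * measure_pmf.prob (comparisons col n) ?B"
    by (subst Bochner_Integration.integral_add) (auto intro: integrable_measure_pmf_finite finite_comparisons)
  also have "\<dots> \<le> (7 / 6 * real n + real (overhead n)) + 10 * real n * exp (- ((ln (real n))\<^sup>2))"
    by (intro add_left_mono mult_left_mono overhead) auto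
  finally show "measure_pmf.expectation (comparisons col n) real \<le>
      7 / 6 * real n + (real (overhead n) + 10 * real n * exp (- ((ln (real n))\<^sup>2)))"
    by simp
next
  have "(\<lambda>n :: nat. 10 * real n * exp (- ((ln (real n))\<^sup>2))) \<in> o(\<lambda>n. real n)" by real_asymp
  thus "(\<lambda>n. real (overhead n) + 10 * real n * exp (- ((ln (real n))\<^sup>2))) \<in> o(\<lambda>n. real n)"
    by (intro sum_in_smallo overhead_smallo)
qed (auto intro: overhead_smallo)

end
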